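(* For all $k$-partite states $\rho,\sigma$, \[ R_{\mathrm{LOCCq}}(\rho,\sigma)=\inf_{\substack{E\in\mathcal{F}_k\\ E(\sigma)\neq0}}\frac{E(\rho)}{E(\sigma)}. \]
   Context: A $k$-partite state is a density operator on $\mathcal{H}_1\otimes\cdots\otimes\mathcal{H}_k$ (finite-dimensional factors); tensor products group corresponding factors. $\mathrm{GHZ}$ is the state with vector $2^{-1/2}(|0\ldots0\rangle+|1\ldots1\rangle)\in(\mathbb{C}^2)^{\otimes k}$. Purified distance $D(\rho,\sigma)=\sqrt{1-F(\rho,\sigma)^2}$, $F(\rho,\sigma)=\operatorname{Tr}\sqrt{\sigma^{1/2}\rho\sigma^{1/2}}$; $\rho\to_\epsilon\sigma$ means some LOCC channel $\Lambda$ has $D(\Lambda(\rho),\sigma)\le\epsilon$. Write $\rho\ge\sigma$ iff $\limsup_{n\to\infty}\inf\{\epsilon\ge0:\rho^{\otimes n}\to_\epsilon\sigma^{\otimes n}\}=0$. $\mathcal{F}_k$ is the set of maps $E$ from $k$-partite states (of all finite dimensions) to $\mathbb{R}$ such that $E(\mathrm{GHZ})=1$, $E(\rho\otimes\sigma)=E(\rho)+E(\sigma)$ for all $\rho,\sigma$, and $\rho\ge\sigma$ implies $E(\rho)\ge E(\sigma)$. $r\ge0$ is an achievable rate if for every $\delta>0$, $\limsup_{n\to\infty}\inf\{\epsilon\ge0:\rho^{\otimes n}\otimes\mathrm{GHZ}^{\otimes\lfloor\delta n\rfloor}\to_\epsilon\sigma^{\otimes\lceil rn\rceil}\}=0$;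 $R_{\mathrm{LOCCq}}(\rho,\sigma)$ is the supremum of achievable rates. The infimum over an empty set is $+\infty$. *)

theory Defs
  imports "HOL-Library.Extended_Real" "HOL-Library.Liminf_Limsup" "Jordan_Normal_Form.Matrix"
begin

text \<open>A k-partite state is represented as a pair (ds, A): ds is the list of local
dimensions (length k), A is a density matrix of size prod_list ds, acting on
C^(ds!0) (x) ... (x) C^(ds!(k-1)); basis index of the tensor product uses the
mixed-radix (lexicographic) encoding below.\<close>

type_synonym kstate = "nat list \<times> complex mat"

fun decode :: "nat list \<Rightarrow> nat \<Rightarrow> nat list" where
  "decode [] n = []"
| "decode (d # ds) n = (n div prod_list ds) # decode ds (n mod prod_list ds)"

fun encode :: "nat list \<Rightarrow> nat list \<Rightarrow> nat" where
  "encode (d # ds) (x # xs) = x * prod_list ds + encode ds xs"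
| "encode _ _ = 0"

definition mtrace :: "complex mat \<Rightarrow> complex" where
  "mtrace A = (\<Sum>i<dim_row A. A $$ (i, i))"

definition adj :: "complex mat \<Rightarrow> complex mat" where
  "adj A = mat (dim_col A) (dim_row A) (\<lambda>(i, j). cnj (A $$ (j, i)))"

definition psd :: "nat \<Rightarrow> complex mat \<Rightarrow> bool" where
  "psd n A \<longleftrightarrow> A \<in> carrier_mat n n \<and>
     (\<forall>v :: nat \<Rightarrow> complex. let q = (\<Sum>i<n. \<Sum>j<n. cnj (v i) * A $$ (i, j) * v j)
        in Im q = 0 \<and> Re q \<ge> 0)"

definition is_density :: "nat \<Rightarrow> complex mat \<Rightarrow> bool" where
  "is_density n A \<longleftrightarrow> psd n A \<and> mtrace A = 1"

definition kstate :: "nat \<Rightarrow> kstate \<Rightarrow> bool" where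
  "kstate k \<rho> \<longleftrightarrow> length (fst \<rho>) = k \<and> is_density (prod_list (fst \<rho>)) (snd \<rho>)"

text \<open>Tensor product of k-partite states, grouping corresponding factors:
party t of the result is H_t (x) K_t (local index c = a * dim K_t + b).\<close>
definition tensor_st :: "kstate \<Rightarrow> kstate \<Rightarrow> kstate" where
  "tensor_st \<rho> \<sigma> =
    (let d = fst \<rho>; e = fst \<sigma>; de = map2 (*) d e; N = prod_list de in
     (de, mat N N (\<lambda>(i, j). let x = decode de i; y = decode de j in
        snd \<rho> $$ (encode d (map2 (div) x e), encode d (map2 (div) y e)) *
        snd \<sigma> $$ (encode e (map2 (mod) x e), encode e (map2 (mod) y e)))))"

definition unit_st :: "nat \<Rightarrow> kstate" where
  "unit_st k = (replicate k 1, 1\<^sub>m 1)"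

fun tpow :: "kstate \<Rightarrow> nat \<Rightarrow> kstate" where
  "tpow \<rho> 0 = unit_st (length (fst \<rho>))"
| "tpow \<rho> (Suc n) = tensor_st \<rho> (tpow \<rho> n)"

definition GHZ :: "nat \<Rightarrow> kstate" where
  "GHZ k = (let N = 2 ^ k in (replicate k 2,
     mat N N (\<lambda>(i, j). if i \<in> {0, N - 1} \<and> j \<in> {0, N - 1} then 1 / 2 else 0)))"

definition psd_sqrt :: "complex mat \<Rightarrow> complex mat" where
  "psd_sqrt A = (THE B. psd (dim_row A) B \<and> B * B = A)"

definition fidelity :: "complex mat \<Rightarrow> complex mat \<Rightarrow> real" where
  "fidelity \<rho> \<sigma> = Re (mtrace (psd_sqrt (psd_sqrt \<sigma> * \<rho> * psd_sqrt \<sigma>)))"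

definition pdist :: "complex mat \<Rightarrow> complex mat \<Rightarrow> real" where
  "pdist \<rho> \<sigma> = sqrt (1 - (fidelity \<rho> \<sigma>)\<^sup>2)"

definition lift_local :: "nat list \<Rightarrow> nat list \<Rightarrow> nat \<Rightarrow> complex mat \<Rightarrow> complex mat" where
  "lift_local din dout j L = mat (prod_list dout) (prod_list din) (\<lambda>(a, b).
     let x = decode dout a; y = decode din b in
     if (\<forall>t<length din. t \<noteq> j \<longrightarrow> x ! t = y ! t) then L $$ (x ! j, y ! j) else 0)"

text \<open>LOCC instruments (finite rounds): a list of branches (outcomes), each branch a
CP map given by a list of (global) Kraus operators. Generated by local instruments
of a single party and by adaptive composition (the next instrument may depend on
the broadcast outcome).\<close>
inductive locc_instr :: "nat list \<Rightarrow> nat list \<Rightarrow> complex mat list list \<Rightarrow> bool" where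
  local: "j < length din \<Longrightarrow> length dout = length din \<Longrightarrow>
    (\<forall>t<length din. t \<noteq> j \<longrightarrow> dout ! t = din ! t) \<Longrightarrow>
    (\<forall>Ls\<in>set Lss. \<forall>L\<in>set Ls. L \<in> carrier_mat (dout ! j) (din ! j)) \<Longrightarrow>
    (\<forall>a<din ! j. \<forall>b<din ! j.
        sum_list (map (\<lambda>L. (adj L * L) $$ (a, b)) (concat Lss)) = (if a = b then 1 else 0)) \<Longrightarrow>
    locc_instr din dout (map (map (lift_local din dout j)) Lss)"
| compose: "locc_instr d d' Fs \<Longrightarrow> length Gss = length Fs \<Longrightarrow>
    (\<forall>i<length Fs. locc_instr d' d'' (Gss ! i)) \<Longrightarrow>
    locc_instr d d''
      (concat (map (\<lambda>(Fb, Gs). map (\<lambda>Gb. [G * F. F \<leftarrow> Fb, G \<leftarrow> Gb]) Gs) (zip Fs Gss)))"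

definition apply_instr :: "nat list \<Rightarrow> complex mat list list \<Rightarrow> complex mat \<Rightarrow> complex mat" where
  "apply_instr dout Ks A = mat (prod_list dout) (prod_list dout)
     (\<lambda>(a, b). sum_list (map (\<lambda>K. (K * A * adj K) $$ (a, b)) (concat Ks)))"

definition converts :: "kstate \<Rightarrow> kstate \<Rightarrow> real \<Rightarrow> bool" where
  "converts \<rho> \<sigma> \<epsilon> \<longleftrightarrow> (\<exists>Ks. locc_instr (fst \<rho>) (fst \<sigma>) Ks \<and>
      pdist (apply_instr (fst \<sigma>) Ks (snd \<rho>)) (snd \<sigma>) \<le> \<epsilon>)"

definition opt_err :: "kstate \<Rightarrow> kstate \<Rightarrow> ereal" where
  "opt_err \<rho> \<sigma> = Inf {ereal \<epsilon> | \<epsilon>. \<epsilon> \<ge> 0 \<and> converts \<rho> \<sigma> \<epsilon>}"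

definition asym_ge :: "kstate \<Rightarrow> kstate \<Rightarrow> bool" where
  "asym_ge \<rho> \<sigma> \<longleftrightarrow> limsup (\<lambda>n. opt_err (tpow \<rho> n) (tpow \<sigma> n)) = 0"

definition monotones :: "nat \<Rightarrow> (kstate \<Rightarrow> real) set" where
  "monotones k = {E. E (GHZ k) = 1 \<and>
     (\<forall>\<rho> \<sigma>. kstate k \<rho> \<longrightarrow> kstate k \<sigma> \<longrightarrow> E (tensor_st \<rho> \<sigma>) = E \<rho> + E \<sigma>) \<and>
     (\<forall>\<rho> \<sigma>. kstate k \<rho> \<longrightarrow> kstate k \<sigma> \<longrightarrow> asym_ge \<rho> \<sigma> \<longrightarrow> E \<rho> \<ge> E \<sigma>)}"

definition achievable :: "nat \<Rightarrow> kstate \<Rightarrow> kstate \<Rightarrow> real \<Rightarrow> bool" where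
  "achievable k \<rho> \<sigma> r \<longleftrightarrow> r \<ge> 0 \<and> (\<forall>\<delta>>0.
     limsup (\<lambda>n. opt_err (tensor_st (tpow \<rho> n) (tpow (GHZ k) (nat \<lfloor>\<delta> * real n\<rfloor>)))
                         (tpow \<sigma> (nat \<lceil>r * real n\<rceil>))) = 0)"

definition R_LOCCq :: "nat \<Rightarrow> kstate \<Rightarrow> kstate \<Rightarrow> ereal" where
  "R_LOCCq k \<rho> \<sigma> = Sup {ereal r | r. achievable k \<rho> \<sigma> r}"

end

theory Submission
  imports Defs "Jordan_Normal_Form.Schur_Decomposition"
    "HOL-Computational_Algebra.Fundamental_Theorem_Algebra"
begin

text \<open>
  Upper bound: if \<open>r\<close> is achievable then, restricting to \<open>n = N m\<close> with \<open>\<delta> = 1/N\<close>, one gets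
  \<open>\<rho>\<^bsup>\<otimes>N\<^esup> \<otimes> GHZ \<ge> \<sigma>\<^bsup>\<otimes>\<lfloor>rN\<rfloor>\<^esup>\<close>, hence \<open>N E(\<rho>) + 1 \<ge> (rN - 1) E(\<sigma>)\<close> for every monotone \<open>E\<close>; let \<open>N \<rightarrow> \<infinity>\<close>.

  Lower bound: states modulo asymptotic conversion form a preordered commutative monoid in which every
  element is \<open>\<ge> 0\<close> and GHZ is an order unit. Adjoin \<open>p \<sigma> \<ge> K \<rho> + GHZ\<close> to the order, where \<open>p/K\<close> is slightly
  above \<open>r\<close>. If the enlarged order is non-degenerate, a Hahn-Banach argument (a minimal sublinear functional
  is additive) gives a monotone with \<open>E(\<rho>) / E(\<sigma>) < p/K\<close>; if it degenerates, unwinding the degeneracy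
  yields \<open>\<rho>\<^bsup>\<otimes>WK\<^esup> \<otimes> GHZ\<^bsup>\<otimes>2W\<^esup> \<ge> \<sigma>\<^bsup>\<otimes>Wp\<^esup>\<close> for some \<open>W\<close>, which makes \<open>r\<close> achievable.

  Two inputs carry the quantum content. Fidelity is the maximum of \<open>Re (tr X)\<close> over all \<open>X\<close> for which the
  block matrix with rows \<open>(\<rho>, X)\<close> and \<open>(X\<^sup>*, \<sigma>)\<close> is positive; in this form monotonicity under Kraus maps is
  immediate and an approximate triangle inequality follows from polar decomposition. GHZ is an order unit
  because a large GHZ state \<open>\<Sum>\<^sub>x |x\<dots>x\<rangle>\<close> can be reshaped to \<open>\<Sum>\<^sub>x \<psi>\<^sub>x |x\<dots>x\<rangle>\<close> by one measurement followed by
  shifts, after which each party erases the digits of \<open>x\<close> that it should not hold by a Fourier measurement,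
  whose phase the other parties undo locally.
\<close>

subsection \<open>Additive functionals on preordered multisets\<close>

text \<open>The tensor product commutes only up to local relabelling, so the separation argument
  runs on multisets, where sums commute on the nose; states enter through products of listings, and
  any two listings of a multiset convert into each other. The first sublinear functional moves by
  exactly 1 when GHZ is added because the order is cancellative. The enlarged order therefore
  permits, besides the adjoined inequality, an arbitrary catalyst on both sides. Removing it is the
  work in the degenerate case: every round returns the catalyst, so it is bought once with GHZ and
  its price is spread over many rounds. The summand GHZ in
  \<open>p \<sigma> \<ge> K \<rho> + GHZ\<close> forces \<open>E(\<sigma>) \<noteq> 0\<close>, so
  the separating functional takes part in the infimum. It also fixes the price: \<open>W\<close>
  uses of the adjoined inequality account for \<open>W\<close> copies of GHZ and the catalyst for at
  most \<open>W\<close> more, hence \<open>2W\<close> per \<open>W K\<close> copies of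
  \<open>\<rho>\<close>. This is the rate \<open>2/K\<close>, which any \<open>\<delta>\<close>
  exceeds once \<open>K\<close> is large. Since GHZ copies yield any fixed state exactly, a constant
  number of them also pays for the remainder when a conversion of blocks is stretched to all
  lengths.\<close>

lemma inf_chain_add_le:
  fixes f g h :: "'b \<Rightarrow> real"
  assumes ne: "C \<noteq> {}" and lin: "\<And>a b. a \<in> C \<Longrightarrow> b \<in> C \<Longrightarrow> \<exists>c\<in>C. f c \<le> g a + h b"
    and bd: "\<And>c. c \<in> C \<Longrightarrow> 0 \<le> f c"
  shows "(INF c\<in>C. f c) \<le> (INF c\<in>C. g c) + (INF c\<in>C. h c)"
proof -
  have *: "(INF c\<in>C. f c) \<le> g a + h b" if ab: "a \<in> C" "b \<in> C" for a b
  proof -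
    obtain c where "c \<in> C" "f c \<le> g a + h b" using lin[OF ab] by blast
    moreover have "bdd_below (f ` C)" using bd by (auto intro!: bdd_belowI[of _ 0])
    ultimately show ?thesis using cINF_lower[of f C c] by linarith
  qed
  have "(INF c\<in>C. f c) - h b \<le> (INF c\<in>C. g c)" if "b \<in> C" for b
    using *[OF _ that] by (intro cINF_greatest[OF ne]) (force simp: algebra_simps)
  hence "(INF c\<in>C. f c) - (INF c\<in>C. g c) \<le> (INF c\<in>C. h c)"
    by (intro cINF_greatest[OF ne]) (force simp: algebra_simps)
  thus ?thesis by simp
qed

locale ordered_multisets =
  fixes R :: "'a multiset \<Rightarrow> 'a multiset \<Rightarrow> bool" and U :: "'a multiset"
  assumes R_refl: "R A A"
    and R_trans: "R A B \<Longrightarrow> R B C \<Longrightarrow> R A C"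
    and R_add: "R A B \<Longrightarrow> R (A + C) (B + C)"
    and R_pos: "R A {#}"
    and R_unit: "\<exists>n. R (repeat_mset n U) A"
begin

lemma R_add2: "R A B \<Longrightarrow> R A' B' \<Longrightarrow> R (A + A') (B + B')"
  using R_add[of A B A'] R_add[of A' B' B] R_trans by (metis add.commute)

lemma R_repeat: "R A B \<Longrightarrow> R (repeat_mset n A) (repeat_mset n B)"
  by (induction n) (auto simp: R_refl intro: R_add2)

lemma R_weaken: "R (A + B) A"
  using R_add2[OF R_refl R_pos] by simp

lemma R_repeat_le: "m \<le> n \<Longrightarrow> R (repeat_mset n A) (repeat_mset m A)"
  using R_weaken[of "repeat_mset m A" "repeat_mset (n - m) A"]
  by (simp flip: repeat_mset_distrib)

text \<open>Each conversion hands \<open>Z\<close> back, so a single copy of the catalyst serves all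
  \<open>j\<close> rounds.\<close>

lemma R_catalyst_iterate:
  assumes "R (A + Z) (B + Z)"
  shows "R (repeat_mset j A + Z) (repeat_mset j B + Z)"
proof (induction j)
  case (Suc j)
  have "R (A + (repeat_mset j A + Z)) (A + (repeat_mset j B + Z))"
    using R_add2[OF R_refl Suc] .
  moreover have "R (A + Z + repeat_mset j B) (B + Z + repeat_mset j B)"
    using R_add[OF assms] .
  moreover have "A + (repeat_mset j B + Z) = A + Z + repeat_mset j B" by (simp add: ac_simps)
  ultimately have "R (A + (repeat_mset j A + Z)) (B + Z + repeat_mset j B)" using R_trans by simp
  thus ?case by (simp add: ac_simps)
qed (simp add: R_refl)

text \<open>The clause for \<open>A + U\<close> is stronger than \<open>p U = 1\<close>. It passes
  to the shifted functional below, whereas from \<open>p U = 1\<close> alone the shifted value at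
  \<open>U\<close> could drop below 1.\<close>

definition sublinear :: "('a multiset \<Rightarrow> real) \<Rightarrow> bool" where
  "sublinear p \<longleftrightarrow> (\<forall>A B. p (A + B) \<le> p A + p B) \<and> (\<forall>n A. p (repeat_mset n A) = real n * p A)
     \<and> (\<forall>A B. R A B \<longrightarrow> p B \<le> p A) \<and> (\<forall>A. p (A + U) = p A + 1) \<and> (\<forall>A. 0 \<le> p A)"

text \<open>Since \<open>q \<le> p\<close> is again sublinear, a minimal \<open>p\<close> equals \<open>q\<close>, and then
  \<open>p A + p Z \<le> p (A + Z)\<close>: minimal sublinear functionals are additive.\<close>

lemma sublinear_shift:
  fixes Z :: "'a multiset"
  assumes p: "sublinear p"
  defines "q \<equiv> \<lambda>A. INF n. p (A + repeat_mset n Z) - real n * p Z"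
  shows "sublinear q" and "q A \<le> p A" and "q A \<le> p (A + Z) - p Z"
proof -
  have sub: "\<And>A B. p (A + B) \<le> p A + p B" and hom: "\<And>n A. p (repeat_mset n A) = real n * p A"
    and mono: "\<And>A B. R A B \<Longrightarrow> p B \<le> p A" and trans: "\<And>A. p (A + U) = p A + 1" and nn: "\<And>A. 0 \<le> p A"
    using p unfolding sublinear_def by blast+
  let ?h = "\<lambda>A n. p (A + repeat_mset n Z) - real n * p Z"
  have h0: "0 \<le> ?h A n" for A n
  proof -
    have "p (repeat_mset n Z) \<le> p (A + repeat_mset n Z)"
      by (rule mono) (metis R_weaken add.commute)
    thus ?thesis by (simp add: hom)
  qed
  have bd: "bdd_below (range (?h A))" for A using h0 by (auto intro!: bdd_belowI[of _ 0])
  have q_le: "q A \<le> ?h A n" for A n unfolding q_def by (rule cINF_lower[OF bd]) simp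
  have q_ge: "c \<le> q A" if "\<And>n. c \<le> ?h A n" for c A
    unfolding q_def by (rule cINF_greatest) (use that in auto)
  \<comment> \<open>Subadditivity makes the differences decrease in \<open>n\<close>, so indices may
    be enlarged freely; homogeneity below compares \<open>n * l\<close> with \<open>l\<close> in
    this way.\<close>
  have hdec: "?h A m \<le> ?h A n" if "n \<le> m" for A n m
  proof -
    have "p ((A + repeat_mset n Z) + repeat_mset (m - n) Z) \<le> p (A + repeat_mset n Z) + real (m - n) * p Z"
      using sub hom by metis
    moreover have "(A + repeat_mset n Z) + repeat_mset (m - n) Z = A + repeat_mset m Z"
      using that by (simp add: add.assoc flip: repeat_mset_distrib)
    ultimately show ?thesis using that by (simp add: of_nat_diff algebra_simps)
  qed
  show "q A \<le> p A" using q_le[of A 0] by simp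
  show "q A \<le> p (A + Z) - p Z" using q_le[of A 1] by simp
  have qsub: "q (A + B) \<le> q A + q B" for A B
    unfolding q_def
  proof (rule inf_chain_add_le)
    \<comment> \<open>A single index has to serve both summands, and \<open>n + m\<close>
      does.\<close>
    fix n m :: nat
    have "p (A + B + repeat_mset (n + m) Z) \<le> p (A + repeat_mset n Z) + p (B + repeat_mset m Z)"
      using sub[of "A + repeat_mset n Z" "B + repeat_mset m Z"]
      by (simp add: repeat_mset_distrib ac_simps)
    thus "\<exists>c\<in>UNIV. ?h (A + B) c \<le> ?h A n + ?h B m"
      by (intro bexI[of _ "n + m"]) (auto simp: algebra_simps)
  qed (use h0 in auto)
  have q00: "q {#} = 0" 
    using q_le[of "{#}" 0] q_ge[of 0 "{#}"] h0 hom[of 0] by fastforce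
  have qhom: "q (repeat_mset n A) = real n * q A" for n A
  proof (rule antisym)
    show "q (repeat_mset n A) \<le> real n * q A"
    proof (induction n)
      case (Suc n)
      thus ?case using qsub[of A "repeat_mset n A"] by (simp add: algebra_simps)
    qed (simp add: q00)
    show "real n * q A \<le> q (repeat_mset n A)"
    proof (cases "n = 0")
      case False
      show ?thesis
      proof (rule q_ge)
        fix l
        have "real n * q A \<le> real n * ?h A l"
          using q_le[of A l] by (intro mult_left_mono) auto
        also have "\<dots> = ?h (repeat_mset n A) (n * l)"
          using hom[of n "A + repeat_mset l Z"] by (simp add: algebra_simps repeat_mset_distrib2)
        also have "\<dots> \<le> ?h (repeat_mset n A) l" by (rule hdec) (use False in auto)
        finally show "real n * q A \<le> ?h (repeat_mset n A) l" .
      qed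
    qed (simp add: q00)
  qed
  show "sublinear q"
    unfolding sublinear_def
  proof (intro conjI allI impI qsub qhom)
    fix A B assume "R A B"
    show "q B \<le> q A"
    proof (rule q_ge)
      fix n
      show "q B \<le> ?h A n" using q_le[of B n] mono[OF R_add[OF \<open>R A B\<close>], of "repeat_mset n Z"] by linarith
    qed
  next
    fix A
    have e: "?h (A + U) n = ?h A n + 1" for n
      using trans[of "A + repeat_mset n Z"] by (simp add: ac_simps)
    show "q (A + U) = q A + 1"
    proof (rule antisym)
      have "q (A + U) - 1 \<le> q A" by (rule q_ge) (use q_le[of "A + U"] e in \<open>force simp: algebra_simps\<close>)
      thus "q (A + U) \<le> q A + 1" by simp
      show "q A + 1 \<le> q (A + U)" by (rule q_ge) (use q_le[of A] e in force)
    qed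
  next
    fix A show "0 \<le> q A" by (rule q_ge) (rule h0)
  qed
qed

text \<open>Zorn's lemma needs lower bounds of chains. A pointwise infimum of subadditive
  functionals need not be subadditive in general; in a chain the smaller of two members serves both
  summands.\<close>

lemma sublinear_chain_INF:
  assumes ne: "C \<noteq> {}" and C: "\<And>p. p \<in> C \<Longrightarrow> sublinear p"
    and chain: "\<And>p q. p \<in> C \<Longrightarrow> q \<in> C \<Longrightarrow> p \<le> q \<or> q \<le> p"
  defines "q \<equiv> \<lambda>A. INF p\<in>C. p A"
  shows "sublinear q" and "\<And>p. p \<in> C \<Longrightarrow> q \<le> p"
proof -
  have nn: "0 \<le> p A" if "p \<in> C" for p A using C[OF that] unfolding sublinear_def by blast
  have bd: "bdd_below ((\<lambda>p. p A) ` C)" for A using nn by (auto intro!: bdd_belowI[of _ 0])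
  have q_le: "q A \<le> p A" if "p \<in> C" for p A unfolding q_def by (rule cINF_lower[OF bd that])
  have q_ge: "c \<le> q A" if "\<And>p. p \<in> C \<Longrightarrow> c \<le> p A" for c A
    unfolding q_def by (rule cINF_greatest[OF ne that])
  show "q \<le> p" if "p \<in> C" for p using q_le[OF that] by (simp add: le_fun_def)
  show "sublinear q"
    unfolding sublinear_def
  proof (intro conjI allI impI)
    fix A B
    show "q (A + B) \<le> q A + q B"
      unfolding q_def
    proof (rule inf_chain_add_le[OF ne])
      fix a b assume ab: "a \<in> C" "b \<in> C"
      have sub: "\<And>p A B. p \<in> C \<Longrightarrow> p (A + B) \<le> p A + p B" using C unfolding sublinear_def by blast
      show "\<exists>c\<in>C. c (A + B) \<le> a A + b B"
        using chain[OF ab] sub[OF ab(1), of A B] sub[OF ab(2), of A B] ab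
        by (metis add_mono le_fun_def order_refl order_trans)
    qed (rule nn)
  next
    fix n A
    have hom: "\<And>p. p \<in> C \<Longrightarrow> p (repeat_mset n A) = real n * p A" using C unfolding sublinear_def by blast
    show "q (repeat_mset n A) = real n * q A"
    proof (rule antisym)
      show "real n * q A \<le> q (repeat_mset n A)"
        by (rule q_ge) (simp add: hom q_le mult_left_mono)
      show "q (repeat_mset n A) \<le> real n * q A"
      proof (cases "n = 0")
        case True
        then show ?thesis using q_le[of _ "repeat_mset n A"] hom ne by fastforce
      next
        case False
        have "q (repeat_mset n A) / real n \<le> q A"
          by (rule q_ge) (use False q_le[of _ "repeat_mset n A"] hom in \<open>auto simp: field_simps\<close>)
        thus ?thesis using False by (simp add: field_simps)
      qed
    qed
  next
    fix A B assume "R A B"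
    show "q B \<le> q A"
      by (rule q_ge) (use C \<open>R A B\<close> q_le in \<open>fastforce simp: sublinear_def intro: order_trans\<close>)
  next
    fix A
    have e: "\<And>p. p \<in> C \<Longrightarrow> p (A + U) = p A + 1" using C unfolding sublinear_def by blast
    show "q (A + U) = q A + 1"
    proof (rule antisym)
      have "q (A + U) - 1 \<le> q A" by (rule q_ge) (use q_le[of _ "A + U"] e in \<open>force simp: algebra_simps\<close>)
      thus "q (A + U) \<le> q A + 1" by simp
      show "q A + 1 \<le> q (A + U)" by (rule q_ge) (use q_le[of _ A] e in force)
    qed
  next
    fix A show "0 \<le> q A" by (rule q_ge) (rule nn)
  qed
qed

text \<open>The value of \<open>A\<close> is its regularized price in units: the infimum of
  \<open>t / m\<close> over conversions of \<open>t\<close> units into \<open>m\<close> copies.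
  Adding \<open>U\<close> raises the price by exactly 1 because \<open>nondeg\<close> gives
  \<open>m \<le> t\<close> and \<open>cancel\<close> then removes \<open>m\<close> units from both
  sides.\<close>

lemma sublinear_exists:
  assumes cancel: "\<And>A B C. R (A + C) (B + C) \<Longrightarrow> R A B"
    and nondeg: "\<And>t m. R (repeat_mset t U) (repeat_mset m U) \<Longrightarrow> m \<le> t"
  shows "\<exists>p. sublinear p"
proof -
  define S where "S = (\<lambda>A. {real t / real m | t m. m > 0 \<and> R (repeat_mset t U) (repeat_mset m A)})"
  define p where "p = (\<lambda>A. Inf (S A))"
  have Sne: "S A \<noteq> {}" for A
  proof -
    obtain n where "R (repeat_mset n U) A" using R_unit by blast
    hence "real n / real 1 \<in> S A" unfolding S_def
      by (intro CollectI exI[of _ n] exI[of _ "1::nat"]) simp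
    thus ?thesis by blast
  qed
  have S0: "x \<ge> 0" if "x \<in> S A" for x A using that unfolding S_def by auto
  have bd: "bdd_below (S A)" for A using S0 by (auto intro!: bdd_belowI[of _ 0])
  have p_le: "p A \<le> real t / real m" if "m > 0" "R (repeat_mset t U) (repeat_mset m A)" for A t m
    unfolding p_def by (rule cInf_lower[OF _ bd]) (use that in \<open>auto simp: S_def\<close>)
  have p_ge: "c \<le> p A" if "\<And>t m. m > 0 \<Longrightarrow> R (repeat_mset t U) (repeat_mset m A) \<Longrightarrow> c \<le> real t / real m" for c A
    unfolding p_def by (rule cInf_greatest[OF Sne]) (use that in \<open>auto simp: S_def\<close>)
  have sub: "p (A + B) \<le> p A + p B" for A B
  proof -
    have *: "p (A + B) \<le> real t / real m + real t' / real m'"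
      if a: "m > 0" "R (repeat_mset t U) (repeat_mset m A)" "m' > 0" "R (repeat_mset t' U) (repeat_mset m' B)"
      for t m t' m'
    proof -
      have "R (repeat_mset (m' * t) U + repeat_mset (m * t') U) (repeat_mset (m' * m) A + repeat_mset (m * m') B)"
        using R_add2[OF R_repeat[OF a(2), of m'] R_repeat[OF a(4), of m]] by simp
      hence "R (repeat_mset (m' * t + m * t') U) (repeat_mset (m' * m) (A + B))"
        by (simp add: repeat_mset_distrib repeat_mset_distrib2 mult.commute)
      from p_le[OF _ this] show ?thesis using a by (simp add: field_simps)
    qed
    have "p (A + B) - real t / real m \<le> p B" if "m > 0" "R (repeat_mset t U) (repeat_mset m A)" for t m
      by (rule p_ge) (use *[OF that] in \<open>force simp: algebra_simps\<close>)
    hence "p (A + B) - p B \<le> p A"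
      by (intro p_ge) (force simp: algebra_simps)
    thus ?thesis by simp
  qed
  have p0: "p {#} = 0"
  proof (rule antisym)
    show "p {#} \<le> 0" using p_le[of 1 0 "{#}"] R_refl by simp
    show "0 \<le> p {#}" by (rule p_ge) simp
  qed
  have "sublinear p"
    unfolding sublinear_def
  proof (intro conjI allI impI sub)
    fix n A
    show "p (repeat_mset n A) = real n * p A"
    proof (rule antisym)
      show "p (repeat_mset n A) \<le> real n * p A"
      proof (induction n)
        case (Suc n)
        thus ?case using sub[of A "repeat_mset n A"] by (simp add: algebra_simps)
      qed (simp add: p0)
      show "real n * p A \<le> p (repeat_mset n A)"
      proof (cases "n = 0")
        case False
        show ?thesis
        proof (rule p_ge)
          fix t m :: nat assume "m > 0" "R (repeat_mset t U) (repeat_mset m (repeat_mset n A))"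
          hence "p A \<le> real t / real (m * n)" using False by (intro p_le) auto
          thus "real n * p A \<le> real t / real m" using False \<open>m > 0\<close> by (simp add: field_simps)
        qed
      qed (simp add: p0)
    qed
  next
    fix A B assume "R A B"
    show "p B \<le> p A"
      by (rule p_ge) (use R_trans R_repeat[OF \<open>R A B\<close>] p_le in blast)
  next
    fix A
    show "p (A + U) = p A + 1"
    proof (rule antisym)
      have "p U \<le> 1" using p_le[of 1 1 U] R_refl by simp
      thus "p (A + U) \<le> p A + 1" using sub[of A U] by simp
      show "p A + 1 \<le> p (A + U)"
      proof (rule p_ge)
        fix t m :: nat assume m: "m > 0" and r: "R (repeat_mset t U) (repeat_mset m (A + U))"
        have r': "R (repeat_mset t U) (repeat_mset m A + repeat_mset m U)" using r by (simp add: repeat_mset_distrib2)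
        have "R (repeat_mset t U) (repeat_mset m U)"
          using R_trans[OF r'] R_weaken by (metis add.commute)
        hence mt: "m \<le> t" by (rule nondeg)
        hence "repeat_mset t U = repeat_mset (t - m) U + repeat_mset m U"
          by (simp flip: repeat_mset_distrib)
        hence "R (repeat_mset (t - m) U) (repeat_mset m A)" using r' cancel by metis
        from p_le[OF m this] show "p A + 1 \<le> real t / real m" using m mt by (simp add: of_nat_diff field_simps)
      qed
    qed
  next
    fix A show "0 \<le> p A" by (rule p_ge) simp
  qed
  thus ?thesis by (rule exI[of sublinear p])
qed

lemma additive_exists:
  assumes "\<And>A B C. R (A + C) (B + C) \<Longrightarrow> R A B"
    and "\<And>t m. R (repeat_mset t U) (repeat_mset m U) \<Longrightarrow> m \<le> t"
  shows "\<exists>p. (\<forall>A B. p (A + B) = p A + (p B :: real)) \<and> (\<forall>A B. R A B \<longrightarrow> p B \<le> p A) \<and> p U = 1"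
proof -
  have "\<exists>p. sublinear p" by (rule sublinear_exists) (use assms in blast)+
  then obtain p0 where p0: "sublinear p0" by (rule exE)
  \<comment> \<open>The order is reversed: a maximal element for Zorn's lemma is a minimal
    functional.\<close>
  let ?P = "\<lambda>p q :: 'a multiset \<Rightarrow> real. q \<le> p"
  have "\<exists>m\<in>Collect sublinear. \<forall>a\<in>Collect sublinear. ?P m a \<longrightarrow> a = m"
  proof (rule predicate_Zorn)
    show "partial_order_on (Collect sublinear) (relation_of ?P (Collect sublinear))"
      by (rule partial_order_on_relation_ofI) auto
    fix C assume C: "C \<in> Chains (relation_of ?P (Collect sublinear))"
    show "\<exists>u\<in>Collect sublinear. \<forall>a\<in>C. ?P a u"
    proof (cases "C = {}")
      case True
      then show ?thesis using p0 by blast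
    next
      case False
      have "\<And>p. p \<in> C \<Longrightarrow> sublinear p" and "\<And>p q. p \<in> C \<Longrightarrow> q \<in> C \<Longrightarrow> p \<le> q \<or> q \<le> p"
        using C by (auto simp: Chains_def relation_of_def)
      note sublinear_chain_INF[OF False this]
      thus ?thesis by blast
    qed
  qed
  then obtain p where p: "sublinear p" and min: "\<And>q. sublinear q \<Longrightarrow> q \<le> p \<Longrightarrow> q = p" by blast
  have "p (A + Z) = p A + p Z" for A Z
  proof (rule antisym)
    show "p (A + Z) \<le> p A + p Z" using p unfolding sublinear_def by blast
    note q = sublinear_shift[OF p, where Z = Z]
    have "(\<lambda>A. INF n. p (A + repeat_mset n Z) - real n * p Z) = p"
      by (rule min) (use q in \<open>auto simp: le_fun_def\<close>)
    from fun_cong[OF this, of A] have "p A \<le> p (A + Z) - p Z" using q(3)[of A] by linarith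
    thus "p A + p Z \<le> p (A + Z)" by simp
  qed
  moreover have "p U = 1"
  proof -
    have "p (repeat_mset 0 U) = real 0 * p U" "p ({#} + U) = p {#} + 1"
      using p unfolding sublinear_def by blast+
    thus ?thesis by simp
  qed
  ultimately show ?thesis using p unfolding sublinear_def by blast
qed

text \<open>Either some functional separates \<open>p Y\<close> from \<open>q X + U\<close>, or adding \<open>p Y \<ge> q X + U\<close> to the
  order degenerates, which unwinds to a conversion of many copies.\<close>

theorem additive_separation:
  fixes p q :: nat
  assumes no: "\<not> (\<exists>E. (\<forall>A B. E (A + B) = E A + (E B :: real)) \<and> (\<forall>A B. R A B \<longrightarrow> E B \<le> E A) \<and> E U = 1
      \<and> real q * E X + 1 \<le> real p * E Y)"
  shows "\<exists>W>0. R (repeat_mset (W * q) X + repeat_mset (2 * W) U) (repeat_mset (W * p) Y)"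
proof -
  define C where "C = repeat_mset q X + U"
  define D where "D = repeat_mset p Y"
  \<comment> \<open>\<open>n\<close> counts uses of the adjoined conversion of \<open>D\<close> into
    \<open>C\<close>, and the catalyst \<open>Z\<close> makes \<open>R'\<close>
    cancellative.\<close>
  define R' where "R' = (\<lambda>A B. \<exists>n Z. R (A + repeat_mset n C + Z) (B + repeat_mset n D + Z))"
  have R'I: "R' A B" if "R A B" for A B
    unfolding R'_def by (rule exI[of _ 0], rule exI[of _ "{#}"]) (simp add: that)
  interpret F: ordered_multisets R' U
  proof
    show "R' A A" for A by (rule R'I[OF R_refl])
    show "R' A {#}" for A by (rule R'I[OF R_pos])
    show "\<exists>n. R' (repeat_mset n U) A" for A using R_unit R'I by blast
  next
    fix A B E assume "R' A B" "R' B E"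
    then obtain n Z n' Z' where a: "R (A + repeat_mset n C + Z) (B + repeat_mset n D + Z)"
      and b: "R (B + repeat_mset n' C + Z') (E + repeat_mset n' D + Z')" unfolding R'_def by blast
    have "R (A + repeat_mset (n + n') C + (B + Z + Z')) (E + repeat_mset (n + n') D + (B + Z + Z'))"
      using R_add2[OF a b] by (simp add: repeat_mset_distrib ac_simps)
    thus "R' A E" unfolding R'_def by blast
  next
    fix A B E assume "R' A B"
    then obtain n Z where a: "R (A + repeat_mset n C + Z) (B + repeat_mset n D + Z)" unfolding R'_def by blast
    from R_add[OF this, of E] show "R' (A + E) (B + E)" unfolding R'_def
      by (intro exI[of _ n] exI[of _ Z]) (simp add: ac_simps)
  qed
  have cancel: "R' A B" if "R' (A + E) (B + E)" for A B E
  proof -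
    obtain n Z where "R (A + E + repeat_mset n C + Z) (B + E + repeat_mset n D + Z)"
      using \<open>R' (A + E) (B + E)\<close> unfolding R'_def by blast
    hence "R (A + repeat_mset n C + (E + Z)) (B + repeat_mset n D + (E + Z))" by (simp add: ac_simps)
    thus ?thesis unfolding R'_def by blast
  qed
  have "\<not> (\<forall>t m. R' (repeat_mset t U) (repeat_mset m U) \<longrightarrow> m \<le> t)"
  proof
    assume "\<forall>t m. R' (repeat_mset t U) (repeat_mset m U) \<longrightarrow> m \<le> t"
    hence "\<exists>E. (\<forall>A B. E (A + B) = E A + (E B :: real)) \<and> (\<forall>A B. R' A B \<longrightarrow> E B \<le> E A) \<and> E U = 1"
      by (intro F.additive_exists) (use cancel in blast)+
    then obtain E :: "'a multiset \<Rightarrow> real"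
      where E: "\<forall>A B. E (A + B) = E A + E B" "\<forall>A B. R' A B \<longrightarrow> E B \<le> E A" "E U = 1" by blast
    have E0: "E {#} = 0" using E(1)[rule_format, of "{#}" "{#}"] by simp
    have En: "E (repeat_mset n A) = real n * E A" for n A
      by (induction n) (simp_all add: E0 E(1) algebra_simps)
    have "R' D C" unfolding R'_def
      by (rule exI[of _ 1], rule exI[of _ "{#}"]) (simp add: R_refl add.commute)
    hence "E C \<le> E D" using E(2) by blast
    hence "real q * E X + 1 \<le> real p * E Y" by (simp add: C_def D_def E En)
    thus False using no E R'I by blast
  qed
  then obtain t m where tm: "t < m" and "R' (repeat_mset t U) (repeat_mset m U)" by (auto simp: not_le)
  then obtain n0 Z where r0: "R (repeat_mset t U + repeat_mset n0 C + Z) (repeat_mset m U + repeat_mset n0 D + Z)"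
    unfolding R'_def by blast
  obtain t m n where tm: "t < m" and n: "n > 0"
    and r: "R (repeat_mset t U + repeat_mset n C + Z) (repeat_mset m U + repeat_mset n D + Z)"
  proof (cases "n0 = 0")
    case False
    then show ?thesis using that tm r0 by blast
  next
    case True
    obtain d where d: "R (repeat_mset d U) D" using R_unit by blast
    have "R (repeat_mset (d + 1) (repeat_mset t U) + Z) (repeat_mset (d + 1) (repeat_mset m U) + Z)"
      by (rule R_catalyst_iterate) (use r0 True in simp)
    hence "R (repeat_mset ((d + 1) * t) U + Z + C) (repeat_mset ((d + 1) * m) U + Z + C)"
      using R_add by simp
    moreover have "R (repeat_mset ((d + 1) * m) U + Z + C) (repeat_mset ((d + 1) * m) U + Z)"
      by (rule R_weaken)
    moreover have "(d + 1) * (t + 1) \<le> (d + 1) * m" using tm by (intro mult_le_mono) auto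
    hence "R (repeat_mset ((d + 1) * m) U + Z) (repeat_mset ((d + 1) * t + 1 + d) U + Z)"
      by (intro R_add R_repeat_le) (simp add: algebra_simps)
    moreover have "R (repeat_mset ((d + 1) * t + 1 + d) U + Z) (repeat_mset ((d + 1) * t + 1) U + D + Z)"
      by (rule R_add) (use R_add2[OF R_refl d] in \<open>simp only: repeat_mset_distrib\<close>)
    ultimately have "R (repeat_mset ((d + 1) * t) U + Z + C) (repeat_mset ((d + 1) * t + 1) U + D + Z)"
      using R_trans by blast
    hence "R (repeat_mset ((d + 1) * t) U + repeat_mset 1 C + Z) (repeat_mset ((d + 1) * t + 1) U + repeat_mset 1 D + Z)"
      by (simp add: ac_simps)
    thus ?thesis by (rule that[rotated 2]) auto
  qed
  obtain c where c: "R (repeat_mset c U) Z" using R_unit by blast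
  \<comment> \<open>Buying \<open>Z\<close> costs \<open>c\<close> units; \<open>c + 1\<close>
    rounds earn at least \<open>c + 1\<close>, so after dropping \<open>Z\<close> the balance is not
    below \<open>s\<close>.\<close>
  define j where "j = c + 1"
  define s where "s = j * t + c"
  have "R (repeat_mset j (repeat_mset t U + repeat_mset n C) + Z) (repeat_mset j (repeat_mset m U + repeat_mset n D) + Z)"
    by (rule R_catalyst_iterate[OF r])
  hence "R (repeat_mset j (repeat_mset t U + repeat_mset n C) + repeat_mset c U) (repeat_mset j (repeat_mset m U + repeat_mset n D))"
    using R_trans R_add2[OF R_refl c] R_weaken by meson
  moreover have "repeat_mset j (repeat_mset t U + repeat_mset n C) + repeat_mset c U = repeat_mset (j * n) C + repeat_mset s U"
    by (simp add: s_def repeat_mset_distrib2 repeat_mset_distrib ac_simps)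
  ultimately have "R (repeat_mset (j * n) C + repeat_mset s U) (repeat_mset (j * m) U + repeat_mset (j * n) D)"
    by (simp only: repeat_mset_distrib2 repeat_mset_right)
  moreover have "j * (t + 1) \<le> j * m" using tm by (intro mult_le_mono) auto
  hence "R (repeat_mset (j * m) U + repeat_mset (j * n) D) (repeat_mset s U + repeat_mset (j * n) D)"
    by (intro R_add R_repeat_le) (simp add: s_def j_def algebra_simps)
  ultimately have "R (repeat_mset (j * n) C + repeat_mset s U) (repeat_mset (j * n) D + repeat_mset s U)"
    using R_trans by (subst (2) add.commute) blast
  \<comment> \<open>Now the catalyst consists of \<open>s\<close> copies of \<open>U\<close>. With
    more than \<open>s\<close> rounds its price is at most \<open>W\<close>, and the
    \<open>W\<close> units inside \<open>W\<close> copies of \<open>C\<close> bring the total to at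
    most \<open>2 * W\<close>.\<close>
  define i where "i = s + 1"
  have "R (repeat_mset i (repeat_mset (j * n) C) + repeat_mset s U) (repeat_mset i (repeat_mset (j * n) D) + repeat_mset s U)"
    by (rule R_catalyst_iterate) fact
  hence main: "R (repeat_mset (i * j * n) C + repeat_mset s U) (repeat_mset (i * j * n) D)"
    using R_trans[OF _ R_weaken] by (simp add: mult.assoc)
  define W where "W = i * j * n"
  have W0: "W > 0" using n by (simp add: W_def i_def j_def)
  have "i * 1 \<le> i * (j * n)" using n by (intro mult_le_mono) (auto simp: j_def)
  hence sW: "s \<le> W" by (simp add: W_def i_def algebra_simps)
  have "R (repeat_mset (W * q) X + repeat_mset (2 * W) U) (repeat_mset (W * q) X + repeat_mset (W + s) U)"
    by (intro R_add2 R_refl R_repeat_le) (use sW in simp)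
  moreover have "repeat_mset (W * q) X + repeat_mset (W + s) U = repeat_mset W C + repeat_mset s U"
    by (simp add: C_def repeat_mset_distrib repeat_mset_distrib2 ac_simps)
  ultimately have "R (repeat_mset (W * q) X + repeat_mset (2 * W) U) (repeat_mset W D)"
    using R_trans[OF _ main[folded W_def]] by simp
  thus ?thesis using W0 by (auto simp: D_def)
qed

end

subsection \<open>Adjoints, traces and the Hilbert-Schmidt norm\<close>

lemma dim_adj [simp]: "dim_row (adj A) = dim_col A" "dim_col (adj A) = dim_row A"
  by (simp_all add: adj_def)

lemma adj_carrier [simp]: "A \<in> carrier_mat n m \<Longrightarrow> adj A \<in> carrier_mat m n"
  by (auto simp: adj_def)

lemma index_adj [simp]: "i < dim_col A \<Longrightarrow> j < dim_row A \<Longrightarrow> adj A $$ (i, j) = cnj (A $$ (j, i))"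
  by (simp add: adj_def)

lemma index_mult_sum:
  assumes "i < dim_row A" "j < dim_col B" "dim_col A = dim_row B"
  shows "(A * B) $$ (i, j) = (\<Sum>k<dim_row B. A $$ (i, k) * B $$ (k, j))"
  using assms by (simp add: scalar_prod_def atLeast0LessThan)

lemma adj_adj [simp]: "adj (adj A) = A"
  by (rule eq_matI) simp_all

lemma adj_mult [simp]: "dim_col A = dim_row B \<Longrightarrow> adj (A * B) = adj B * adj A"
  by (rule eq_matI) (auto simp: index_mult_sum mult.commute simp del: index_mult_mat(1))

lemma adj_one [simp]: "adj (1\<^sub>m n) = 1\<^sub>m n"
  by (rule eq_matI) auto

lemma adj_minus: "dim_row A = dim_row B \<Longrightarrow> dim_col A = dim_col B \<Longrightarrow> adj (A - B) = adj A - adj B"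
  by (rule eq_matI) auto

lemma mat_assoc: "dim_col A = dim_row B \<Longrightarrow> dim_col B = dim_row C \<Longrightarrow> A * B * C = A * (B * (C :: complex mat))"
  by (rule assoc_mult_mat) (auto intro: carrier_matI)

lemma mtrace_mult_comm:
  assumes "dim_col A = dim_row B" "dim_col B = dim_row A"
  shows "mtrace (A * B) = mtrace (B * A)"
proof -
  have "mtrace (A * B) = (\<Sum>i<dim_row A. \<Sum>k<dim_row B. A $$ (i, k) * B $$ (k, i))"
    unfolding mtrace_def using assms by (auto simp: index_mult_sum simp del: index_mult_mat(1) intro!: sum.cong)
  also have "\<dots> = (\<Sum>k<dim_row B. \<Sum>i<dim_row A. B $$ (k, i) * A $$ (i, k))"
    by (subst sum.swap) (simp add: mult.commute)
  also have "\<dots> = mtrace (B * A)"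
    unfolding mtrace_def using assms by (auto simp: index_mult_sum simp del: index_mult_mat(1) intro!: sum.cong)
  finally show ?thesis .
qed

lemma mtrace_add: "A \<in> carrier_mat n n \<Longrightarrow> B \<in> carrier_mat n n \<Longrightarrow> mtrace (A + B) = mtrace A + mtrace B"
  by (simp add: mtrace_def sum.distrib)

lemma mtrace_minus: "A \<in> carrier_mat n n \<Longrightarrow> B \<in> carrier_mat n n \<Longrightarrow> mtrace (A - B) = mtrace A - mtrace B"
  by (simp add: mtrace_def sum_subtractf)

text \<open>The squared Hilbert-Schmidt norm. Vectors are treated as matrices with one column, so it
  covers them as well.\<close>

definition nrm :: "complex mat \<Rightarrow> real" where
  "nrm A = (\<Sum>i<dim_row A. \<Sum>j<dim_col A. (cmod (A $$ (i, j)))\<^sup>2)"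

lemma nrm_nonneg: "0 \<le> nrm A"
  by (simp add: nrm_def sum_nonneg)

lemma nrm_eq_0: "nrm A = 0 \<Longrightarrow> A = 0\<^sub>m (dim_row A) (dim_col A)"
  by (rule eq_matI) (auto simp: nrm_def sum_nonneg_eq_0_iff sum_nonneg)

lemma nrm_trace: "mtrace (adj A * A) = of_real (nrm A)"
proof -
  have "mtrace (adj A * A) = (\<Sum>j<dim_col A. \<Sum>i<dim_row A. of_real ((cmod (A $$ (i, j)))\<^sup>2))"
    unfolding mtrace_def
    by (auto simp: index_mult_sum mult.commute[of "cnj _"] complex_norm_square simp del: index_mult_mat(1) of_real_power intro!: sum.cong)
  also have "\<dots> = of_real (nrm A)" unfolding nrm_def by (subst sum.swap) simp
  finally show ?thesis .
qed

lemma mult_minus_mat: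
  assumes "dim_col A = dim_row B" "dim_row B = dim_row C" "dim_col B = dim_col C"
  shows "A * (B - C) = A * B - A * (C :: complex mat)"
  using assms by (intro mult_minus_distrib_mat) (auto intro: carrier_matI)

lemma minus_mult_mat:
  assumes "dim_col B = dim_row A" "dim_row B = dim_row C" "dim_col B = dim_col C"
  shows "(B - C) * A = B * A - C * (A :: complex mat)"
  using assms by (intro minus_mult_distrib_mat) (auto intro: carrier_matI)

lemma smult_mult_mats:
  assumes "dim_col A = dim_row B"
  shows "(c \<cdot>\<^sub>m A) * B = c \<cdot>\<^sub>m (A * (B :: complex mat))" "A * (c \<cdot>\<^sub>m B) = c \<cdot>\<^sub>m (A * B)"
  using assms by (auto intro!: mult_smult_assoc_mat mult_smult_distrib intro: carrier_matI)

lemma cmod_diff_power2: "(cmod (a - b))\<^sup>2 = (cmod a)\<^sup>2 + (cmod b)\<^sup>2 - 2 * Re (cnj a * b)"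
  unfolding cmod_power2 by (simp add: power2_eq_square algebra_simps)

lemma nrm_minus:
  assumes "dim_row A = dim_row B" "dim_col A = dim_col B"
  shows "nrm (A - B) = nrm A + nrm B - 2 * Re (mtrace (adj A * B))"
proof -
  have "nrm (A - B) = (\<Sum>i<dim_row A. \<Sum>j<dim_col A. (cmod (A $$ (i, j)))\<^sup>2 + (cmod (B $$ (i, j)))\<^sup>2
      - 2 * Re (cnj (A $$ (i, j)) * B $$ (i, j)))"
    using assms by (simp add: nrm_def cmod_diff_power2)
  also have "\<dots> = nrm A + nrm B - 2 * Re (\<Sum>i<dim_row A. \<Sum>j<dim_col A. cnj (A $$ (i, j)) * B $$ (i, j))"
    using assms by (simp add: nrm_def sum.distrib sum_subtractf sum_distrib_left)
  also have "(\<Sum>i<dim_row A. \<Sum>j<dim_col A. cnj (A $$ (i, j)) * B $$ (i, j)) = mtrace (adj A * B)"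
    unfolding mtrace_def using assms
    by (subst sum.swap) (auto simp: index_mult_sum simp del: index_mult_mat(1) intro!: sum.cong)
  finally show ?thesis .
qed

lemma nrm_smult: "nrm (c \<cdot>\<^sub>m A) = (cmod c)\<^sup>2 * nrm A"
  by (simp add: nrm_def sum_distrib_left norm_mult power_mult_distrib)

text \<open>Expansion of \<open>nrm (A - B)\<close>. This form of the Cauchy-Schwarz inequality
  avoids square roots and is enough wherever both norms have the same bound.\<close>

lemma inner_le_nrm:
  assumes "dim_row A = dim_row B" "dim_col A = dim_col B"
  shows "2 * Re (mtrace (adj A * B)) \<le> nrm A + nrm B"
  using nrm_minus[OF assms] nrm_nonneg[of "A - B"] by simp

subsection \<open>Positive semidefinite matrices and the spectral theorem\<close>

lemma psd_carrier: "psd n A \<Longrightarrow> A \<in> carrier_mat n n"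
  by (simp add: psd_def)

lemma quad_form_column:
  assumes A: "A \<in> carrier_mat n n" and V: "V \<in> carrier_mat n 1"
  shows "(adj V * A * V) $$ (0, 0) = (\<Sum>i<n. \<Sum>j<n. cnj (V $$ (i, 0)) * A $$ (i, j) * V $$ (j, 0))"
proof -
  have "(adj V * A * V) $$ (0, 0) = (\<Sum>j<n. (\<Sum>i<n. cnj (V $$ (i, 0)) * A $$ (i, j)) * V $$ (j, 0))"
    using A V by (auto simp: index_mult_sum simp del: index_mult_mat(1) intro!: sum.cong)
  also have "\<dots> = (\<Sum>i<n. \<Sum>j<n. cnj (V $$ (i, 0)) * A $$ (i, j) * V $$ (j, 0))"
    unfolding sum_distrib_right by (rule sum.swap)
  finally show ?thesis .
qed

lemma psd_iff_columns:
  "psd n A \<longleftrightarrow> A \<in> carrier_mat n n \<and>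
     (\<forall>V\<in>carrier_mat n 1. Im ((adj V * A * V) $$ (0, 0)) = 0 \<and> 0 \<le> Re ((adj V * A * V) $$ (0, 0)))"
proof (safe)
  assume p: "psd n A"
  show A: "A \<in> carrier_mat n n" using p by (rule psd_carrier)
  fix V :: "complex mat" assume V: "V \<in> carrier_mat n 1"
  show "Im ((adj V * A * V) $$ (0, 0)) = 0" "0 \<le> Re ((adj V * A * V) $$ (0, 0))"
    unfolding quad_form_column[OF A V] using p by (auto simp: psd_def Let_def)
next
  assume A: "A \<in> carrier_mat n n"
    and q: "\<forall>V\<in>carrier_mat n 1. Im ((adj V * A * V) $$ (0, 0)) = 0 \<and> 0 \<le> Re ((adj V * A * V) $$ (0, 0))"
  have "Im (\<Sum>i<n. \<Sum>j<n. cnj (v i) * A $$ (i, j) * v j) = 0 \<and>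
    0 \<le> Re (\<Sum>i<n. \<Sum>j<n. cnj (v i) * A $$ (i, j) * v j)" for v :: "nat \<Rightarrow> complex"
  proof -
    have V: "mat n 1 (\<lambda>(i, j). v i) \<in> carrier_mat n 1" by simp
    have e: "(\<Sum>i<n. \<Sum>j<n. cnj (v i) * A $$ (i, j) * v j) =
      (adj (mat n 1 (\<lambda>(i, j). v i)) * A * mat n 1 (\<lambda>(i, j). v i)) $$ (0, 0)"
      unfolding quad_form_column[OF A V] by simp
    show ?thesis unfolding e using q V by blast
  qed
  thus "psd n A" using A by (simp add: psd_def Let_def)
qed

lemma column_gram: "V \<in> carrier_mat n 1 \<Longrightarrow> (adj V * V) $$ (0, 0) = of_real (nrm V)"
  unfolding nrm_trace[symmetric] by (simp add: mtrace_def)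

lemma psd_gram:
  assumes "dim_col B = n"
  shows "psd n (adj B * B)"
  unfolding psd_iff_columns
proof (intro conjI ballI)
  show "adj B * B \<in> carrier_mat n n" using assms by (intro carrier_matI) simp_all
  fix V :: "complex mat" assume V: "V \<in> carrier_mat n 1"
  have e: "adj V * (adj B * B) * V = adj (B * V) * (B * V)" using V assms by (simp add: mat_assoc)
  have c: "B * V \<in> carrier_mat (dim_row B) 1" using V by (intro carrier_matI) auto
  have "(adj V * (adj B * B) * V) $$ (0, 0) = of_real (nrm (B * V))"
    by (simp only: e column_gram[OF c])
  thus "Im ((adj V * (adj B * B) * V) $$ (0, 0)) = 0" "0 \<le> Re ((adj V * (adj B * B) * V) $$ (0, 0))"
    by (simp_all add: nrm_nonneg)
qed

lemma quad_form_two: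
  fixes A :: "complex mat"
  assumes "i < n" "j < n" and v: "v = (\<lambda>l. (if l = i then 1 else 0) + c * (if l = j then 1 else 0))"
  shows "(\<Sum>k<n. \<Sum>l<n. cnj (v k) * A $$ (k, l) * v l)
    = A $$ (i, i) + c * A $$ (i, j) + cnj c * A $$ (j, i) + cnj c * c * A $$ (j, j)"
proof -
  have inner: "(\<Sum>l<n. cnj (v k) * A $$ (k, l) * v l) = cnj (v k) * (A $$ (k, i) + c * A $$ (k, j))" for k
  proof -
    have "(\<Sum>l<n. cnj (v k) * A $$ (k, l) * v l)
      = (\<Sum>l<n. (if l = i then cnj (v k) * A $$ (k, l) else 0) + (if l = j then c * (cnj (v k) * A $$ (k, l)) else 0))"
      by (rule sum.cong) (auto simp: v algebra_simps)
    thus ?thesis using assms(1,2) by (simp add: sum.distrib algebra_simps)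
  qed
  have "(\<Sum>k<n. cnj (v k) * (A $$ (k, i) + c * A $$ (k, j)))
    = (\<Sum>k<n. (if k = i then A $$ (k, i) + c * A $$ (k, j) else 0) + (if k = j then cnj c * (A $$ (k, i) + c * A $$ (k, j)) else 0))"
    by (rule sum.cong) (auto simp: v algebra_simps)
  thus ?thesis unfolding inner using assms(1,2) by (simp add: sum.distrib algebra_simps)
qed

text \<open>Polarization: the quadratic form is real on \<open>e_i + c e_j\<close>, and the choices
  \<open>c = 1\<close> and \<open>c = \<i>\<close> compare the imaginary and the real parts of the
  two mirrored entries.\<close>

lemma psd_hermitian:
  assumes "psd n A"
  shows "adj A = A"
proof -
  have A: "A \<in> carrier_mat n n" using assms by (rule psd_carrier)
  have q: "Im (A $$ (i, i) + c * A $$ (i, j) + cnj c * A $$ (j, i) + cnj c * c * A $$ (j, j)) = 0"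
    if "i < n" "j < n" for i j c
  proof -
    define v :: "nat \<Rightarrow> complex" where "v = (\<lambda>l. (if l = i then 1 else 0) + c * (if l = j then 1 else 0))"
    have "Im (\<Sum>k<n. \<Sum>l<n. cnj (v k) * A $$ (k, l) * v l) = 0"
      using assms unfolding psd_def Let_def by blast
    thus ?thesis unfolding quad_form_two[OF that v_def] .
  qed
  show ?thesis
  proof (rule eq_matI)
    fix i j assume "i < dim_row A" "j < dim_col A"
    hence ij: "i < n" "j < n" using A by auto
    have d: "Im (A $$ (i, i)) = 0" "Im (A $$ (j, j)) = 0"
      using q[OF ij(1) ij(1), of 0] q[OF ij(2) ij(2), of 0] by simp_all
    show "adj A $$ (i, j) = A $$ (i, j)"
      using q[OF ij, of 1] q[OF ij, of \<i>] d ij A by (simp add: complex_eq_iff)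
  qed (use A in auto)
qed

section \<open>Spectral theorem for hermitian matrices\<close>

lemma unitary_completion:
  fixes v :: "complex vec"
  assumes v: "v \<in> carrier_vec n" "v \<noteq> 0\<^sub>v n"
  obtains U c where "U \<in> carrier_mat n n" "adj U * U = 1\<^sub>m n" "c \<noteq> 0" "\<And>i. i < n \<Longrightarrow> U $$ (i, 0) = c * v $ i"
proof -
  interpret cof_vec_space n "TYPE(complex)" .
  define ws where "ws = gram_schmidt n (basis_completion v)"
  note bc = basis_completion[OF v]
  have ws: "corthogonal ws" "set ws \<subseteq> carrier_vec n" "length ws = n"
    using gram_schmidt_result[OF bc(2,4,5) ws_def] bc(6) by auto
  have n0: "0 < n"
  proof (rule ccontr)
    assume "\<not> 0 < n"
    hence "v = 0\<^sub>v n" using v by (intro eq_vecI) auto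
    thus False using v by simp
  qed
  have "hd ws = v"
  proof -
    have "basis_completion v = v # tl (basis_completion v)"
      using bc(6,7) n0 by (metis length_greater_0_conv list.collapse)
    thus ?thesis unfolding ws_def using gram_schmidt_hd[of v "tl (basis_completion v)"] v by simp
  qed
  hence w0: "ws ! 0 = v" using ws(3) n0 by (metis hd_conv_nth length_greater_0_conv)
  have wsc: "ws ! j \<in> carrier_vec n" if "j < n" for j using ws that by auto
  define s where "s j = (\<Sum>i<n. (cmod (ws ! j $ i))\<^sup>2)" for j
  have inner: "(ws ! b) \<bullet>c (ws ! a) = (\<Sum>i<n. cnj (ws ! a $ i) * ws ! b $ i)" if "a < n" "b < n" for a b
    using wsc[OF that(1)] wsc[OF that(2)] by (auto simp: scalar_prod_def atLeast0LessThan mult.commute intro!: sum.cong)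
  have self: "(\<Sum>i<n. cnj (ws ! a $ i) * ws ! a $ i) = of_real (s a)" for a
    unfolding s_def by (simp add: complex_norm_square mult.commute del: of_real_power)
  have s0: "s a > 0" if "a < n" for a
  proof -
    have "(ws ! a) \<bullet>c (ws ! a) \<noteq> 0" using corthogonalD[OF ws(1), of a a] ws(3) that by simp
    hence "s a \<noteq> 0" using inner[OF that that] self[of a] by simp
    moreover have "s a \<ge> 0" by (simp add: s_def sum_nonneg)
    ultimately show ?thesis by simp
  qed
  \<comment> \<open>Gram-Schmidt leaves the vectors orthogonal with \<open>v\<close> in front;
    dividing by their lengths makes the columns orthonormal and is the origin of
    \<open>c\<close>.\<close>
  define U where "U = mat n n (\<lambda>(i, j). ws ! j $ i / of_real (sqrt (s j)))"
  have U: "U \<in> carrier_mat n n" by (simp add: U_def)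
  have "adj U * U = 1\<^sub>m n"
  proof (rule eq_matI)
    fix a b assume "a < dim_row (1\<^sub>m n)" "b < dim_col (1\<^sub>m n)"
    hence ab: "a < n" "b < n" by simp_all
    have "(adj U * U) $$ (a, b) = (\<Sum>i<n. cnj (ws ! a $ i) * ws ! b $ i) / of_real (sqrt (s a) * sqrt (s b))"
      using ab by (simp add: U_def index_mult_sum sum_divide_distrib del: index_mult_mat(1))
    also have "\<dots> = (if a = b then 1 else 0)"
    proof (cases "a = b")
      case True
      have "sqrt (s b) * sqrt (s b) = s b" using s0[OF ab(2)] by simp
      thus ?thesis using True self[of b] s0[OF ab(2)] by (simp flip: of_real_mult)
    next
      case False
      thus ?thesis using corthogonalD[OF ws(1), of b a] ws(3) ab inner[OF ab] by simp
    qed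
    finally show "(adj U * U) $$ (a, b) = 1\<^sub>m n $$ (a, b)" using ab by simp
  qed (use U in auto)
  moreover have "U $$ (i, 0) = (1 / of_real (sqrt (s 0))) * v $ i" if "i < n" for i
    using that n0 w0 by (simp add: U_def)
  moreover have "(1 / complex_of_real (sqrt (s 0))) \<noteq> 0" using s0[OF n0] by simp
  ultimately show ?thesis using that U by blast
qed

lemma complex_eigenvector_exists:
  fixes A :: "complex mat"
  assumes A: "A \<in> carrier_mat n n" and n: "n > 0"
  obtains v e where "v \<in> carrier_vec n" "v \<noteq> 0\<^sub>v n" "A *\<^sub>v v = e \<cdot>\<^sub>v v"
proof -
  have "degree (char_poly A) = n" using degree_monic_char_poly[OF A] by simp
  hence "\<not> constant (poly (char_poly A))" using n by (simp add: constant_degree)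
  then obtain e where "poly (char_poly A) e = 0" using fundamental_theorem_of_algebra by blast
  hence "eigenvalue A e" using eigenvalue_root_char_poly[OF A] by simp
  thus ?thesis using that A unfolding eigenvalue_def eigenvector_def by auto
qed

text \<open>Induction on the dimension. Conjugation by a unitary whose first column is a multiple of
  an eigenvector clears the first column below the corner; hermiticity then clears the first row,
  and the remaining block is hermitian again.\<close>

lemma hermitian_diagonalization:
  fixes A :: "complex mat"
  assumes "A \<in> carrier_mat n n" "adj A = A"
  shows "\<exists>U d. U \<in> carrier_mat n n \<and> adj U * U = 1\<^sub>m n \<and> U * adj U = 1\<^sub>m n \<and> A = U * mat_diag n d * adj U"
  using assms
proof (induction n arbitrary: A)
  case 0
  show ?case by (rule exI[of _ "1\<^sub>m 0"], rule exI[of _ "\<lambda>_. 0"]) (use 0 in auto)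
next
  case (Suc n)
  note A = Suc.prems(1)
  obtain v e where v: "v \<in> carrier_vec (Suc n)" "v \<noteq> 0\<^sub>v (Suc n)" "A *\<^sub>v v = e \<cdot>\<^sub>v v"
    using complex_eigenvector_exists[OF A] by blast
  obtain U c where U: "U \<in> carrier_mat (Suc n) (Suc n)" "adj U * U = 1\<^sub>m (Suc n)" "c \<noteq> 0"
    and Uc: "\<And>i. i < Suc n \<Longrightarrow> U $$ (i, 0) = c * v $ i"
    using unitary_completion[OF v(1,2)] by blast
  have UU: "U * adj U = 1\<^sub>m (Suc n)"
    using mat_mult_left_right_inverse[OF adj_carrier[OF U(1)] U(1) U(2)] .
  note dims [simp] = carrier_matD[OF A] carrier_matD[OF U(1)]
  define B where "B = adj U * A * U"
  have Bc: "B \<in> carrier_mat (Suc n) (Suc n)" by (simp add: B_def carrier_matI)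
  note dims' [simp] = carrier_matD[OF Bc]
  have Bh: "adj B = B" by (simp add: B_def mat_assoc Suc.prems(2))
  have Av: "(\<Sum>k<Suc n. A $$ (i, k) * v $ k) = e * v $ i" if "i < Suc n" for i
  proof -
    have "(A *\<^sub>v v) $ i = (\<Sum>k<Suc n. A $$ (i, k) * v $ k)"
      using that v(1) A by (auto simp: scalar_prod_def atLeast0LessThan intro!: sum.cong)
    thus ?thesis using v(1,3) that by simp
  qed
  have AU: "(A * U) $$ (i, 0) = e * U $$ (i, 0)" if "i < Suc n" for i
  proof -
    have "(A * U) $$ (i, 0) = (\<Sum>k<Suc n. A $$ (i, k) * (c * v $ k))"
      using that Uc by (subst index_mult_sum) (auto intro!: sum.cong)
    also have "\<dots> = c * (\<Sum>k<Suc n. A $$ (i, k) * v $ k)" 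
      unfolding sum_distrib_left by (rule sum.cong) (auto simp: ac_simps)
    finally show ?thesis using Av[OF that] Uc[OF that] by simp
  qed
  have B0: "B $$ (i, 0) = (if i = 0 then e else 0)" if "i < Suc n" for i
  proof -
    have "B = adj U * (A * U)" by (simp add: B_def mat_assoc)
    hence "B $$ (i, 0) = (\<Sum>k<Suc n. adj U $$ (i, k) * (A * U) $$ (k, 0))"
      using that by (simp add: index_mult_sum del: index_mult_mat(1))
    also have "\<dots> = (\<Sum>k<Suc n. adj U $$ (i, k) * (e * U $$ (k, 0)))"
      by (rule sum.cong) (use AU in auto)
    also have "\<dots> = e * (\<Sum>k<Suc n. adj U $$ (i, k) * U $$ (k, 0))" 
      unfolding sum_distrib_left by (rule sum.cong) (auto simp: ac_simps)
    also have "(\<Sum>k<Suc n. adj U $$ (i, k) * U $$ (k, 0)) = (adj U * U) $$ (i, 0)"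
      using that by (subst index_mult_sum) auto
    finally show ?thesis using that by (simp add: U(2))
  qed
  define B' where "B' = mat n n (\<lambda>(i, j). B $$ (Suc i, Suc j))"
  have adjB: "cnj (B $$ (j, i)) = B $$ (i, j)" if "i < Suc n" "j < Suc n" for i j
    using arg_cong[OF Bh, of "\<lambda>M. M $$ (i, j)"] that by simp
  have "adj B' = B'" by (rule eq_matI) (auto simp: B'_def adjB)
  then obtain V d where V: "V \<in> carrier_mat n n" "adj V * V = 1\<^sub>m n" "V * adj V = 1\<^sub>m n"
    and B'V: "B' = V * mat_diag n d * adj V"
    using Suc.IH[of B'] by (auto simp: B'_def)
  define V1 where "V1 = four_block_mat (1\<^sub>m 1) (0\<^sub>m 1 n) (0\<^sub>m n 1) V"
  define d1 where "d1 = (\<lambda>i. case i of 0 \<Rightarrow> e | Suc j \<Rightarrow> d j)"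
  have adjV1: "adj V1 = four_block_mat (1\<^sub>m 1) (0\<^sub>m 1 n) (0\<^sub>m n 1) (adj V)"
    using V(1) by (intro eq_matI) (auto simp: V1_def)
  have V1c: "V1 \<in> carrier_mat (Suc n) (Suc n)" using V(1) by (auto simp: V1_def intro!: carrier_matI)
  have D1: "mat_diag (Suc n) d1 = four_block_mat (mat_diag 1 (\<lambda>_. e)) (0\<^sub>m 1 n) (0\<^sub>m n 1) (mat_diag n d)"
    by (intro eq_matI) (auto simp: d1_def mat_diag_def split: nat.splits)
  have B4: "B = four_block_mat (mat_diag 1 (\<lambda>_. e)) (0\<^sub>m 1 n) (0\<^sub>m n 1) B'"
  proof (rule eq_matI, goal_cases)
    case (1 i j)
    hence ij: "i < Suc n" "j < Suc n" by (auto simp: B'_def mat_diag_def)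
    show ?case
    proof (cases "j = 0")
      case True
      thus ?thesis using B0[OF ij(1)] ij by (auto simp: mat_diag_def B'_def)
    next
      case False
      show ?thesis
      proof (cases "i = 0")
        case True
        have "B $$ (0, j) = 0" using adjB[of 0 j] B0[OF ij(2)] False ij by simp
        thus ?thesis using True ij False by (auto simp: mat_diag_def B'_def)
      next
        case False
        thus ?thesis using \<open>j \<noteq> 0\<close> ij by (auto simp: mat_diag_def B'_def)
      qed
    qed
  qed (auto simp: B'_def mat_diag_def)
  have one: "mat_diag 1 (\<lambda>_. e) \<in> carrier_mat 1 1" "mat_diag n d \<in> carrier_mat n n" by (auto simp: mat_diag_def)
  have m1: "V1 * mat_diag (Suc n) d1 = four_block_mat (mat_diag 1 (\<lambda>_. e)) (0\<^sub>m 1 n) (0\<^sub>m n 1) (V * mat_diag n d)"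
    unfolding V1_def D1 by (subst mult_four_block_mat[where ?nr1.0 = 1 and ?n1.0 = 1 and ?n2.0 = n and ?nr2.0 = n and ?nc1.0 = 1 and ?nc2.0 = n])
      (use V(1) one in \<open>auto simp: left_mult_one_mat[OF one(1)] right_add_zero_mat[OF one(1)] left_mult_zero_mat[OF one(1)]
          left_mult_zero_mat[OF one(2)] simp del: One_nat_def\<close>)
  have Vd: "V * mat_diag n d \<in> carrier_mat n n" "V * mat_diag n d * adj V \<in> carrier_mat n n" using V(1) one by auto
  have BV: "B = V1 * mat_diag (Suc n) d1 * adj V1"
    unfolding m1 adjV1 B4 B'V by (subst mult_four_block_mat[where ?nr1.0 = 1 and ?n1.0 = 1 and ?n2.0 = n and ?nr2.0 = n and ?nc1.0 = 1 and ?nc2.0 = n])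
      (use V(1) one Vd in \<open>auto simp: right_mult_one_mat[OF one(1)] right_add_zero_mat[OF one(1)] right_mult_zero_mat[OF one(1)]
          right_mult_zero_mat[OF Vd(1)] left_add_zero_mat[OF Vd(2)] simp del: One_nat_def\<close>)
  have V1u: "adj V1 * V1 = 1\<^sub>m (Suc n)"
  proof -
    have "adj V1 * V1 = four_block_mat (1\<^sub>m 1) (0\<^sub>m 1 n) (0\<^sub>m n 1) (1\<^sub>m n)"
      unfolding adjV1 unfolding V1_def by (subst mult_four_block_mat[where ?nr1.0 = 1 and ?n1.0 = 1 and ?n2.0 = n and ?nr2.0 = n and ?nc1.0 = 1 and ?nc2.0 = n])
        (use V in auto)
    also have "\<dots> = 1\<^sub>m (Suc n)" by (rule eq_matI) auto
    finally show ?thesis .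
  qed
  note dims'' [simp] = carrier_matD[OF V1c]
  have [simp]: "dim_row (mat_diag (Suc n) d1) = Suc n" "dim_col (mat_diag (Suc n) d1) = Suc n" by (simp_all add: mat_diag_def)
  have U1: "U * V1 \<in> carrier_mat (Suc n) (Suc n)" by (simp add: carrier_matI)
  have U2: "adj (U * V1) * (U * V1) = 1\<^sub>m (Suc n)"
  proof -
    have "adj (U * V1) * (U * V1) = adj V1 * ((adj U * U) * V1)" by (simp add: mat_assoc)
    thus ?thesis using V1u U(2) V1c by simp
  qed
  have "A = (U * adj U) * A * (U * adj U)" using A by (simp add: UU)
  also have "\<dots> = U * B * adj U" by (simp add: B_def mat_assoc)
  also have "\<dots> = (U * V1) * mat_diag (Suc n) d1 * adj (U * V1)" unfolding BV by (simp add: mat_assoc)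
  finally show ?case using U1 U2 mat_mult_left_right_inverse[OF adj_carrier[OF U1] U1 U2] by blast
qed

lemma nrm_add_smult:
  assumes "dim_row A = dim_row B" "dim_col A = dim_col B"
  shows "nrm (A + of_real s \<cdot>\<^sub>m B) = nrm A + s\<^sup>2 * nrm B + 2 * s * Re (mtrace (adj A * B))"
proof -
  have e: "A + of_real s \<cdot>\<^sub>m B = A - of_real (- s) \<cdot>\<^sub>m B" using assms by (intro eq_matI) auto
  have "mtrace (adj A * (of_real (- s) \<cdot>\<^sub>m B)) = of_real (- s) * mtrace (adj A * B)"
    using assms by (subst smult_mult_mats) (auto simp: mtrace_def sum_distrib_left)
  thus ?thesis unfolding e using assms by (subst nrm_minus) (auto simp: nrm_smult)
qed

section \<open>Functional calculus in a fixed eigenbasis: square roots and pseudo-inverses\<close>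

definition spec_fun :: "nat \<Rightarrow> complex mat \<Rightarrow> (nat \<Rightarrow> complex) \<Rightarrow> complex mat" where
  "spec_fun n U f = U * mat_diag n f * adj U"

lemma dim_mat_diag [simp]: "dim_row (mat_diag n f) = n" "dim_col (mat_diag n f) = n"
  by (simp_all add: mat_diag_def)

lemma mat_diag_cong: "(\<And>i. i < n \<Longrightarrow> f i = g i) \<Longrightarrow> mat_diag n f = mat_diag n g"
  by (rule eq_matI) (auto simp: mat_diag_def)

lemma spec_fun_carrier: "U \<in> carrier_mat n n \<Longrightarrow> spec_fun n U f \<in> carrier_mat n n"
  by (auto simp: spec_fun_def intro!: carrier_matI)

lemma spec_fun_mult:
  assumes U: "U \<in> carrier_mat n n" "adj U * U = 1\<^sub>m n"
  shows "spec_fun n U f * spec_fun n U g = spec_fun n U (\<lambda>i. f i * g i)"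
proof -
  have [simp]: "dim_row U = n" "dim_col U = n" using U by auto
  have "spec_fun n U f * spec_fun n U g = U * (mat_diag n f * ((adj U * U) * (mat_diag n g * adj U)))"
    by (simp add: spec_fun_def mat_assoc)
  also have "\<dots> = U * ((mat_diag n f * mat_diag n g) * adj U)"
    unfolding U(2) by (subst left_mult_one_mat[of _ n n]) (simp_all add: carrier_matI mat_assoc del: mat_diag_diag)
  finally show ?thesis by (simp add: spec_fun_def mat_assoc)
qed

lemma adj_spec_fun:
  assumes "U \<in> carrier_mat n n"
  shows "adj (spec_fun n U f) = spec_fun n U (\<lambda>i. cnj (f i))"
proof -
  have "adj (mat_diag n f) = mat_diag n (\<lambda>i. cnj (f i))"
    by (rule eq_matI) (auto simp: mat_diag_def)
  thus ?thesis using assms by (simp add: spec_fun_def mat_assoc)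
qed

lemma psd_spec_fun:
  assumes U: "U \<in> carrier_mat n n" "adj U * U = 1\<^sub>m n" and s: "\<And>i. i < n \<Longrightarrow> 0 \<le> s i"
  shows "psd n (spec_fun n U (\<lambda>i. of_real (s i)))"
proof -
  let ?B = "spec_fun n U (\<lambda>i. of_real (sqrt (s i)))"
  have "adj ?B * ?B = spec_fun n U (\<lambda>i. of_real (sqrt (s i) * sqrt (s i)))"
    unfolding adj_spec_fun[OF U(1)] spec_fun_mult[OF U] by (simp only: complex_cnj_complex_of_real of_real_mult)
  also have "\<dots> = spec_fun n U (\<lambda>i. of_real (s i))"
    unfolding spec_fun_def using s by (subst mat_diag_cong[where g = "\<lambda>i. of_real (s i)"]) auto
  finally show ?thesis using psd_gram[of ?B n] spec_fun_carrier[OF U(1)] by (metis carrier_matD(2))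
qed

lemma psd_spectral:
  assumes "psd n A"
  obtains U s where "U \<in> carrier_mat n n" "adj U * U = 1\<^sub>m n" "\<And>i. 0 \<le> s i"
    "A = spec_fun n U (\<lambda>i. of_real (s i :: real))"
proof -
  have A: "A \<in> carrier_mat n n" using assms by (rule psd_carrier)
  obtain U d where U: "U \<in> carrier_mat n n" "adj U * U = 1\<^sub>m n" "U * adj U = 1\<^sub>m n"
    and d: "A = U * mat_diag n d * adj U"
    using hermitian_diagonalization[OF A psd_hermitian[OF assms]] by blast
  have [simp]: "dim_row U = n" "dim_col U = n" "dim_row A = n" "dim_col A = n" using U A by auto
  have dd: "adj U * A * U = mat_diag n d"
  proof -
    have "adj U * A * U = (adj U * U) * (mat_diag n d * (adj U * U))" unfolding d by (simp add: mat_assoc)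
    thus ?thesis unfolding U(2) by (simp add: left_mult_one_mat[of _ n n] right_mult_one_mat[of _ n n])
  qed
  have pos: "Im (d i) = 0 \<and> 0 \<le> Re (d i)" if i: "i < n" for i
  proof -
    define v where "v = (\<lambda>k. U $$ (k, i))"
    have "d i = (adj U * A * U) $$ (i, i)" unfolding dd using i by (simp add: mat_diag_def)
    also have "\<dots> = (\<Sum>l<n. (\<Sum>k<n. cnj (v k) * A $$ (k, l)) * v l)"
      using i by (auto simp: index_mult_sum v_def simp del: index_mult_mat(1) intro!: sum.cong)
    also have "\<dots> = (\<Sum>k<n. \<Sum>l<n. cnj (v k) * A $$ (k, l) * v l)"
      unfolding sum_distrib_right by (rule sum.swap)
    finally have e: "d i = \<dots>" .
    show ?thesis unfolding e using assms unfolding psd_def Let_def by blast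
  qed
  \<comment> \<open>The default 0 outside the range lets nonnegativity be stated for every
    index.\<close>
  define s where "s = (\<lambda>i. if i < n then Re (d i) else 0)"
  have "A = spec_fun n U (\<lambda>i. of_real (s i))"
    unfolding d spec_fun_def using pos
    by (subst mat_diag_cong[where g = "\<lambda>i. of_real (s i)"]) (auto simp: s_def complex_eq_iff)
  moreover have "0 \<le> s i" for i using pos by (simp add: s_def)
  ultimately show ?thesis using that U by blast
qed

lemma psd_sqrt_exists:
  assumes "psd n A"
  obtains S where "psd n S" "S * S = A"
proof -
  obtain U s where U: "U \<in> carrier_mat n n" "adj U * U = 1\<^sub>m n" and s: "\<And>i. 0 \<le> s i"
    and A: "A = spec_fun n U (\<lambda>i. of_real (s i))" using psd_spectral[OF assms] by metis
  let ?S = "spec_fun n U (\<lambda>i. of_real (sqrt (s i)))"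
  have "psd n ?S" by (rule psd_spec_fun[OF U]) (simp add: s)
  moreover have "?S * ?S = A" unfolding spec_fun_mult[OF U] A by (simp add: s flip: of_real_mult)
  ultimately show ?thesis using that by blast
qed

text \<open>The Moore-Penrose inverse: since \<open>inverse 0 = 0\<close>, nonzero eigenvalues are
  inverted and the kernel is kept.\<close>

lemma psd_pseudo_inverse:
  assumes "psd n S"
  obtains P where "P \<in> carrier_mat n n" "adj P = P" "P * S = S * P" "P * (S * S) = S" "P * (S * P) = P"
proof -
  obtain U s where U: "U \<in> carrier_mat n n" "adj U * U = 1\<^sub>m n" and s: "\<And>i. 0 \<le> s i"
    and S: "S = spec_fun n U (\<lambda>i. of_real (s i))" using psd_spectral[OF assms] by metis
  let ?P = "spec_fun n U (\<lambda>i. of_real (inverse (s i)))"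
  have "?P * S = S * ?P" unfolding S spec_fun_mult[OF U] by (simp add: mult.commute)
  moreover have "?P * (S * S) = S"
    unfolding S spec_fun_mult[OF U]
    by (rule arg_cong[where f = "spec_fun n U"]) (auto simp: fun_eq_iff field_simps)
  moreover have "?P * (S * ?P) = ?P"
    unfolding S spec_fun_mult[OF U]
    by (rule arg_cong[where f = "spec_fun n U"]) (auto simp: fun_eq_iff field_simps)
  ultimately show ?thesis
    by (intro that[of ?P]) (simp_all add: adj_spec_fun[OF U(1)] spec_fun_carrier[OF U(1)])
qed

text \<open>For \<open>H = B - C\<close> the hypothesis says \<open>B * H + H * C = 0\<close>.
  Multiplying by \<open>H\<close> and taking the trace gives
  \<open>nrm (G * H) + nrm (K * H) = 0\<close> for roots \<open>G\<close>, \<open>K\<close> of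
  \<open>B\<close>, \<open>C\<close>. Hence \<open>B * H\<close> and \<open>C * H\<close> vanish, so
  \<open>H * H\<close> vanishes, and with it \<open>H\<close>.\<close>

lemma psd_sqrt_unique:
  assumes B: "psd n B" and C: "psd n C" and eq: "B * B = C * C"
  shows "B = C"
proof -
  obtain G where G: "psd n G" "G * G = B" using psd_sqrt_exists[OF B] .
  obtain K where K: "psd n K" "K * K = C" using psd_sqrt_exists[OF C] .
  note c = psd_carrier[OF B] psd_carrier[OF C] psd_carrier[OF G(1)] psd_carrier[OF K(1)]
  note h = psd_hermitian[OF B] psd_hermitian[OF C] psd_hermitian[OF G(1)] psd_hermitian[OF K(1)]
  have [simp]: "dim_row B = n" "dim_col B = n" "dim_row C = n" "dim_col C = n"
    "dim_row G = n" "dim_col G = n" "dim_row K = n" "dim_col K = n" using c by auto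
  define H where "H = B - C"
  have Hc: "H \<in> carrier_mat n n" using c by (auto simp: H_def intro!: carrier_matI)
  have [simp]: "dim_row H = n" "dim_col H = n" using Hc by auto
  have Hh: "adj H = H" by (simp add: H_def adj_minus h)
  have z: "B * H + H * C = 0\<^sub>m n n"
  proof -
    have "B * H + H * C = (C * C - B * C) + (B * C - C * C)" 
      by (simp add: H_def mult_minus_mat minus_mult_mat eq)
    also have "\<dots> = 0\<^sub>m n n" by (rule eq_matI) auto
    finally show ?thesis .
  qed
  have nG: "of_real (nrm (G * H)) = mtrace (H * (B * H))"
    unfolding nrm_trace[symmetric] by (simp add: h Hh mat_assoc flip: G(2))
  have nK: "of_real (nrm (K * H)) = mtrace (H * (C * H))"
    unfolding nrm_trace[symmetric] by (simp add: h Hh mat_assoc flip: K(2))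
  have "mtrace (H * (C * H)) = mtrace (H * (H * C))"
    by (subst mtrace_mult_comm) (simp_all add: mat_assoc mtrace_mult_comm[of C "H * H"])
  hence "complex_of_real (nrm (G * H) + nrm (K * H)) = mtrace (H * (B * H)) + mtrace (H * (H * C))"
    by (simp add: nG nK)
  also have "\<dots> = mtrace (H * (B * H + H * C))"
    using c Hc by (subst mult_add_distrib_mat[of _ n n _ n]) (auto simp: mtrace_add[of _ n] carrier_matI)
  also have "\<dots> = 0" unfolding z using Hc by (simp add: mtrace_def)
  finally have "nrm (G * H) + nrm (K * H) = 0" by (simp only: of_real_eq_0_iff)
  hence "nrm (G * H) = 0" "nrm (K * H) = 0" using nrm_nonneg[of "G * H"] nrm_nonneg[of "K * H"] by linarith+
  hence "G * H = 0\<^sub>m n n" "K * H = 0\<^sub>m n n" using nrm_eq_0 by force+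
  hence "B * H = 0\<^sub>m n n" "C * H = 0\<^sub>m n n"
    using G K c by (simp_all add: mat_assoc right_mult_zero_mat[of _ n n] flip: G(2) K(2))
  moreover have "H * H = B * H - C * H" by (subst (1) H_def) (simp add: minus_mult_mat)
  ultimately have "H * H = 0\<^sub>m n n" by (intro eq_matI) auto
  hence "complex_of_real (nrm H) = 0" unfolding nrm_trace[symmetric] Hh by (simp add: mtrace_def)
  hence Hz: "H = 0\<^sub>m n n" using nrm_eq_0[of H] by simp
  have "B $$ (i, j) = C $$ (i, j)" if "i < n" "j < n" for i j
    using arg_cong[OF Hz, of "\<lambda>M. M $$ (i, j)"] that unfolding H_def by simp
  thus ?thesis by (intro eq_matI) auto
qed

lemma psd_sqrt_eqI:
  assumes "psd n B" "B * B = A"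
  shows "psd_sqrt A = B"
proof -
  have "dim_row A = n" using assms psd_carrier by fastforce
  thus ?thesis unfolding psd_sqrt_def using assms psd_sqrt_unique by (intro the_equality) blast+
qed

lemma psd_sqrt:
  assumes "psd n A"
  shows "psd n (psd_sqrt A)" "psd_sqrt A * psd_sqrt A = A"
  using psd_sqrt_exists[OF assms] psd_sqrt_eqI by metis+

subsection \<open>Contractions and polar decomposition\<close>

text \<open>Operator norm at most 1, tested on matrices of every width, so that the bound applies to
  purifications and to single columns alike.\<close>

definition contr :: "complex mat \<Rightarrow> bool" where
  "contr Q \<longleftrightarrow> (\<forall>A. dim_row A = dim_col Q \<longrightarrow> nrm (Q * A) \<le> nrm A)"

lemma contr_mult: "contr P \<Longrightarrow> contr Q \<Longrightarrow> dim_col P = dim_row Q \<Longrightarrow> contr (P * Q)"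
  unfolding contr_def by (auto simp: mat_assoc) (metis index_mult_mat(2) order_trans)

text \<open>\<open>nrm (adj V * A)\<close> is the overlap of \<open>A\<close> with
  \<open>V * (adj V * A)\<close>, hence at most the mean of \<open>nrm A\<close> and
  \<open>nrm (adj V * A)\<close>; solve for the latter.\<close>

lemma contr_adj:
  assumes "contr V"
  shows "contr (adj V)"
  unfolding contr_def
proof (intro allI impI)
  fix A :: "complex mat" assume "dim_row A = dim_col (adj V)"
  hence [simp]: "dim_row A = dim_row V" by simp
  have "2 * Re (mtrace (adj A * (V * (adj V * A)))) \<le> nrm A + nrm (V * (adj V * A))"
    by (rule inner_le_nrm) simp_all
  moreover have "mtrace (adj A * (V * (adj V * A))) = of_real (nrm (adj V * A))"
    unfolding nrm_trace[symmetric] by (simp add: mat_assoc)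
  moreover have "nrm (V * (adj V * A)) \<le> nrm (adj V * A)" using assms by (simp add: contr_def)
  ultimately show "nrm (adj V * A) \<le> nrm A" by simp
qed

text \<open>\<open>V\<close> is a partial isometry: \<open>P\<close> is an orthogonal projection,
  and \<open>nrm (V * A)\<close> equals both \<open>nrm (P * A)\<close> and the overlap of
  \<open>A\<close> with \<open>P * A\<close>.\<close>

lemma contr_if_gram_idempotent:
  assumes "adj V * V = P" "P * P = P"
  shows "contr V"
  unfolding contr_def
proof (intro allI impI)
  fix A :: "complex mat" assume [simp]: "dim_row A = dim_col V"
  have [simp]: "dim_row P = dim_col V" "dim_col P = dim_col V" using assms(1) by auto
  have h: "adj P = P" using assms(1) by auto
  have 1: "mtrace (adj A * (P * A)) = of_real (nrm (V * A))"
    unfolding nrm_trace[symmetric] by (simp add: mat_assoc flip: assms(1))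
  have "mtrace (adj A * (P * A)) = of_real (nrm (P * A))"
    unfolding nrm_trace[symmetric] by (simp add: h mat_assoc) (simp add: assms(2) flip: mat_assoc)
  hence "nrm (P * A) = nrm (V * A)" using 1 by (metis of_real_eq_iff)
  thus "nrm (V * A) \<le> nrm A" using inner_le_nrm[of A "P * A"] 1 by simp
qed

text \<open>\<open>S\<close> is the absolute value of \<open>B\<close>, and the pseudo-inverse
  yields the partial isometry \<open>B * P\<close> even when \<open>S\<close> is singular.
  \<open>B\<close> may have more rows than columns, as purifications do.\<close>

lemma polar:
  assumes S: "psd n S" and B: "B \<in> carrier_mat m n" and eq: "adj B * B = S * S"
  obtains V where "V \<in> carrier_mat m n" "V * S = B" "adj V * B = S" "contr V"
proof -
  obtain P where P: "P \<in> carrier_mat n n" "adj P = P" "P * S = S * P" "P * (S * S) = S" "P * (S * P) = P"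
    using psd_pseudo_inverse[OF S] .
  note Sc = psd_carrier[OF S]
  have [simp]: "dim_row S = n" "dim_col S = n" "dim_row P = n" "dim_col P = n" "dim_row B = m" "dim_col B = n"
    using P Sc B by auto
  define V where "V = B * P"
  have [simp]: "dim_row V = m" "dim_col V = n" by (simp_all add: V_def)
  have 1: "adj V * B = S" by (simp add: V_def P(2) mat_assoc eq P(4))
  have VV: "adj V * V = S * P" using 1 by (simp add: V_def flip: mat_assoc)
  have "S * P * (S * P) = S * P" by (simp add: mat_assoc P(5))
  hence cV: "contr V" using contr_if_gram_idempotent[OF VV] by simp
  \<comment> \<open>\<open>P\<close> inverts \<open>S\<close> only off its kernel. That nothing of
    \<open>B\<close> is lost shows in the norms: \<open>nrm (V * S)\<close> and the overlap of
    \<open>V * S\<close> with \<open>B\<close> both equal \<open>nrm B\<close>.\<close>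
  have "nrm (V * S - B) = 0"
  proof -
    have "mtrace (adj (V * S) * B) = of_real (nrm B)" "mtrace (adj (V * S) * (V * S)) = of_real (nrm B)"
    proof -
      show "mtrace (adj (V * S) * B) = of_real (nrm B)"
        unfolding nrm_trace[symmetric] using 1 B by (simp add: V_def mat_assoc psd_hermitian[OF S] eq)
      have "adj (V * S) * (V * S) = S * (S * (P * S))"
      proof -
        have "adj (V * S) * (V * S) = S * ((adj V * V) * S)" by (simp add: mat_assoc psd_hermitian[OF S])
        thus ?thesis unfolding VV by (simp add: mat_assoc)
      qed
      also have "S * (P * S) = (P * S) * S" by (simp add: P(3) mat_assoc)
      also have "\<dots> = S" by (simp add: mat_assoc P(4))
      finally show "mtrace (adj (V * S) * (V * S)) = of_real (nrm B)"
        unfolding nrm_trace[symmetric] eq by simp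
    qed
    hence "Re (mtrace (adj (V * S) * B)) = nrm B" "nrm (V * S) = nrm B"
      by (simp_all add: nrm_trace del: adj_mult)
    thus ?thesis by (subst nrm_minus) (simp_all del: adj_mult)
  qed
  hence z: "V * S - B = 0\<^sub>m m n" using nrm_eq_0[of "V * S - B"] by simp
  have "V * S = B"
  proof (rule eq_matI)
    fix i j assume "i < dim_row B" "j < dim_col B"
    thus "(V * S) $$ (i, j) = B $$ (i, j)" using arg_cong[OF z, of "\<lambda>M. M $$ (i, j)"] 
      by (simp del: index_mult_mat(1))
  qed simp_all
  moreover have "V \<in> carrier_mat m n" by (intro carrier_matI) simp_all
  ultimately show ?thesis using that 1 cV by blast
qed


subsection \<open>Fidelity as a semidefinite program\<close>

definition bil :: "nat \<Rightarrow> complex mat \<Rightarrow> (nat \<Rightarrow> complex) \<Rightarrow> (nat \<Rightarrow> complex) \<Rightarrow> complex" where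
  "bil n A u v = (\<Sum>i<n. \<Sum>j<n. cnj (u i) * A $$ (i, j) * v j)"

definition colm :: "nat \<Rightarrow> (nat \<Rightarrow> complex) \<Rightarrow> complex mat" where
  "colm n u = mat n 1 (\<lambda>(i, j). u i)"

lemma dim_colm [simp]: "dim_row (colm n u) = n" "dim_col (colm n u) = 1"
  by (simp_all add: colm_def)

lemma psd_bil: "psd n A \<longleftrightarrow> A \<in> carrier_mat n n \<and> (\<forall>v. Im (bil n A v v) = 0 \<and> 0 \<le> Re (bil n A v v))"
  by (simp add: psd_def bil_def Let_def)

lemma bil_colm:
  assumes "A \<in> carrier_mat n n"
  shows "bil n A u v = mtrace (adj (colm n u) * (A * colm n v))"
proof -
  have "mtrace (adj (colm n u) * (A * colm n v)) = (\<Sum>i<n. cnj (u i) * (\<Sum>j<n. A $$ (i, j) * v j))"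
    using assms by (auto simp: mtrace_def index_mult_sum colm_def simp del: index_mult_mat(1) intro!: sum.cong)
  thus ?thesis by (simp add: bil_def sum_distrib_left mult.assoc)
qed

lemma bil_gram:
  assumes "dim_col A = n" "dim_col B = n" "dim_row A = dim_row B"
  shows "bil n (adj A * B) u v = mtrace (adj (A * colm n u) * (B * colm n v))"
  using assms by (subst bil_colm) (auto simp: mat_assoc intro!: carrier_matI)

lemma sum_lessThan_add: "(\<Sum>i<n + m. f i) = (\<Sum>i<n. f i) + (\<Sum>i<m. f (n + i :: nat) :: 'a :: comm_monoid_add)"
  by (induction m) (simp_all add: add.assoc)

text \<open>Positivity of the block matrix with rows \<open>(\<rho>, X)\<close> and \<open>(X\<^sup>*, \<sigma>)\<close>.\<close>

definition coupling :: "nat \<Rightarrow> complex mat \<Rightarrow> complex mat \<Rightarrow> complex mat \<Rightarrow> bool" where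
  "coupling n \<rho> X \<sigma> \<longleftrightarrow> psd n \<rho> \<and> psd n \<sigma> \<and> X \<in> carrier_mat n n \<and>
     (\<forall>u v. 0 \<le> Re (bil n \<rho> u u) + 2 * Re (bil n X u v) + Re (bil n \<sigma> v v))"

text \<open>A lower bound on the fidelity, witnessed by one feasible point of the semidefinite
  program. Kraus maps carry witnesses to witnesses, so no optimal point has to be tracked.\<close>

definition fid_ge :: "nat \<Rightarrow> complex mat \<Rightarrow> complex mat \<Rightarrow> real \<Rightarrow> bool" where
  "fid_ge n \<rho> \<sigma> c \<longleftrightarrow> (\<exists>X. coupling n \<rho> X \<sigma> \<and> c \<le> Re (mtrace X))"

text \<open>At \<open>(u, v)\<close> the block form is at least the squared norm of
  \<open>Q * A * u + C * v\<close>, because \<open>Q\<close> does not increase the norm of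
  \<open>A * u\<close>.\<close>

lemma coupling_contraction:
  assumes A: "A \<in> carrier_mat m n" and C: "C \<in> carrier_mat l n" and Q: "contr Q" "Q \<in> carrier_mat l m"
  shows "coupling n (adj A * A) (adj (Q * A) * C) (adj C * C)"
  unfolding coupling_def
proof (intro conjI allI)
  have [simp]: "dim_row A = m" "dim_col A = n" "dim_row C = l" "dim_col C = n" "dim_row Q = l" "dim_col Q = m"
    using A C Q by auto
  show "psd n (adj A * A)" "psd n (adj C * C)" by (rule psd_gram, simp)+
  show "adj (Q * A) * C \<in> carrier_mat n n" by (simp add: carrier_matI)
  fix u v
  let ?a = "A * colm n u" and ?c = "C * colm n v"
  have 1: "Re (bil n (adj A * A) u u) = nrm ?a" "Re (bil n (adj C * C) v v) = nrm ?c"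
    by (simp_all add: bil_gram nrm_trace del: adj_mult)
  have "bil n (adj (Q * A) * C) u v = mtrace (adj (Q * ?a) * ?c)"
    by (subst bil_gram) (simp_all add: mat_assoc)
  moreover have "nrm (Q * ?a + of_real 1 \<cdot>\<^sub>m ?c) = nrm (Q * ?a) + 1\<^sup>2 * nrm ?c + 2 * 1 * Re (mtrace (adj (Q * ?a) * ?c))"
    by (rule nrm_add_smult) simp_all
  moreover have "nrm (Q * ?a) \<le> nrm ?a" using Q by (simp add: contr_def)
  ultimately show "0 \<le> Re (bil n (adj A * A) u u) + 2 * Re (bil n (adj (Q * A) * C) u v) + Re (bil n (adj C * C) v v)"
    using nrm_nonneg[of "Q * ?a + of_real 1 \<cdot>\<^sub>m ?c"] unfolding 1 by (simp del: adj_mult)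
qed

text \<open>The square root of the block matrix has \<open>n + n\<close> columns; its left half
  \<open>A\<close> and right half \<open>B\<close> are purifications of \<open>\<rho>\<close> and
  \<open>\<sigma>\<close> with overlap \<open>X\<close>.\<close>

lemma coupling_gram:
  assumes "coupling n \<rho> X \<sigma>"
  obtains A B where "A \<in> carrier_mat (n + n) n" "B \<in> carrier_mat (n + n) n"
    "adj A * A = \<rho>" "adj B * B = \<sigma>" "adj A * B = X"
proof -
  have c: "\<rho> \<in> carrier_mat n n" "\<sigma> \<in> carrier_mat n n" "X \<in> carrier_mat n n" and p: "psd n \<rho>" "psd n \<sigma>"
    using assms psd_carrier by (auto simp: coupling_def)
  have [simp]: "dim_row \<rho> = n" "dim_col \<rho> = n" "dim_row \<sigma> = n" "dim_col \<sigma> = n" "dim_row X = n" "dim_col X = n"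
    using c by auto
  define M where "M = four_block_mat \<rho> X (adj X) \<sigma>"
  have M: "M \<in> carrier_mat (n + n) (n + n)" by (simp add: M_def carrier_matI)
  have "psd (n + n) M"
    unfolding psd_bil
  proof (intro conjI allI M)
    fix w :: "nat \<Rightarrow> complex"
    define u v where "u = w" and "v = (\<lambda>i. w (n + i))"
    have "bil (n + n) M w w = (\<Sum>i<n. \<Sum>j<n. cnj (u i) * \<rho> $$ (i, j) * u j) + (\<Sum>i<n. \<Sum>j<n. cnj (u i) * X $$ (i, j) * v j)
       + ((\<Sum>i<n. \<Sum>j<n. cnj (v i) * cnj (X $$ (j, i)) * u j) + (\<Sum>i<n. \<Sum>j<n. cnj (v i) * \<sigma> $$ (i, j) * v j))"
      by (simp add: bil_def sum_lessThan_add sum.distrib M_def u_def v_def)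
    also have "(\<Sum>i<n. \<Sum>j<n. cnj (v i) * cnj (X $$ (j, i)) * u j) = cnj (bil n X u v)"
      unfolding bil_def by (subst sum.swap) (simp add: ac_simps)
    finally have e: "bil (n + n) M w w = bil n \<rho> u u + bil n X u v + (cnj (bil n X u v) + bil n \<sigma> v v)"
      by (simp add: bil_def)
    show "Im (bil (n + n) M w w) = 0" unfolding e using p by (simp add: psd_bil)
    show "0 \<le> Re (bil (n + n) M w w)"
      unfolding e using assms by (auto simp: coupling_def algebra_simps)
  qed
  then obtain N where N: "psd (n + n) N" "N * N = M" using psd_sqrt_exists by blast
  have Nd: "dim_row N = n + n" "dim_col N = n + n" using psd_carrier[OF N(1)] by auto
  define A where "A = mat (n + n) n (\<lambda>(i, j). N $$ (i, j))"
  define B where "B = mat (n + n) n (\<lambda>(i, j). N $$ (i, n + j))"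
  have MN: "M $$ (a, b) = (\<Sum>k<n + n. cnj (N $$ (k, a)) * N $$ (k, b))" if "a < n + n" "b < n + n" for a b
  proof -
    have "M = adj N * N" using N psd_hermitian[OF N(1)] by simp
    thus ?thesis using that Nd by (simp add: index_mult_sum del: index_mult_mat(1))
  qed
  have "adj A * A = \<rho>"
    by (rule eq_matI) (auto simp: index_mult_sum A_def MN[symmetric] simp del: index_mult_mat(1), simp add: M_def)
  moreover have "adj A * B = X"
    by (rule eq_matI) (auto simp: index_mult_sum A_def B_def MN[symmetric] simp del: index_mult_mat(1), simp add: M_def)
  moreover have "adj B * B = \<sigma>"
    by (rule eq_matI) (auto simp: index_mult_sum B_def MN[symmetric] simp del: index_mult_mat(1), simp add: M_def)
  ultimately show ?thesis using that[of A B] by (simp add: A_def B_def)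
qed

lemma psd_conj:
  assumes "psd n A" "B \<in> carrier_mat n m"
  shows "psd m (adj B * A * B)"
proof -
  obtain S where S: "psd n S" "S * S = A" using psd_sqrt_exists[OF assms(1)] .
  have "adj (S * B) * (S * B) = adj B * A * B"
    using psd_carrier[OF S(1)] assms(2) psd_hermitian[OF S(1)] by (simp add: mat_assoc flip: S(2))
  thus ?thesis using psd_gram[of "S * B" m] assms(2) by simp
qed

text \<open>Uhlmann's theorem in matrix form: with \<open>S\<close> the root of
  \<open>\<sigma>\<close> and \<open>T\<close> the root of \<open>S * \<rho> * S\<close>, the
  fidelity is the trace of \<open>T\<close>. The polar factor of \<open>W * S\<close> yields a
  feasible \<open>X\<close> reaching it; for any feasible \<open>X\<close>, two polar decompositions
  rewrite its trace as an overlap of two contracted copies of the root of \<open>T\<close>.\<close>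

theorem fid_ge_iff_fidelity:
  assumes \<rho>: "psd n \<rho>" and \<sigma>: "psd n \<sigma>"
  shows "fid_ge n \<rho> \<sigma> c \<longleftrightarrow> c \<le> fidelity \<rho> \<sigma>"
proof -
  define S where "S = psd_sqrt \<sigma>"
  define T where "T = psd_sqrt (S * \<rho> * S)"
  have S: "psd n S" "S * S = \<sigma>" unfolding S_def using psd_sqrt[OF \<sigma>] by auto
  have "psd n (S * \<rho> * S)" using psd_conj[OF \<rho> psd_carrier[OF S(1)]] psd_hermitian[OF S(1)] by simp
  hence T: "psd n T" "T * T = S * \<rho> * S" unfolding T_def using psd_sqrt by auto
  have F: "fidelity \<rho> \<sigma> = Re (mtrace T)" by (simp add: fidelity_def T_def S_def)
  obtain W where W: "psd n W" "W * W = \<rho>" using psd_sqrt_exists[OF \<rho>] .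
  note h = psd_hermitian[OF S(1)] psd_hermitian[OF T(1)] psd_hermitian[OF W(1)]
  have [simp]: "dim_row S = n" "dim_col S = n" "dim_row T = n" "dim_col T = n" "dim_row W = n" "dim_col W = n"
    "dim_row \<rho> = n" "dim_col \<rho> = n"
    using psd_carrier[OF S(1)] psd_carrier[OF T(1)] psd_carrier[OF W(1)] psd_carrier[OF \<rho>] by auto
  show ?thesis
  proof
    assume "c \<le> fidelity \<rho> \<sigma>"
    have WS: "adj (W * S) * (W * S) = T * T" "W * S \<in> carrier_mat n n"
      by (simp_all add: h T(2) mat_assoc carrier_matI flip: W(2))
    obtain V where V: "V \<in> carrier_mat n n" "V * T = W * S" "adj V * (W * S) = T" "contr V"
      by (rule polar[OF T(1) WS(2,1)])
    \<comment> \<open>\<open>T = adj V * (W * S)\<close> is the absolute value of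
      \<open>W * S\<close>, so rotating \<open>W\<close> by \<open>adj V\<close> makes its overlap
      with \<open>S\<close> equal to the trace of \<open>T\<close>.\<close>
    have "coupling n (adj W * W) (adj (adj V * W) * S) (adj S * S)"
      by (rule coupling_contraction) (use V contr_adj psd_carrier S W in auto)
    moreover have "mtrace (adj (adj V * W) * S) = mtrace T"
    proof -
      have "mtrace (adj (adj V * W) * S) = mtrace (S * (adj W * V))"
        using V(1) by (subst mtrace_mult_comm) simp_all
      also have "S * (adj W * V) = adj (adj V * (W * S))" using V(1) by (simp add: h mat_assoc)
      also have "\<dots> = T" by (simp add: V(3) h)
      finally show ?thesis .
    qed
    ultimately show "fid_ge n \<rho> \<sigma> c"
      unfolding fid_ge_def using \<open>c \<le> fidelity \<rho> \<sigma>\<close> F h S(2) W(2) by (metis (no_types))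
  next
    assume "fid_ge n \<rho> \<sigma> c"
    then obtain X where X: "coupling n \<rho> X \<sigma>" "c \<le> Re (mtrace X)" by (auto simp: fid_ge_def)
    obtain A B where AB: "A \<in> carrier_mat (n + n) n" "B \<in> carrier_mat (n + n) n"
      "adj A * A = \<rho>" "adj B * B = \<sigma>" "adj A * B = X" using coupling_gram[OF X(1)] .
    have [simp]: "dim_row A = n + n" "dim_col A = n" "dim_row B = n + n" "dim_col B = n" using AB by auto
    have e: "adj B * B = S * S" by (simp add: AB(4) S(2))
    obtain V where V: "V \<in> carrier_mat (n + n) n" "V * S = B" "adj V * B = S" "contr V"
      by (rule polar[OF S(1) AB(2) e])
    have "adj (A * S) * (A * S) = S * ((adj A * A) * S)" by (simp add: mat_assoc h)
    also have "\<dots> = T * T" by (simp add: AB(3) T(2) mat_assoc)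
    finally have AS: "adj (A * S) * (A * S) = T * T" .
    have ASc: "A * S \<in> carrier_mat (n + n) n" by (simp add: carrier_matI)
    obtain Y where Y: "Y \<in> carrier_mat (n + n) n" "Y * T = A * S" "adj Y * (A * S) = T" "contr Y"
      by (rule polar[OF T(1) ASc AS])
    obtain R where R: "psd n R" "R * R = T" using psd_sqrt_exists[OF T(1)] .
    have [simp]: "dim_row R = n" "dim_col R = n" "dim_row V = n + n" "dim_col V = n" "dim_row Y = n + n" "dim_col Y = n"
      using psd_carrier[OF R(1)] V Y by auto
    \<comment> \<open>Cyclicity moves \<open>S\<close> next to \<open>adj A\<close>, where
      \<open>A * S = Y * T\<close> applies. Splitting \<open>T = R * R\<close> evenly then exposes
      the inner product of \<open>Y * R\<close> and \<open>V * R\<close>, neither of larger norm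
      than \<open>R\<close>.\<close>
    have "mtrace X = mtrace (adj A * (V * S))" by (simp add: AB(5) V(2))
    also have "\<dots> = mtrace (S * (adj A * V))"
      by (subst mtrace_mult_comm) (simp_all add: mat_assoc mtrace_mult_comm[of _ S])
    also have "S * (adj A * V) = adj (Y * T) * V" unfolding Y(2) by (simp add: h mat_assoc)
    also have "\<dots> = R * (R * (adj Y * V))" using psd_hermitian[OF R(1)] by (simp add: mat_assoc flip: R(2))
    also have "mtrace \<dots> = mtrace (adj (Y * R) * (V * R))"
      using psd_hermitian[OF R(1)] by (subst mtrace_mult_comm) (simp_all add: mat_assoc)
    finally have "2 * Re (mtrace X) \<le> nrm (Y * R) + nrm (V * R)"
      using inner_le_nrm[of "Y * R" "V * R"] by simp
    also have "\<dots> \<le> nrm R + nrm R" using V(4) Y(4) by (intro add_mono) (auto simp: contr_def)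
    also have "nrm R = Re (mtrace T)" using nrm_trace[of R] psd_hermitian[OF R(1)] R(2) by simp
    finally show "c \<le> fidelity \<rho> \<sigma>" using X(2) F by simp
  qed
qed

text \<open>\<open>B\<close> and \<open>B'\<close> purify the same \<open>\<sigma>\<close>; the
  contraction \<open>Q\<close> assembled from their polar factors maps one to the other, so
  \<open>Q * A\<close> can be paired with \<open>C\<close>. Since \<open>nrm (A - B)\<close> is
  \<open>2 - 2 * Re (mtrace X)\<close>, the loss \<open>\<eta>\<^sup>2 / 2\<close> in the first
  hypothesis bounds it by \<open>\<eta>\<^sup>2\<close>.\<close>

lemma fid_ge_triangle:
  assumes 1: "fid_ge n \<rho> \<sigma> (1 - \<eta>\<^sup>2 / 2)" and 2: "fid_ge n \<sigma> \<tau> (1 - \<zeta>)" and \<eta>: "\<eta> > 0"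
    and tr: "mtrace \<rho> = 1" "mtrace \<sigma> = 1" "mtrace \<tau> = 1"
  shows "fid_ge n \<rho> \<tau> (1 - \<zeta> - \<eta>)"
proof -
  obtain X Y where X: "coupling n \<rho> X \<sigma>" "1 - \<eta>\<^sup>2 / 2 \<le> Re (mtrace X)"
    and Y: "coupling n \<sigma> Y \<tau>" "1 - \<zeta> \<le> Re (mtrace Y)" using 1 2 by (auto simp: fid_ge_def)
  obtain A B where AB: "A \<in> carrier_mat (n + n) n" "B \<in> carrier_mat (n + n) n"
      "adj A * A = \<rho>" "adj B * B = \<sigma>" "adj A * B = X" using coupling_gram[OF X(1)] .
  obtain B' C where BC: "B' \<in> carrier_mat (n + n) n" "C \<in> carrier_mat (n + n) n"
      "adj B' * B' = \<sigma>" "adj C * C = \<tau>" "adj B' * C = Y" using coupling_gram[OF Y(1)] .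
  have [simp]: "dim_row A = n + n" "dim_col A = n" "dim_row B = n + n" "dim_col B = n"
    "dim_row B' = n + n" "dim_col B' = n" "dim_row C = n + n" "dim_col C = n" using AB BC by auto
  have "psd n \<sigma>" using X(1) by (simp add: coupling_def)
  then obtain S where S: "psd n S" "S * S = \<sigma>" using psd_sqrt_exists by blast
  have e: "adj B * B = S * S" "adj B' * B' = S * S" by (simp_all add: AB(4) BC(3) S(2))
  obtain V where V: "V \<in> carrier_mat (n + n) n" "V * S = B" "adj V * B = S" "contr V"
    by (rule polar[OF S(1) AB(2) e(1)])
  obtain V' where V': "V' \<in> carrier_mat (n + n) n" "V' * S = B'" "adj V' * B' = S" "contr V'"
    by (rule polar[OF S(1) BC(1) e(2)])
  have [simp]: "dim_row V = n + n" "dim_col V = n" "dim_row V' = n + n" "dim_col V' = n" using V V' by auto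
  define Q where "Q = V' * adj V"
  have Q: "contr Q" "Q \<in> carrier_mat (n + n) (n + n)" unfolding Q_def
    by (auto intro!: contr_mult contr_adj V V' carrier_matI)
  have [simp]: "dim_row Q = n + n" "dim_col Q = n + n" using Q by auto
  have QB: "Q * B = B'" by (simp add: Q_def mat_assoc V(3) V'(2))
  have nn: "nrm A = 1" "nrm B = 1" "nrm C = 1"
    using nrm_trace[of A] nrm_trace[of B] nrm_trace[of C] AB BC tr by simp_all
  define D where "D = A - B"
  have [simp]: "dim_row D = n + n" "dim_col D = n" by (simp_all add: D_def)
  have "nrm D \<le> \<eta>\<^sup>2" unfolding D_def using X(2) by (subst nrm_minus) (simp_all add: nn AB(5))
  moreover have "nrm (Q * D) \<le> nrm D" using Q(1) by (simp add: contr_def)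
  ultimately have nD: "nrm (Q * D) \<le> \<eta>\<^sup>2" by linarith
  \<comment> \<open>The weight \<open>\<eta>\<close> balances the two norms, so that the expansion
    gives the Cauchy-Schwarz bound \<open>\<eta>\<close> for the overlap of \<open>Q * D\<close>
    with \<open>C\<close>.\<close>
  have "nrm (Q * D + of_real \<eta> \<cdot>\<^sub>m C) = nrm (Q * D) + \<eta>\<^sup>2 * nrm C + 2 * \<eta> * Re (mtrace (adj (Q * D) * C))"
    by (rule nrm_add_smult) simp_all
  hence "0 \<le> 2 * \<eta>\<^sup>2 + 2 * \<eta> * Re (mtrace (adj (Q * D) * C))"
    using nrm_nonneg[of "Q * D + of_real \<eta> \<cdot>\<^sub>m C"] nD nn by simp
  hence "0 \<le> 2 * \<eta> * (\<eta> + Re (mtrace (adj (Q * D) * C)))" by (simp add: power2_eq_square algebra_simps)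
  hence d: "- \<eta> \<le> Re (mtrace (adj (Q * D) * C))" using \<eta> by (simp add: zero_le_mult_iff)
  have "Q * D = Q * A - B'" by (simp add: D_def mult_minus_mat QB)
  hence "adj (Q * D) * C = adj (Q * A) * C - Y" by (simp add: adj_minus minus_mult_mat BC(5) del: adj_mult)
  moreover have Yc: "Y \<in> carrier_mat n n" using Y(1) unfolding coupling_def by blast
  moreover have Qc: "adj (Q * A) * C \<in> carrier_mat n n" by (intro carrier_matI) simp_all
  ultimately have "mtrace (adj (Q * D) * C) = mtrace (adj (Q * A) * C) - mtrace Y"
    by (simp only: mtrace_minus[OF Qc Yc])
  hence "1 - \<zeta> - \<eta> \<le> Re (mtrace (adj (Q * A) * C))" using d Y(2) by (simp del: adj_mult)
  moreover have "coupling n \<rho> (adj (Q * A) * C) \<tau>"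
    using coupling_contraction[OF AB(1) BC(2) Q] AB(3) BC(4) by simp
  ultimately show ?thesis unfolding fid_ge_def by blast
qed

lemma fidelity_nonneg: "psd n \<rho> \<Longrightarrow> psd n \<sigma> \<Longrightarrow> 0 \<le> fidelity \<rho> \<sigma>"
proof -
  assume a: "psd n \<rho>" "psd n \<sigma>"
  have "coupling n \<rho> (0\<^sub>m n n) \<sigma>"
    using a by (auto simp: coupling_def bil_def[of n "0\<^sub>m n n"] psd_bil)
  hence "fid_ge n \<rho> \<sigma> 0" unfolding fid_ge_def by (intro exI[of _ "0\<^sub>m n n"]) (simp add: mtrace_def)
  thus ?thesis using fid_ge_iff_fidelity[OF a] by simp
qed

lemma fid_ge_refl:
  assumes "psd n \<rho>" "mtrace \<rho> = 1"
  shows "fid_ge n \<rho> \<rho> 1"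
proof -
  obtain S where S: "psd n S" "S * S = \<rho>" using psd_sqrt_exists[OF assms(1)] .
  have "contr (1\<^sub>m n)" unfolding contr_def by (auto simp: left_mult_one_mat')
  from coupling_contraction[OF psd_carrier[OF S(1)] psd_carrier[OF S(1)] this] have "coupling n \<rho> \<rho> \<rho>"
    using S psd_hermitian[OF S(1)] psd_carrier[OF S(1)] by simp
  thus ?thesis unfolding fid_ge_def using assms(2) by (intro exI[of _ \<rho>]) simp
qed

lemma fid_ge_mono: "fid_ge n \<rho> \<sigma> c \<Longrightarrow> c' \<le> c \<Longrightarrow> fid_ge n \<rho> \<sigma> c'"
  unfolding fid_ge_def using order_trans by blast

section \<open>Purified distance against lower bounds on the fidelity\<close>

lemma pdist_le_imp_fid_ge:
  assumes "psd n \<rho>" "psd n \<sigma>" "pdist \<rho> \<sigma> \<le> \<epsilon>" "0 \<le> \<epsilon>" "\<epsilon> \<le> 1"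
  shows "fid_ge n \<rho> \<sigma> (1 - \<epsilon>\<^sup>2)"
proof -
  let ?F = "fidelity \<rho> \<sigma>"
  have F0: "0 \<le> ?F" using fidelity_nonneg[OF assms(1,2)] .
  have "1 - ?F\<^sup>2 \<le> \<epsilon>\<^sup>2"
  proof (cases "1 - ?F\<^sup>2 \<le> 0")
    case False
    hence "sqrt (1 - ?F\<^sup>2) ^ 2 \<le> \<epsilon> ^ 2" using assms(3,4) by (intro power_mono) (auto simp: pdist_def)
    thus ?thesis using False by simp
  qed (use zero_le_power2[of \<epsilon>] in linarith)
  \<comment> \<open>Squaring a number in \<open>[0, 1]\<close> makes it smaller. This trades the
    square root for a cruder bound, which still tends to 1.\<close>
  moreover have "(1 - \<epsilon>\<^sup>2)\<^sup>2 \<le> 1 - \<epsilon>\<^sup>2"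
  proof -
    have "0 \<le> 1 - \<epsilon>\<^sup>2" "1 - \<epsilon>\<^sup>2 \<le> 1" using assms(4,5) by (simp_all add: power_le_one)
    thus ?thesis by (simp add: power2_eq_square mult_left_le)
  qed
  ultimately have "(1 - \<epsilon>\<^sup>2)\<^sup>2 \<le> ?F\<^sup>2" by linarith
  hence "1 - \<epsilon>\<^sup>2 \<le> ?F" using F0 by (rule power2_le_imp_le)
  thus ?thesis using fid_ge_iff_fidelity[OF assms(1,2)] by simp
qed

lemma fid_ge_imp_pdist_le:
  assumes "fid_ge n \<rho> \<sigma> c" "0 \<le> c" "1 - c\<^sup>2 \<le> \<epsilon>\<^sup>2" "0 \<le> \<epsilon>"
  shows "pdist \<rho> \<sigma> \<le> \<epsilon>"
proof -
  have p: "psd n \<rho>" "psd n \<sigma>" using assms(1) by (auto simp: fid_ge_def coupling_def)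
  have "c \<le> fidelity \<rho> \<sigma>" using fid_ge_iff_fidelity[OF p] assms(1) by simp
  hence "c\<^sup>2 \<le> (fidelity \<rho> \<sigma>)\<^sup>2" using assms(2) by (intro power_mono)
  thus ?thesis unfolding pdist_def using assms(3,4) by (intro real_le_lsqrt real_sqrt_le_iff[THEN iffD2, THEN order_trans]) auto
qed

subsection \<open>Multi-indices and kernels\<close>

text \<open>The range of \<open>decode ds\<close>. Summing over digit lists instead of flat indices
  turns an operation of one party into a change of one list entry.\<close>

definition idx :: "nat list \<Rightarrow> nat list set" where
  "idx ds = {xs. list_all2 (<) xs ds}"

lemma idx_iff: "xs \<in> idx ds \<longleftrightarrow> length xs = length ds \<and> (\<forall>t<length ds. xs ! t < ds ! t)"
  by (auto simp: idx_def list_all2_conv_all_nth)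

lemma idx_length: "xs \<in> idx ds \<Longrightarrow> length xs = length ds"
  by (simp add: idx_iff)

lemma idx_Nil [simp]: "idx [] = {[]}"
  by (auto simp: idx_def)

lemma encode_less: "xs \<in> idx ds \<Longrightarrow> encode ds xs < prod_list ds"
proof (induction ds arbitrary: xs)
  case (Cons d ds)
  then obtain y ys where xs: "xs = y # ys" "y < d" "ys \<in> idx ds" by (auto simp: idx_def list_all2_Cons2)
  have "y * prod_list ds + encode ds ys < y * prod_list ds + prod_list ds" using Cons.IH[OF xs(3)] by simp
  also have "\<dots> = Suc y * prod_list ds" by simp
  also have "\<dots> \<le> d * prod_list ds" using xs(2) by (intro mult_right_mono) auto
  finally show ?case by (simp add: xs)
qed simp

lemma decode_encode: "xs \<in> idx ds \<Longrightarrow> decode ds (encode ds xs) = xs"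
proof (induction ds arbitrary: xs)
  case (Cons d ds)
  then obtain y ys where xs: "xs = y # ys" "y < d" "ys \<in> idx ds" by (auto simp: idx_def list_all2_Cons2)
  have p: "prod_list ds \<noteq> 0" using encode_less[OF xs(3)] by linarith
  have "(y * prod_list ds + encode ds ys) div prod_list ds = y"
    using encode_less[OF xs(3)] by (simp only: div_mult_self3[OF p] div_less add_0_right)
  thus ?case using Cons.IH[OF xs(3)] encode_less[OF xs(3)] xs by simp
qed simp

lemma decode_idx: "n < prod_list ds \<Longrightarrow> decode ds n \<in> idx ds"
proof (induction ds arbitrary: n)
  case (Cons d ds)
  have p: "prod_list ds > 0" using Cons.prems by (cases "prod_list ds") auto
  have "n div prod_list ds < d" using Cons.prems by (simp add: less_mult_imp_div_less)
  thus ?case using Cons.IH[of "n mod prod_list ds"] p by (simp add: idx_def)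
qed simp

lemma encode_decode: "n < prod_list ds \<Longrightarrow> encode ds (decode ds n) = n"
proof (induction ds arbitrary: n)
  case (Cons d ds)
  have p: "prod_list ds > 0" using Cons.prems by (cases "prod_list ds") auto
  thus ?case using Cons.IH[of "n mod prod_list ds"] by simp
qed simp

lemma bij_decode: "bij_betw (decode ds) {..<prod_list ds} (idx ds)"
  by (rule bij_betw_byWitness[where f' = "encode ds"])
    (auto simp: encode_decode decode_encode decode_idx encode_less)

lemma finite_idx [simp]: "finite (idx ds)"
  using bij_betw_finite[OF bij_decode] by simp

lemma sum_idx: "(\<Sum>i<prod_list ds. f i) = (\<Sum>x\<in>idx ds. f (encode ds x))"
  by (subst sum.reindex_bij_betw[OF bij_decode, symmetric]) (simp add: encode_decode)

definition kmat :: "nat list \<Rightarrow> nat list \<Rightarrow> (nat list \<Rightarrow> nat list \<Rightarrow> complex) \<Rightarrow> complex mat" where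
  "kmat d' d \<kappa> = mat (prod_list d') (prod_list d) (\<lambda>(a, b). \<kappa> (decode d' a) (decode d b))"

lemma dim_kmat [simp]: "dim_row (kmat d' d \<kappa>) = prod_list d'" "dim_col (kmat d' d \<kappa>) = prod_list d"
  by (simp_all add: kmat_def)

lemma kmat_carrier [simp]: "kmat d' d \<kappa> \<in> carrier_mat (prod_list d') (prod_list d)"
  by (simp add: carrier_matI)

lemma kmat_encode [simp]:
  "x \<in> idx d' \<Longrightarrow> y \<in> idx d \<Longrightarrow> kmat d' d \<kappa> $$ (encode d' x, encode d y) = \<kappa> x y"
  by (simp add: kmat_def encode_less decode_encode)

lemma kmat_eqI:
  assumes "A \<in> carrier_mat (prod_list d') (prod_list d)" "B \<in> carrier_mat (prod_list d') (prod_list d)"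
    "\<And>x y. x \<in> idx d' \<Longrightarrow> y \<in> idx d \<Longrightarrow> A $$ (encode d' x, encode d y) = B $$ (encode d' x, encode d y)"
  shows "A = B"
proof (rule eq_matI)
  fix i j assume "i < dim_row B" "j < dim_col B"
  hence ij: "i < prod_list d'" "j < prod_list d" using assms by auto
  thus "A $$ (i, j) = B $$ (i, j)"
    using assms(3)[OF decode_idx decode_idx, of i j] by (simp add: encode_decode)
qed (use assms in auto)

lemma kmat_cong:
  "(\<And>x y. x \<in> idx d' \<Longrightarrow> y \<in> idx d \<Longrightarrow> \<kappa> x y = \<kappa>' x y) \<Longrightarrow> kmat d' d \<kappa> = kmat d' d \<kappa>'"
  by (rule kmat_eqI[OF kmat_carrier kmat_carrier]) simp

lemma kmat_ker:
  "A \<in> carrier_mat (prod_list d') (prod_list d) \<Longrightarrow> kmat d' d (\<lambda>x y. A $$ (encode d' x, encode d y)) = A"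
  by (rule kmat_eqI[OF kmat_carrier]) (simp_all only: kmat_encode)

lemma index_mult_encode:
  assumes "A \<in> carrier_mat (prod_list d'') (prod_list d')" "B \<in> carrier_mat (prod_list d') (prod_list d)"
    "x \<in> idx d''" "z \<in> idx d"
  shows "(A * B) $$ (encode d'' x, encode d z)
    = (\<Sum>y\<in>idx d'. A $$ (encode d'' x, encode d' y) * B $$ (encode d' y, encode d z))"
  using assms encode_less[OF assms(3)] encode_less[OF assms(4)]
  by (subst index_mult_sum) (auto simp: sum_idx)

lemma kmat_mult: "kmat d'' d' \<kappa> * kmat d' d \<kappa>' = kmat d'' d (\<lambda>x z. \<Sum>y\<in>idx d'. \<kappa> x y * \<kappa>' y z)"
  by (rule kmat_eqI[where d' = d'' and d = d])
    (auto simp: index_mult_encode[OF kmat_carrier kmat_carrier] intro!: carrier_matI simp del: index_mult_mat(1))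

lemma adj_kmat: "adj (kmat d' d \<kappa>) = kmat d d' (\<lambda>x y. cnj (\<kappa> y x))"
  by (rule kmat_eqI[where d' = d and d = d']) (auto simp: encode_less intro!: carrier_matI)

lemma kmat_conj:
  "kmat d' d \<kappa> * kmat d d \<alpha> * adj (kmat d' d \<kappa>)
    = kmat d' d' (\<lambda>x x'. \<Sum>y\<in>idx d. \<Sum>y'\<in>idx d. \<kappa> x y * \<alpha> y y' * cnj (\<kappa> x' y'))"
  unfolding adj_kmat kmat_mult
  by (rule kmat_cong) (simp add: sum_distrib_right, subst sum.swap, simp)

subsection \<open>Kraus maps\<close>

lemma sum_list_sum: "sum_list (map (\<lambda>K. \<Sum>i\<in>I. f K i) Ks) = (\<Sum>i\<in>I. sum_list (map (\<lambda>K. f K i :: complex) Ks))"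
  by (induction Ks) (simp_all add: sum.distrib)

lemma sum_list_mult_left: "sum_list (map (\<lambda>K. c * f K) Ks) = c * (sum_list (map f Ks) :: complex)"
  by (induction Ks) (simp_all add: algebra_simps)

lemma sum_list_mult_right: "sum_list (map (\<lambda>K. f K * c) Ks) = sum_list (map f Ks) * (c :: complex)"
  by (induction Ks) (simp_all add: algebra_simps)

lemma sum_list_map_swap:
  "sum_list (map (\<lambda>G. sum_list (map (\<lambda>F. f G F) Fs)) Gs) = sum_list (map (\<lambda>F. sum_list (map (\<lambda>G. f G F :: complex) Gs)) Fs)"
  by (induction Gs) (simp_all add: sum_list_addf)

text \<open>No completeness is built in, so that a single outcome of an instrument is covered too;
  \<open>kraus\<close> supplies trace preservation.\<close>

definition krs :: "nat \<Rightarrow> complex mat list \<Rightarrow> complex mat \<Rightarrow> complex mat" where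
  "krs M Ks A = mat M M (\<lambda>(a, b). sum_list (map (\<lambda>K. (K * A * adj K) $$ (a, b)) Ks))"

definition kraus :: "nat \<Rightarrow> nat \<Rightarrow> complex mat list \<Rightarrow> bool" where
  "kraus N M Ks \<longleftrightarrow> (\<forall>K\<in>set Ks. K \<in> carrier_mat M N) \<and>
     (\<forall>i<N. \<forall>j<N. sum_list (map (\<lambda>K. (adj K * K) $$ (i, j)) Ks) = (if i = j then 1 else 0))"

lemma apply_instr_krs: "apply_instr d' Ks A = krs (prod_list d') (concat Ks) A"
  by (simp add: apply_instr_def krs_def)

lemma krs_carrier [simp]: "krs M Ks A \<in> carrier_mat M M" "dim_row (krs M Ks A) = M" "dim_col (krs M Ks A) = M"
  by (simp_all add: krs_def)

lemma index_conj:
  assumes "K \<in> carrier_mat M N" "A \<in> carrier_mat N N" "a < M" "b < M"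
  shows "(K * A * adj K) $$ (a, b) = (\<Sum>i<N. \<Sum>j<N. K $$ (a, i) * A $$ (i, j) * cnj (K $$ (b, j)))"
proof -
  have "(K * A * adj K) $$ (a, b) = (\<Sum>j<N. (\<Sum>i<N. K $$ (a, i) * A $$ (i, j)) * cnj (K $$ (b, j)))"
    using assms by (auto simp: index_mult_sum simp del: index_mult_mat(1) intro!: sum.cong)
  also have "\<dots> = (\<Sum>i<N. \<Sum>j<N. K $$ (a, i) * A $$ (i, j) * cnj (K $$ (b, j)))"
    unfolding sum_distrib_right by (rule sum.swap)
  finally show ?thesis .
qed

text \<open>The vector \<open>adj K\<close> applied to \<open>u\<close>. Pulling test vectors back
  along each Kraus operator reduces positivity of an output to positivity of the input.\<close>

definition adv :: "nat \<Rightarrow> complex mat \<Rightarrow> (nat \<Rightarrow> complex) \<Rightarrow> nat \<Rightarrow> complex" where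
  "adv M K u = (\<lambda>j. \<Sum>i<M. cnj (K $$ (i, j)) * u i)"

lemma bil_conj:
  assumes "K \<in> carrier_mat M N" "A \<in> carrier_mat N N"
  shows "bil M (K * A * adj K) u v = bil N A (adv M K u) (adv M K v)"
proof -
  have "bil M (K * A * adj K) u v
    = (\<Sum>a<M. \<Sum>b<M. \<Sum>i<N. \<Sum>j<N. cnj (u a) * (K $$ (a, i) * A $$ (i, j) * cnj (K $$ (b, j))) * v b)"
    unfolding bil_def using assms
    by (intro sum.cong refl) (simp add: index_conj sum_distrib_left sum_distrib_right del: index_mult_mat(1))
  also have "\<dots> = (\<Sum>a<M. \<Sum>i<N. \<Sum>b<M. \<Sum>j<N. cnj (u a) * (K $$ (a, i) * A $$ (i, j) * cnj (K $$ (b, j))) * v b)"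
    by (intro sum.cong refl sum.swap)
  also have "\<dots> = (\<Sum>i<N. \<Sum>a<M. \<Sum>j<N. \<Sum>b<M. cnj (u a) * (K $$ (a, i) * A $$ (i, j) * cnj (K $$ (b, j))) * v b)"
    by (subst sum.swap) (intro sum.cong refl sum.swap)
  also have "\<dots> = (\<Sum>i<N. \<Sum>j<N. \<Sum>a<M. \<Sum>b<M. cnj (u a) * (K $$ (a, i) * A $$ (i, j) * cnj (K $$ (b, j))) * v b)"
    by (intro sum.cong refl sum.swap)
  also have "\<dots> = bil N A (adv M K u) (adv M K v)"
    unfolding bil_def adv_def
    by (intro sum.cong refl) (simp add: sum_distrib_left sum_distrib_right ac_simps)
  finally show ?thesis .
qed

lemma bil_krs:
  assumes "\<forall>K\<in>set Ks. K \<in> carrier_mat M N" "A \<in> carrier_mat N N"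
  shows "bil M (krs M Ks A) u v = sum_list (map (\<lambda>K. bil N A (adv M K u) (adv M K v)) Ks)"
proof -
  have "bil M (krs M Ks A) u v = (\<Sum>a<M. \<Sum>b<M. sum_list (map (\<lambda>K. cnj (u a) * (K * A * adj K) $$ (a, b) * v b) Ks))"
    unfolding bil_def by (intro sum.cong refl) (simp add: krs_def sum_list_mult_left sum_list_mult_right)
  also have "\<dots> = sum_list (map (\<lambda>K. bil M (K * A * adj K) u v) Ks)"
    unfolding bil_def sum_list_sum ..
  also have "\<dots> = sum_list (map (\<lambda>K. bil N A (adv M K u) (adv M K v)) Ks)"
    by (intro arg_cong[where f = sum_list] map_cong refl bil_conj) (use assms in auto)
  finally show ?thesis .
qed

lemma Re_sum_list: "Re (sum_list (map f Ks)) = sum_list (map (\<lambda>K. Re (f K)) Ks)"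
  by (induction Ks) simp_all

lemma Im_sum_list: "Im (sum_list (map f Ks)) = sum_list (map (\<lambda>K. Im (f K)) Ks)"
  by (induction Ks) simp_all

lemma krs_psd:
  assumes "\<forall>K\<in>set Ks. K \<in> carrier_mat M N" "psd N A"
  shows "psd M (krs M Ks A)"
proof -
  have "A \<in> carrier_mat N N" using assms(2) by (rule psd_carrier)
  note b = bil_krs[OF assms(1) this]
  show ?thesis unfolding psd_bil b Im_sum_list Re_sum_list
    using assms(2) by (auto simp: psd_bil intro!: sum_list_nonneg)
qed

lemma krs_trace:
  assumes k: "kraus N M Ks" and A: "A \<in> carrier_mat N N"
  shows "mtrace (krs M Ks A) = mtrace A"
proof -
  have c: "\<forall>K\<in>set Ks. K \<in> carrier_mat M N" using k by (simp add: kraus_def)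
  have "mtrace (krs M Ks A) = sum_list (map (\<lambda>K. \<Sum>a<M. (K * A * adj K) $$ (a, a)) Ks)"
    unfolding sum_list_sum by (simp add: mtrace_def krs_def)
  also have "\<dots> = sum_list (map (\<lambda>K. \<Sum>i<N. \<Sum>j<N. (adj K * K) $$ (j, i) * A $$ (i, j)) Ks)"
  proof (intro arg_cong[where f = sum_list] map_cong refl)
    fix K assume "K \<in> set Ks"
    hence K: "K \<in> carrier_mat M N" using c by blast
    have "(\<Sum>a<M. (K * A * adj K) $$ (a, a)) = mtrace (K * A * adj K)" using K by (simp add: mtrace_def)
    also have "\<dots> = mtrace (adj K * (K * A))" using K A by (subst mtrace_mult_comm) auto
    also have "adj K * (K * A) = (adj K * K) * A" using K A by (simp add: mat_assoc)
    also have "mtrace \<dots> = mtrace (A * (adj K * K))" using K A by (subst mtrace_mult_comm) auto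
    also have "\<dots> = (\<Sum>i<N. \<Sum>j<N. (adj K * K) $$ (j, i) * A $$ (i, j))"
      unfolding mtrace_def using A K
      by (auto simp: index_mult_sum[where A = A and B = "adj K * K"] mult.commute simp del: index_mult_mat(1) intro!: sum.cong)
    finally show "(\<Sum>a<M. (K * A * adj K) $$ (a, a)) = (\<Sum>i<N. \<Sum>j<N. (adj K * K) $$ (j, i) * A $$ (i, j))" .
  qed
  also have "\<dots> = (\<Sum>i<N. \<Sum>j<N. (if j = i then 1 else 0) * A $$ (i, j))"
    unfolding sum_list_sum sum_list_mult_right using k by (auto simp: kraus_def intro!: sum.cong)
  also have "\<dots> = mtrace A" using A by (simp add: mtrace_def if_distrib[of "\<lambda>c. c * _"] cong: if_cong)
  finally show ?thesis .
qed

text \<open>The image of a feasible \<open>X\<close> is feasible with the same trace: the block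
  inequality is pulled back along each Kraus operator and summed.\<close>

lemma krs_fid_ge:
  assumes k: "kraus N M Ks" and f: "fid_ge N \<rho> \<sigma> c"
  shows "fid_ge M (krs M Ks \<rho>) (krs M Ks \<sigma>) c"
proof -
  obtain X where X: "coupling N \<rho> X \<sigma>" "c \<le> Re (mtrace X)" using f by (auto simp: fid_ge_def)
  have Kc: "\<forall>K\<in>set Ks. K \<in> carrier_mat M N" using k by (simp add: kraus_def)
  have p: "psd N \<rho>" "psd N \<sigma>" "X \<in> carrier_mat N N" using X by (simp_all add: coupling_def)
  note b = bil_krs[OF Kc psd_carrier[OF p(1)]] bil_krs[OF Kc psd_carrier[OF p(2)]] bil_krs[OF Kc p(3)]
  have "coupling M (krs M Ks \<rho>) (krs M Ks X) (krs M Ks \<sigma>)"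
    unfolding coupling_def
  proof (intro conjI allI krs_psd[OF Kc] p krs_carrier)
    fix u v
    have "0 \<le> sum_list (map (\<lambda>K. Re (bil N \<rho> (adv M K u) (adv M K u)) + 2 * Re (bil N X (adv M K u) (adv M K v))
        + Re (bil N \<sigma> (adv M K v) (adv M K v))) Ks)"
      using X(1) by (intro sum_list_nonneg) (auto simp: coupling_def)
    also have "\<dots> = Re (bil M (krs M Ks \<rho>) u u) + 2 * Re (bil M (krs M Ks X) u v) + Re (bil M (krs M Ks \<sigma>) v v)"
      unfolding b Re_sum_list by (simp add: sum_list_addf sum_list_const_mult)
    finally show "0 \<le> \<dots>" .
  qed
  thus ?thesis unfolding fid_ge_def using X(2) krs_trace[OF k p(3)] by metis
qed

lemma krs_compose:
  assumes F: "\<forall>F\<in>set Fs. F \<in> carrier_mat M N" and G: "\<forall>G\<in>set Gs. G \<in> carrier_mat L M"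
    and A: "A \<in> carrier_mat N N" and ab: "a < L" "b < L"
  shows "krs L Gs (krs M Fs A) $$ (a, b)
    = sum_list (map (\<lambda>F. sum_list (map (\<lambda>G. ((G * F) * A * adj (G * F)) $$ (a, b)) Gs)) Fs)"
proof -
  have "krs L Gs (krs M Fs A) $$ (a, b) = sum_list (map (\<lambda>G. \<Sum>i<M. \<Sum>j<M. G $$ (a, i) * krs M Fs A $$ (i, j) * cnj (G $$ (b, j))) Gs)"
    unfolding krs_def[of L] using ab
    by (simp del: index_mult_mat(1), intro arg_cong[where f = sum_list] map_cong refl index_conj) (use G in auto)
  also have "\<dots> = sum_list (map (\<lambda>G. sum_list (map (\<lambda>F. \<Sum>i<M. \<Sum>j<M. G $$ (a, i) * (F * A * adj F) $$ (i, j) * cnj (G $$ (b, j))) Fs)) Gs)"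
    by (intro arg_cong[where f = sum_list] map_cong refl)
      (simp add: sum_list_sum krs_def sum_list_mult_left sum_list_mult_right)
  also have "\<dots> = sum_list (map (\<lambda>G. sum_list (map (\<lambda>F. ((G * F) * A * adj (G * F)) $$ (a, b)) Fs)) Gs)"
  proof (intro arg_cong[where f = sum_list] map_cong refl)
    fix G' F assume "G' \<in> set Gs" "F \<in> set Fs"
    hence c: "G' \<in> carrier_mat L M" "F \<in> carrier_mat M N" using F G by auto
    have e: "G' * F * A * adj (G' * F) = G' * (F * A * adj F) * adj G'" using c A by (simp add: mat_assoc)
    have "F * A * adj F \<in> carrier_mat M M" using c A by (intro carrier_matI) auto
    thus "(\<Sum>i<M. \<Sum>j<M. G' $$ (a, i) * (F * A * adj F) $$ (i, j) * cnj (G' $$ (b, j))) = (G' * F * A * adj (G' * F)) $$ (a, b)"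
      unfolding e by (rule index_conj[OF c(1) _ ab, symmetric])
  qed
  also have "\<dots> = sum_list (map (\<lambda>F. sum_list (map (\<lambda>G. ((G * F) * A * adj (G * F)) $$ (a, b)) Gs)) Fs)"
    by (rule sum_list_map_swap)
  finally show ?thesis .
qed

subsection \<open>LOCC instruments as Kraus maps\<close>

lemma lift_local_kmat:
  "lift_local d d' j L = kmat d' d (\<lambda>x y. if \<forall>t<length d. t \<noteq> j \<longrightarrow> x ! t = y ! t then L $$ (x ! j, y ! j) else 0)"
  by (simp add: lift_local_def kmat_def Let_def)

text \<open>The indices that agree with \<open>x\<close> away from position \<open>j\<close> are the
  updates \<open>x[j := a]\<close>, so a sum against a lifted local operator collapses to a sum over
  one local index.\<close>

lemma sum_idx_fiber:
  assumes j: "j < length d" and l: "length d' = length d" and dd: "\<forall>t<length d. t \<noteq> j \<longrightarrow> d' ! t = d ! t"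
    and x: "x \<in> idx d'"
  shows "(\<Sum>y\<in>idx d. if \<forall>t<length d. t \<noteq> j \<longrightarrow> x ! t = y ! t then g y else 0) = (\<Sum>a<d ! j. g (x[j := a]) :: complex)"
proof -
  have "{y \<in> idx d. \<forall>t<length d. t \<noteq> j \<longrightarrow> x ! t = y ! t} = (\<lambda>a. x[j := a]) ` {..<d ! j}" (is "?S = ?T")
  proof (intro equalityI subsetI)
    fix y assume "y \<in> ?S"
    hence y: "y \<in> idx d" "\<forall>t<length d. t \<noteq> j \<longrightarrow> x ! t = y ! t" by auto
    have "y = x[j := y ! j]" using y x l j by (intro nth_equalityI) (auto simp: idx_iff nth_list_update)
    moreover have "y ! j < d ! j" using y j by (auto simp: idx_iff)
    ultimately show "y \<in> ?T" by blast
  next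
    fix y assume "y \<in> ?T"
    thus "y \<in> ?S" using x l dd j by (auto simp: idx_iff nth_list_update) metis
  qed
  moreover have "inj_on (\<lambda>a. x[j := a]) {..<d ! j}"
    by (rule inj_onI) (metis x l j idx_length nth_list_update_eq)
  ultimately show ?thesis by (simp add: sum.inter_filter[symmetric] sum.reindex)
qed

lemma sum_mult_if: "(\<Sum>a\<in>S. f a * (if P then g a else 0)) = (if P then (\<Sum>a\<in>S. f a * g a) else (0 :: complex))"
  by simp

lemma if_nested: "(if P then if Q then a else b else b) = (if P \<and> Q then a else b)"
  by simp

lemma sum_list_if: "sum_list (map (\<lambda>L. if P then f L else 0) Ls) = (if P then sum_list (map f Ls) else (0 :: complex))"
  by (induction Ls) simp_all

lemma sum_list_map_concat:
  "sum_list (map f (concat xss)) = (sum_list (map (\<lambda>xs. sum_list (map f xs)) xss) :: complex)"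
  by (induction xss) simp_all

lemma lift_local_gram:
  assumes j: "j < length d" and l: "length d' = length d" and dd: "\<forall>t<length d. t \<noteq> j \<longrightarrow> d' ! t = d ! t"
    and L: "L \<in> carrier_mat (d' ! j) (d ! j)" and y: "y \<in> idx d" and z: "z \<in> idx d"
  shows "(adj (lift_local d d' j L) * lift_local d d' j L) $$ (encode d y, encode d z)
    = (if \<forall>t<length d. t \<noteq> j \<longrightarrow> y ! t = z ! t then (adj L * L) $$ (y ! j, z ! j) else 0)"
proof -
  let ?P = "\<lambda>x y. \<forall>t<length d. t \<noteq> j \<longrightarrow> x ! t = y ! t"
  have ly: "length y = length d" using y by (rule idx_length)
  have "(adj (lift_local d d' j L) * lift_local d d' j L) $$ (encode d y, encode d z)
    = (\<Sum>x\<in>idx d'. cnj (if ?P x y then L $$ (x ! j, y ! j) else 0) * (if ?P x z then L $$ (x ! j, z ! j) else 0))"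
    unfolding lift_local_kmat adj_kmat kmat_mult using y z by simp
  also have "\<dots> = (\<Sum>x\<in>idx d'. if \<forall>t<length d'. t \<noteq> j \<longrightarrow> y ! t = x ! t
      then cnj (L $$ (x ! j, y ! j)) * (if ?P x z then L $$ (x ! j, z ! j) else 0) else 0)"
    by (rule sum.cong) (auto simp: l)
  also have "\<dots> = (\<Sum>a<d' ! j. cnj (L $$ (y[j := a] ! j, y ! j)) * (if ?P (y[j := a]) z then L $$ (y[j := a] ! j, z ! j) else 0))"
    by (rule sum_idx_fiber) (use j l dd y in auto)
  also have "\<dots> = (\<Sum>a<d' ! j. cnj (L $$ (a, y ! j)) * (if ?P y z then L $$ (a, z ! j) else 0))"
    using j ly by (intro sum.cong refl) auto
  also have "\<dots> = (if ?P y z then (\<Sum>a<d' ! j. cnj (L $$ (a, y ! j)) * L $$ (a, z ! j)) else 0)"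
    by (rule sum_mult_if)
  also have "(\<Sum>a<d' ! j. cnj (L $$ (a, y ! j)) * L $$ (a, z ! j)) = (adj L * L) $$ (y ! j, z ! j)"
    using L y z j by (auto simp: index_mult_sum idx_iff simp del: index_mult_mat(1))
  finally show ?thesis .
qed

lemma lift_local_kraus:
  assumes j: "j < length d" and l: "length d' = length d" and dd: "\<forall>t<length d. t \<noteq> j \<longrightarrow> d' ! t = d ! t"
    and L: "\<forall>L\<in>set Ls. L \<in> carrier_mat (d' ! j) (d ! j)"
    and s: "\<forall>a<d ! j. \<forall>b<d ! j. sum_list (map (\<lambda>L. (adj L * L) $$ (a, b)) Ls) = (if a = b then 1 else 0)"
  shows "kraus (prod_list d) (prod_list d') (map (lift_local d d' j) Ls)"
  unfolding kraus_def
proof (intro conjI allI impI)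
  show "\<forall>K\<in>set (map (lift_local d d' j) Ls). K \<in> carrier_mat (prod_list d') (prod_list d)"
    by (auto simp: lift_local_kmat)
  fix a b assume ab: "a < prod_list d" "b < prod_list d"
  define y z where "y = decode d a" and "z = decode d b"
  have y: "y \<in> idx d" "encode d y = a" and z: "z \<in> idx d" "encode d z = b"
    using ab by (auto simp: y_def z_def decode_idx encode_decode)
  let ?P = "\<forall>t<length d. t \<noteq> j \<longrightarrow> y ! t = z ! t"
  have "sum_list (map (\<lambda>K. (adj K * K) $$ (a, b)) (map (lift_local d d' j) Ls))
    = sum_list (map (\<lambda>L. if ?P then (adj L * L) $$ (y ! j, z ! j) else 0) Ls)"
    unfolding map_map comp_def y(2)[symmetric] z(2)[symmetric]
    by (intro arg_cong[where f = sum_list] map_cong refl lift_local_gram[OF j l dd]) (use L y z in auto)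
  also have "\<dots> = (if ?P then sum_list (map (\<lambda>L. (adj L * L) $$ (y ! j, z ! j)) Ls) else 0)"
    by (rule sum_list_if)
  also have "sum_list (map (\<lambda>L. (adj L * L) $$ (y ! j, z ! j)) Ls) = (if y ! j = z ! j then 1 else 0)"
    using s y(1) z(1) j by (simp add: idx_iff del: index_mult_mat(1))
  also have "(if ?P then if y ! j = z ! j then 1 else 0 else 0) = (if ?P \<and> y ! j = z ! j then 1 else 0 :: complex)"
    by (rule if_nested)
  also have "?P \<and> y ! j = z ! j \<longleftrightarrow> y = z"
    using y(1) z(1) j by (auto simp: list_eq_iff_nth_eq idx_iff)
  also have "y = z \<longleftrightarrow> a = b" using y z by (metis decode_encode)
  finally show "sum_list (map (\<lambda>K. (adj K * K) $$ (a, b)) (map (lift_local d d' j) Ls)) = (if a = b then 1 else 0)" .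
qed

lemma krs_lift_local:
  assumes j: "j < length d" and l: "length d' = length d" and dd: "\<forall>t<length d. t \<noteq> j \<longrightarrow> d' ! t = d ! t"
  shows "krs (prod_list d') (map (lift_local d d' j) Ls) (kmat d d \<kappa>)
    = kmat d' d' (\<lambda>x x'. sum_list (map (\<lambda>L. \<Sum>a<d ! j. \<Sum>a'<d ! j.
        L $$ (x ! j, a) * \<kappa> (x[j := a]) (x'[j := a']) * cnj (L $$ (x' ! j, a'))) Ls))"
proof (rule kmat_eqI)
  fix x x' assume x: "x \<in> idx d'" and x': "x' \<in> idx d'"
  have lx: "length x = length d" "length x' = length d" using x x' l by (simp_all add: idx_length)
  let ?P = "\<lambda>x y. \<forall>t<length d. t \<noteq> j \<longrightarrow> x ! t = y ! t"
  have "(lift_local d d' j L * kmat d d \<kappa> * adj (lift_local d d' j L)) $$ (encode d' x, encode d' x')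
    = (\<Sum>a<d ! j. \<Sum>a'<d ! j. L $$ (x ! j, a) * \<kappa> (x[j := a]) (x'[j := a']) * cnj (L $$ (x' ! j, a')))" for L
  proof -
    have "(lift_local d d' j L * kmat d d \<kappa> * adj (lift_local d d' j L)) $$ (encode d' x, encode d' x')
      = (\<Sum>y\<in>idx d. \<Sum>y'\<in>idx d. (if ?P x y then L $$ (x ! j, y ! j) else 0) * \<kappa> y y'
          * cnj (if ?P x' y' then L $$ (x' ! j, y' ! j) else 0))"
      unfolding lift_local_kmat kmat_conj using x x' by simp
    also have "\<dots> = (\<Sum>y\<in>idx d. if ?P x y then (\<Sum>y'\<in>idx d. if ?P x' y' then
        L $$ (x ! j, y ! j) * \<kappa> y y' * cnj (L $$ (x' ! j, y' ! j)) else 0) else 0)"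
      by (intro sum.cong refl) (auto intro!: sum.cong)
    also have "\<dots> = (\<Sum>a<d ! j. \<Sum>a'<d ! j. L $$ (x ! j, x[j := a] ! j) * \<kappa> (x[j := a]) (x'[j := a']) * cnj (L $$ (x' ! j, x'[j := a'] ! j)))"
      by (simp only: sum_idx_fiber[OF j l dd x] sum_idx_fiber[OF j l dd x'])
    finally show ?thesis using lx j by simp
  qed
  moreover have "krs (prod_list d') (map (lift_local d d' j) Ls) (kmat d d \<kappa>) $$ (encode d' x, encode d' x')
    = sum_list (map (\<lambda>K. (K * kmat d d \<kappa> * adj K) $$ (encode d' x, encode d' x')) (map (lift_local d d' j) Ls))"
    unfolding krs_def by (subst index_mat) (use x x' in \<open>simp_all only: encode_less prod.case\<close>)
  ultimately show "krs (prod_list d') (map (lift_local d d' j) Ls) (kmat d d \<kappa>) $$ (encode d' x, encode d' x') =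
    kmat d' d' (\<lambda>x x'. sum_list (map (\<lambda>L. \<Sum>a<d ! j. \<Sum>a'<d ! j.
        L $$ (x ! j, a) * \<kappa> (x[j := a]) (x'[j := a']) * cnj (L $$ (x' ! j, a'))) Ls)) $$ (encode d' x, encode d' x')"
    by (simp only: kmat_encode[OF x x'] map_map comp_def)
qed simp_all

text \<open>Verbatim the outcome list of rule \<open>compose\<close>, so that the rule applies to it
  directly.\<close>

abbreviation locc_comp :: "complex mat list list \<Rightarrow> complex mat list list list \<Rightarrow> complex mat list list" where
  "locc_comp Fs Gss \<equiv> concat (map (\<lambda>(Fb, Gs). map (\<lambda>Gb. [G * F. F \<leftarrow> Fb, G \<leftarrow> Gb]) Gs) (zip Fs Gss))"

lemma sum_list_comp_aux:
  "sum_list (map f (concat (map (\<lambda>Gb. [G * F. F \<leftarrow> Fb, G \<leftarrow> Gb]) Gs)))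
    = (sum_list (map (\<lambda>F. sum_list (map (\<lambda>G. f (G * F)) (concat Gs))) Fb) :: complex)"
  by (induction Gs) (simp_all add: sum_list_addf sum_list_map_concat comp_def)

lemma sum_list_locc_comp:
  assumes "length Gss = length Fs"
  shows "sum_list (map f (concat (locc_comp Fs Gss)))
    = (\<Sum>i<length Fs. sum_list (map (\<lambda>F. sum_list (map (\<lambda>G. f (G * F)) (concat (Gss ! i)))) (Fs ! i)) :: complex)"
  using assms[symmetric]
proof (induction Fs Gss rule: list_induct2)
  case (Cons Fb Fs Gs Gss)
  thus ?case by (simp only: zip_Cons_Cons list.map prod.case concat.simps concat_append map_append
      sum_list_append sum_list_comp_aux length_Cons sum.lessThan_Suc_shift nth_Cons_0 nth_Cons_Suc)
qed simp

lemma set_locc_comp: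
  assumes "length Gss = length Fs" "K \<in> set (concat (locc_comp Fs Gss))"
  shows "\<exists>i<length Fs. \<exists>F\<in>set (Fs ! i). \<exists>G\<in>set (concat (Gss ! i)). K = G * F"
  using assms by (fastforce simp: set_zip)

lemma sum_list_nth_concat: "(\<Sum>i<length Fs. sum_list (map h (Fs ! i))) = (sum_list (map h (concat Fs)) :: complex)"
  by (induction Fs) (simp_all add: sum.lessThan_Suc_shift del: sum.lessThan_Suc)

text \<open>Completeness survives adaptive composition because every branch is followed by a
  complete instrument: summing over the second operators first leaves the completeness sum of the
  first instrument.\<close>

lemma locc_kraus: "locc_instr d d' Ks \<Longrightarrow> kraus (prod_list d) (prod_list d') (concat Ks)"
proof (induction rule: locc_instr.induct)
  case (local j din dout Lss)
  have "concat (map (map (lift_local din dout j)) Lss) = map (lift_local din dout j) (concat Lss)"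
    by (simp add: map_concat)
  thus ?case using lift_local_kraus[of j din dout "concat Lss"] local by simp
next
  case (compose d d' Fs Gss d'')
  let ?N = "prod_list d" and ?M = "prod_list d'" and ?L = "prod_list d''"
  have Fc: "F \<in> carrier_mat ?M ?N" if "i < length Fs" "F \<in> set (Fs ! i)" for i F
    using compose.IH that by (force simp: kraus_def)
  have Gk: "kraus ?M ?L (concat (Gss ! i))" if "i < length Fs" for i
    using compose.IH that by blast
  show ?case unfolding kraus_def
  proof (intro conjI allI impI ballI)
    fix K assume "K \<in> set (concat (locc_comp Fs Gss))"
    then obtain i F G where iFG: "i < length Fs" "F \<in> set (Fs ! i)" "G \<in> set (concat (Gss ! i))" "K = G * F"
      using set_locc_comp compose.hyps by blast
    have "G \<in> carrier_mat ?L ?M" using Gk[OF iFG(1)] iFG(3) unfolding kraus_def by blast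
    thus "K \<in> carrier_mat ?L ?N" using Fc[OF iFG(1,2)] iFG(4) by (metis mult_carrier_mat)
  next
    fix a b assume ab: "a < ?N" "b < ?N"
    have "sum_list (map (\<lambda>K. (adj K * K) $$ (a, b)) (concat (locc_comp Fs Gss)))
      = (\<Sum>i<length Fs. sum_list (map (\<lambda>F. sum_list (map (\<lambda>G. (adj (G * F) * (G * F)) $$ (a, b)) (concat (Gss ! i)))) (Fs ! i)))"
      by (rule sum_list_locc_comp) (use compose.hyps in auto)
    also have "\<dots> = (\<Sum>i<length Fs. sum_list (map (\<lambda>F. (adj F * F) $$ (a, b)) (Fs ! i)))"
    proof (intro sum.cong refl arg_cong[where f = sum_list] map_cong)
      fix i F assume i: "i \<in> {..<length Fs}" and F: "F \<in> set (Fs ! i)"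
      have Fc': "F \<in> carrier_mat ?M ?N" using Fc i F by simp
      have Gc: "\<forall>G\<in>set (concat (Gss ! i)). G \<in> carrier_mat ?L ?M" using Gk i by (simp add: kraus_def)
      have "sum_list (map (\<lambda>G. (adj (G * F) * (G * F)) $$ (a, b)) (concat (Gss ! i)))
        = sum_list (map (\<lambda>G. \<Sum>p<?M. \<Sum>q<?M. cnj (F $$ (p, a)) * (adj G * G) $$ (p, q) * F $$ (q, b)) (concat (Gss ! i)))"
      proof (intro arg_cong[where f = sum_list] map_cong refl)
        fix G assume "G \<in> set (concat (Gss ! i))"
        hence G: "G \<in> carrier_mat ?L ?M" using Gc by blast
        have e: "adj (G * F) * (G * F) = adj F * (adj G * G) * adj (adj F)" using G Fc' by (simp add: mat_assoc)
        have "adj G * G \<in> carrier_mat ?M ?M" using G by (intro carrier_matI) auto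
        from index_conj[OF adj_carrier[OF Fc'] this ab]
        show "(adj (G * F) * (G * F)) $$ (a, b) = (\<Sum>p<?M. \<Sum>q<?M. cnj (F $$ (p, a)) * (adj G * G) $$ (p, q) * F $$ (q, b))"
          unfolding e using Fc' ab by (simp del: index_mult_mat(1) adj_adj)
      qed
      also have "\<dots> = (\<Sum>p<?M. \<Sum>q<?M. cnj (F $$ (p, a)) * (if p = q then 1 else 0) * F $$ (q, b))"
        unfolding sum_list_sum sum_list_mult_left sum_list_mult_right
        using Gk i by (auto simp: kraus_def intro!: sum.cong)
      also have "\<dots> = (adj F * F) $$ (a, b)"
        using Fc' ab by (simp add: index_mult_sum if_distrib[of "\<lambda>c. _ * c"] if_distrib[of "\<lambda>c. c * _"] cong: if_cong del: index_mult_mat(1))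
      finally show "sum_list (map (\<lambda>G. (adj (G * F) * (G * F)) $$ (a, b)) (concat (Gss ! i))) = (adj F * F) $$ (a, b)" .
    qed
    also have "\<dots> = sum_list (map (\<lambda>F. (adj F * F) $$ (a, b)) (concat Fs))"
      by (rule sum_list_nth_concat)
    also have "\<dots> = (if a = b then 1 else 0)" using compose.IH(1) ab by (simp add: kraus_def)
    finally show "sum_list (map (\<lambda>K. (adj K * K) $$ (a, b)) (concat (locc_comp Fs Gss))) = (if a = b then 1 else 0)" .
  qed
qed

lemma apply_locc_comp:
  assumes F: "locc_instr d d' Fs" and len: "length Gss = length Fs"
    and G: "\<forall>i<length Fs. locc_instr d' d'' (Gss ! i)" and A: "A \<in> carrier_mat (prod_list d) (prod_list d)"
    and ab: "a < prod_list d''" "b < prod_list d''"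
  shows "apply_instr d'' (locc_comp Fs Gss) A $$ (a, b)
    = (\<Sum>i<length Fs. apply_instr d'' (Gss ! i) (krs (prod_list d') (Fs ! i) A) $$ (a, b))"
proof -
  have "apply_instr d'' (locc_comp Fs Gss) A $$ (a, b)
    = (\<Sum>i<length Fs. sum_list (map (\<lambda>F. sum_list (map (\<lambda>G. (G * F * A * adj (G * F)) $$ (a, b)) (concat (Gss ! i)))) (Fs ! i)))"
    unfolding apply_instr_def using ab sum_list_locc_comp[OF len, of "\<lambda>K. (K * A * adj K) $$ (a, b)"]
    by (simp del: index_mult_mat(1))
  also have "\<dots> = (\<Sum>i<length Fs. apply_instr d'' (Gss ! i) (krs (prod_list d') (Fs ! i) A) $$ (a, b))"
    unfolding apply_instr_krs
  proof (rule sum.cong[OF refl])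
    fix i assume i: "i \<in> {..<length Fs}"
    have "\<forall>F\<in>set (Fs ! i). F \<in> carrier_mat (prod_list d') (prod_list d)"
      using locc_kraus[OF F] i by (force simp: kraus_def)
    moreover have "\<forall>G\<in>set (concat (Gss ! i)). G \<in> carrier_mat (prod_list d'') (prod_list d')"
      using locc_kraus[of d' d'' "Gss ! i"] G i unfolding kraus_def by blast
    ultimately show "sum_list (map (\<lambda>F. sum_list (map (\<lambda>G. (G * F * A * adj (G * F)) $$ (a, b)) (concat (Gss ! i)))) (Fs ! i))
      = krs (prod_list d'') (concat (Gss ! i)) (krs (prod_list d') (Fs ! i) A) $$ (a, b)"
      by (rule krs_compose[OF _ _ A ab, symmetric])
  qed
  finally show ?thesis .
qed

lemma apply_instr_carrier [simp]: "apply_instr d' Ks A \<in> carrier_mat (prod_list d') (prod_list d')"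
  by (simp add: apply_instr_krs)

lemma locc_compose:
  assumes F: "locc_instr d d' Fs" and G: "locc_instr d' d'' Gs"
  shows "\<exists>Ms. locc_instr d d'' Ms \<and> (\<forall>A\<in>carrier_mat (prod_list d) (prod_list d).
    apply_instr d'' Ms A = apply_instr d'' Gs (apply_instr d' Fs A))"
proof (intro exI conjI ballI)
  \<comment> \<open>The second protocol ignores the outcome of the first.\<close>
  let ?Gss = "replicate (length Fs) Gs"
  show "locc_instr d d'' (locc_comp Fs ?Gss)" by (rule locc_instr.compose[OF F]) (use G in auto)
  fix A :: "complex mat" assume A: "A \<in> carrier_mat (prod_list d) (prod_list d)"
  have Fc: "\<forall>F\<in>set (concat Fs). F \<in> carrier_mat (prod_list d') (prod_list d)"
    and Gc: "\<forall>F\<in>set (concat Gs). F \<in> carrier_mat (prod_list d'') (prod_list d')"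
    using locc_kraus[OF F] locc_kraus[OF G] by (simp_all add: kraus_def)
  show "apply_instr d'' (locc_comp Fs ?Gss) A = apply_instr d'' Gs (apply_instr d' Fs A)"
  proof (rule eq_matI)
    fix a b assume "a < dim_row (apply_instr d'' Gs (apply_instr d' Fs A))" "b < dim_col (apply_instr d'' Gs (apply_instr d' Fs A))"
    hence ab: "a < prod_list d''" "b < prod_list d''" by (simp_all add: apply_instr_krs)
    have "apply_instr d'' (locc_comp Fs ?Gss) A $$ (a, b)
      = (\<Sum>i<length Fs. sum_list (map (\<lambda>F. sum_list (map (\<lambda>G. (G * F * A * adj (G * F)) $$ (a, b)) (concat (?Gss ! i)))) (Fs ! i)))"
      unfolding apply_instr_def using ab sum_list_locc_comp[of ?Gss Fs "\<lambda>K. (K * A * adj K) $$ (a, b)"]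
      by (simp del: index_mult_mat(1))
    also have "\<dots> = (\<Sum>i<length Fs. sum_list (map (\<lambda>F. sum_list (map (\<lambda>G. (G * F * A * adj (G * F)) $$ (a, b)) (concat Gs))) (Fs ! i)))"
      by (intro sum.cong refl) simp
    also have "\<dots> = sum_list (map (\<lambda>F. sum_list (map (\<lambda>G. (G * F * A * adj (G * F)) $$ (a, b)) (concat Gs))) (concat Fs))"
      by (rule sum_list_nth_concat)
    also have "\<dots> = apply_instr d'' Gs (apply_instr d' Fs A) $$ (a, b)"
      unfolding apply_instr_krs by (rule krs_compose[OF Fc Gc A ab, symmetric])
    finally show "apply_instr d'' (locc_comp Fs ?Gss) A $$ (a, b) = apply_instr d'' Gs (apply_instr d' Fs A) $$ (a, b)" .
  qed (simp_all add: apply_instr_krs)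
qed

subsection \<open>Exact conversions\<close>

text \<open>Stated for matrices rather than states, since branches of a measurement are processed
  while still unnormalized.\<close>

definition exact :: "nat list \<Rightarrow> complex mat \<Rightarrow> nat list \<Rightarrow> complex mat \<Rightarrow> bool" where
  "exact d A d' B \<longleftrightarrow> (\<exists>Ks. locc_instr d d' Ks \<and> apply_instr d' Ks A = B)"

lemma exact_trans:
  assumes "exact d A d' B" "exact d' B d'' C" "A \<in> carrier_mat (prod_list d) (prod_list d)"
  shows "exact d A d'' C"
  using assms locc_compose unfolding exact_def by metis

text \<open>The probabilities sit inside the unnormalized branches, so the outputs of the separate
  continuations simply add up.\<close>

lemma exact_branch:
  assumes F: "locc_instr d d' Fs" and A: "A \<in> carrier_mat (prod_list d) (prod_list d)"
    and B: "\<And>i. i < length Fs \<Longrightarrow> exact d' (krs (prod_list d') (Fs ! i) A) d'' (B i)"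
  shows "exact d A d'' (mat (prod_list d'') (prod_list d'') (\<lambda>(a, b). \<Sum>i<length Fs. B i $$ (a, b)))"
proof -
  obtain g where g: "\<And>i. i < length Fs \<Longrightarrow> locc_instr d' d'' (g i) \<and> apply_instr d'' (g i) (krs (prod_list d') (Fs ! i) A) = B i"
    using B unfolding exact_def by metis
  let ?Gss = "map g [0..<length Fs]"
  have "locc_instr d d'' (locc_comp Fs ?Gss)" by (rule locc_instr.compose[OF F]) (use g in auto)
  moreover have "apply_instr d'' (locc_comp Fs ?Gss) A = mat (prod_list d'') (prod_list d'') (\<lambda>(a, b). \<Sum>i<length Fs. B i $$ (a, b))"
  proof (rule eq_matI)
    fix a b assume "a < dim_row (mat (prod_list d'') (prod_list d'') (\<lambda>(a, b). \<Sum>i<length Fs. B i $$ (a, b)))"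
      "b < dim_col (mat (prod_list d'') (prod_list d'') (\<lambda>(a, b). \<Sum>i<length Fs. B i $$ (a, b)))"
    hence ab: "a < prod_list d''" "b < prod_list d''" by simp_all
    have "apply_instr d'' (locc_comp Fs ?Gss) A $$ (a, b)
      = (\<Sum>i<length Fs. apply_instr d'' (?Gss ! i) (krs (prod_list d') (Fs ! i) A) $$ (a, b))"
      by (rule apply_locc_comp[OF F _ _ A ab]) (use g in auto)
    thus "apply_instr d'' (locc_comp Fs ?Gss) A $$ (a, b) = mat (prod_list d'') (prod_list d'') (\<lambda>(a, b). \<Sum>i<length Fs. B i $$ (a, b)) $$ (a, b)"
      using ab g by simp
  qed (simp_all add: apply_instr_krs)
  ultimately show ?thesis unfolding exact_def by blast
qed

lemma exact_local:
  assumes j: "j < length d" and l: "length d' = length d" and dd: "\<forall>t<length d. t \<noteq> j \<longrightarrow> d' ! t = d ! t"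
    and L: "\<forall>L\<in>set Ls. L \<in> carrier_mat (d' ! j) (d ! j)"
    and s: "\<forall>a<d ! j. \<forall>b<d ! j. sum_list (map (\<lambda>L. (adj L * L) $$ (a, b)) Ls) = (if a = b then 1 else 0)"
  shows "exact d (kmat d d \<kappa>) d' (kmat d' d' (\<lambda>x x'. sum_list (map (\<lambda>L. \<Sum>a<d ! j. \<Sum>a'<d ! j.
        L $$ (x ! j, a) * \<kappa> (x[j := a]) (x'[j := a']) * cnj (L $$ (x' ! j, a'))) Ls)))"
proof -
  have "locc_instr d d' (map (map (lift_local d d' j)) [Ls])"
    by (rule locc_instr.local) (use assms in auto)
  moreover have "apply_instr d' (map (map (lift_local d d' j)) [Ls]) (kmat d d \<kappa>) = krs (prod_list d') (map (lift_local d d' j) Ls) (kmat d d \<kappa>)"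
    by (simp add: apply_instr_krs)
  ultimately show ?thesis unfolding exact_def krs_lift_local[OF j l dd] by metis
qed

text \<open>A local monomial unitary \<open>|\<tau> a\<rangle> \<mapsto> c a |a\<rangle>\<close>.\<close>

lemma exact_monomial_party:
  assumes j: "j < length d" and \<tau>: "bij_betw \<tau> {..<d ! j} {..<d ! j}" and c: "\<And>a. a < d ! j \<Longrightarrow> cmod (c a) = 1"
  shows "exact d (kmat d d \<kappa>) d (kmat d d (\<lambda>x y. c (x ! j) * cnj (c (y ! j)) * \<kappa> (x[j := \<tau> (x ! j)]) (y[j := \<tau> (y ! j)])))"
proof -
  let ?n = "d ! j"
  define L where "L = mat ?n ?n (\<lambda>(a, b). if b = \<tau> a then c a else 0)"
  have \<tau>n: "\<tau> a < ?n" if "a < ?n" for a using bij_betwE[OF \<tau>] that by auto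
  have iso: "(adj L * L) $$ (a, b) = (if a = b then 1 else 0)" if ab: "a < ?n" "b < ?n" for a b
  proof -
    obtain a' where a': "a' < ?n" "a = \<tau> a'" using \<tau> ab(1) by (metis bij_betw_def imageE lessThan_iff)
    have inj: "\<tau> i = \<tau> a' \<longleftrightarrow> i = a'" if "i < ?n" for i
      using \<tau> a'(1) that by (auto simp: bij_betw_def inj_on_def)
    have "(adj L * L) $$ (a, b) = (\<Sum>i<?n. cnj (L $$ (i, a)) * L $$ (i, b))"
      using ab by (simp add: L_def index_mult_sum del: index_mult_mat(1))
    also have "\<dots> = (\<Sum>i<?n. if i = a' then (if a = b then 1 else 0) else 0)"
    proof (rule sum.cong)
      fix i assume "i \<in> {..<?n}"
      hence i: "i < ?n" by simp
      show "cnj (L $$ (i, a)) * L $$ (i, b) = (if i = a' then (if a = b then 1 else 0) else 0)"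
        using i ab inj[OF i] a' c[OF i] by (auto simp: L_def complex_norm_square[symmetric] mult.commute[of "cnj _"])
    qed simp
    also have "\<dots> = (if a = b then 1 else 0)" using a'(1) by simp
    finally show ?thesis .
  qed
  have "exact d (kmat d d \<kappa>) d (kmat d d (\<lambda>x x'. sum_list (map (\<lambda>L. \<Sum>a<d ! j. \<Sum>a'<d ! j.
        L $$ (x ! j, a) * \<kappa> (x[j := a]) (x'[j := a']) * cnj (L $$ (x' ! j, a'))) [L])))"
  proof (rule exact_local[OF j refl])
    show "\<forall>L\<in>set [L]. L \<in> carrier_mat ?n ?n" by (simp add: L_def)
    show "\<forall>a<?n. \<forall>b<?n. sum_list (map (\<lambda>L. (adj L * L) $$ (a, b)) [L]) = (if a = b then 1 else 0)"
      using iso by (simp del: index_mult_mat(1))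
  qed simp
  moreover have "kmat d d (\<lambda>x x'. sum_list (map (\<lambda>L. \<Sum>a<d ! j. \<Sum>a'<d ! j.
        L $$ (x ! j, a) * \<kappa> (x[j := a]) (x'[j := a']) * cnj (L $$ (x' ! j, a'))) [L]))
    = kmat d d (\<lambda>x y. c (x ! j) * cnj (c (y ! j)) * \<kappa> (x[j := \<tau> (x ! j)]) (y[j := \<tau> (y ! j)]))"
  proof (rule kmat_cong)
    fix x y assume "x \<in> idx d" "y \<in> idx d"
    hence xy: "x ! j < ?n" "y ! j < ?n" using j by (auto simp: idx_iff)
    have "(\<Sum>a<?n. \<Sum>a'<?n. L $$ (x ! j, a) * \<kappa> (x[j := a]) (y[j := a']) * cnj (L $$ (y ! j, a')))
      = (\<Sum>a<?n. \<Sum>a'<?n. if a' = \<tau> (y ! j) then (if a = \<tau> (x ! j) then c (x ! j) * \<kappa> (x[j := a]) (y[j := a']) * cnj (c (y ! j)) else 0) else 0)"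
      using xy by (intro sum.cong refl) (auto simp: L_def)
    also have "\<dots> = c (x ! j) * cnj (c (y ! j)) * \<kappa> (x[j := \<tau> (x ! j)]) (y[j := \<tau> (y ! j)])"
      using \<tau>n[OF xy(1)] \<tau>n[OF xy(2)] by simp
    finally show "sum_list (map (\<lambda>L. \<Sum>a<d ! j. \<Sum>a'<d ! j.
        L $$ (x ! j, a) * \<kappa> (x[j := a]) (y[j := a']) * cnj (L $$ (y ! j, a'))) [L]) =
        c (x ! j) * cnj (c (y ! j)) * \<kappa> (x[j := \<tau> (x ! j)]) (y[j := \<tau> (y ! j)])" by simp
  qed
  ultimately show ?thesis by simp
qed

lemma exact_refl:
  assumes "d \<noteq> []" "A \<in> carrier_mat (prod_list d) (prod_list d)"
  shows "exact d A d A"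
proof -
  define \<kappa> where "\<kappa> = (\<lambda>x y. A $$ (encode d x, encode d y))"
  have A: "A = kmat d d \<kappa>" unfolding \<kappa>_def using kmat_ker[OF assms(2)] by simp
  have "exact d (kmat d d \<kappa>) d (kmat d d (\<lambda>x y. 1 * cnj 1 * \<kappa> (x[0 := id (x ! 0)]) (y[0 := id (y ! 0)])))"
    by (rule exact_monomial_party[where \<tau> = id and c = "\<lambda>_. 1"]) (use assms in simp_all)
  thus ?thesis unfolding A by simp
qed

lemma exact_monomial:
  assumes d: "d \<noteq> []" and \<tau>: "\<And>t. t < length d \<Longrightarrow> bij_betw (\<tau> t) {..<d ! t} {..<d ! t}"
    and c: "\<And>t a. t < length d \<Longrightarrow> a < d ! t \<Longrightarrow> cmod (c t a) = 1"
  defines "C \<equiv> \<lambda>x. \<Prod>t<length d. c t (x ! t)" and "T \<equiv> \<lambda>x. map (\<lambda>t. \<tau> t (x ! t)) [0..<length d]"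
  shows "exact d (kmat d d \<kappa>) d (kmat d d (\<lambda>x y. C x * cnj (C y) * \<kappa> (T x) (T y)))"
proof -
  \<comment> \<open>Phases and permutations after the first \<open>m\<close> parties have acted, for
    an induction on \<open>m\<close>.\<close>
  define Cm where "Cm = (\<lambda>m x. \<Prod>t<m. c t (x ! t))"
  define Tm where "Tm = (\<lambda>m x. map (\<lambda>t. if t < m then \<tau> t (x ! t) else x ! t) [0..<length d])"
  have "exact d (kmat d d \<kappa>) d (kmat d d (\<lambda>x y. Cm m x * cnj (Cm m y) * \<kappa> (Tm m x) (Tm m y)))" if "m \<le> length d" for m
    using that
  proof (induction m)
    case 0
    have "kmat d d (\<lambda>x y. Cm 0 x * cnj (Cm 0 y) * \<kappa> (Tm 0 x) (Tm 0 y)) = kmat d d \<kappa>"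
    proof (rule kmat_cong)
      fix x y assume "x \<in> idx d" "y \<in> idx d"
      hence "Tm 0 x = x" "Tm 0 y = y" by (auto simp: Tm_def idx_iff intro!: nth_equalityI)
      thus "Cm 0 x * cnj (Cm 0 y) * \<kappa> (Tm 0 x) (Tm 0 y) = \<kappa> x y" by (simp add: Cm_def)
    qed
    thus ?case using exact_refl[OF d kmat_carrier] by simp
  next
    case (Suc m)
    have m: "m < length d" using Suc.prems by simp
    let ?\<kappa> = "\<lambda>x y. Cm m x * cnj (Cm m y) * \<kappa> (Tm m x) (Tm m y)"
    have e1: "exact d (kmat d d ?\<kappa>) d (kmat d d (\<lambda>x y. c m (x ! m) * cnj (c m (y ! m)) * ?\<kappa> (x[m := \<tau> m (x ! m)]) (y[m := \<tau> m (y ! m)])))"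
      by (rule exact_monomial_party[OF m \<tau>[OF m] c[OF m]])
    have e2: "kmat d d (\<lambda>x y. c m (x ! m) * cnj (c m (y ! m)) * ?\<kappa> (x[m := \<tau> m (x ! m)]) (y[m := \<tau> m (y ! m)]))
      = kmat d d (\<lambda>x y. Cm (Suc m) x * cnj (Cm (Suc m) y) * \<kappa> (Tm (Suc m) x) (Tm (Suc m) y))"
    proof (rule kmat_cong)
      fix x y assume x: "x \<in> idx d" and y: "y \<in> idx d"
      have "Cm (Suc m) z = c m (z ! m) * Cm m (z[m := \<tau> m (z ! m)])" "Tm (Suc m) z = Tm m (z[m := \<tau> m (z ! m)])"
        if "z \<in> idx d" for z
      proof -
        show "Cm (Suc m) z = c m (z ! m) * Cm m (z[m := \<tau> m (z ! m)])" by (simp add: Cm_def)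
        show "Tm (Suc m) z = Tm m (z[m := \<tau> m (z ! m)])"
          using m idx_length[OF that] by (auto simp: Tm_def nth_list_update less_Suc_eq)
      qed
      thus "c m (x ! m) * cnj (c m (y ! m)) * ?\<kappa> (x[m := \<tau> m (x ! m)]) (y[m := \<tau> m (y ! m)])
        = Cm (Suc m) x * cnj (Cm (Suc m) y) * \<kappa> (Tm (Suc m) x) (Tm (Suc m) y)"
        using x y by simp
    qed
    show ?case using exact_trans[OF Suc.IH[OF less_imp_le[OF m]] e1 kmat_carrier] unfolding e2 .
  qed
  from this[of "length d"] have "exact d (kmat d d \<kappa>) d (kmat d d (\<lambda>x y. Cm (length d) x * cnj (Cm (length d) y) * \<kappa> (Tm (length d) x) (Tm (length d) y)))"
    by simp
  moreover have "Cm (length d) = C" by (simp add: Cm_def C_def)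
  moreover have "Tm (length d) = T" by (auto simp: Tm_def T_def fun_eq_iff)
  ultimately show ?thesis by simp
qed

subsection \<open>Tensor products\<close>

abbreviation pmul :: "nat list \<Rightarrow> nat list \<Rightarrow> nat list" where "pmul \<equiv> map2 (*)"
abbreviation pdiv :: "nat list \<Rightarrow> nat list \<Rightarrow> nat list" where "pdiv \<equiv> map2 (div)"
abbreviation pmod :: "nat list \<Rightarrow> nat list \<Rightarrow> nat list" where "pmod \<equiv> map2 (mod)"

lemma idx_pmul_iff:
  "length d = length e \<Longrightarrow> x \<in> idx (pmul d e) \<longleftrightarrow> length x = length e \<and> (\<forall>t<length e. x ! t < d ! t * e ! t)"
  by (auto simp: idx_iff)

lemma idx_pdiv: "length d = length e \<Longrightarrow> x \<in> idx (pmul d e) \<Longrightarrow> pdiv x e \<in> idx d"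
  by (auto simp: idx_pmul_iff idx_iff less_mult_imp_div_less)

lemma idx_pmod: "length d = length e \<Longrightarrow> x \<in> idx (pmul d e) \<Longrightarrow> pmod x e \<in> idx e"
  by (auto simp: idx_pmul_iff idx_iff) (metis less_nat_zero_code mod_less_divisor mult_0_right neq0_conv)

lemma mixed_less: "(u :: nat) < d \<Longrightarrow> w < e \<Longrightarrow> u * e + w < d * e"
proof -
  assume "u < d" "w < e"
  hence "u * e + w < Suc u * e" "Suc u * e \<le> d * e" by (simp, intro mult_right_mono) auto
  thus ?thesis by linarith
qed

lemma mixed_div_mod: "w < e \<Longrightarrow> (u * e + w) div e = (u :: nat)" "w < e \<Longrightarrow> (u * e + w) mod e = w"
  by (simp_all add: div_mult_self3)

lemma sum_idx_pmul:
  assumes l: "length d = length e"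
  shows "(\<Sum>x\<in>idx (pmul d e). f (pdiv x e) (pmod x e)) = (\<Sum>u\<in>idx d. \<Sum>w\<in>idx e. f u w :: complex)"
proof -
  let ?g = "\<lambda>(u, w). map (\<lambda>t. u ! t * e ! t + w ! t) [0..<length e]"
  have "bij_betw (\<lambda>x. (pdiv x e, pmod x e)) (idx (pmul d e)) (idx d \<times> idx e)"
  proof (rule bij_betw_byWitness[where f' = ?g])
    show "\<forall>x\<in>idx (pmul d e). ?g (pdiv x e, pmod x e) = x"
      using l by (auto simp: idx_pmul_iff div_mult_mod_eq simp del: mod_mult_self4 intro!: nth_equalityI)
    show "\<forall>p\<in>idx d \<times> idx e. (\<lambda>x. (pdiv x e, pmod x e)) (?g p) = p"
      using l by (auto simp: idx_iff mixed_div_mod intro!: nth_equalityI)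
    show "(\<lambda>x. (pdiv x e, pmod x e)) ` idx (pmul d e) \<subseteq> idx d \<times> idx e"
      using idx_pdiv[OF l] idx_pmod[OF l] by auto
    show "?g ` (idx d \<times> idx e) \<subseteq> idx (pmul d e)"
      using l by (auto simp: idx_pmul_iff idx_iff mixed_less)
  qed
  from sum.reindex_bij_betw[OF this, of "\<lambda>(u, w). f u w"]
  show ?thesis by (simp add: sum.cartesian_product)
qed

definition tens :: "nat list \<Rightarrow> nat list \<Rightarrow> complex mat \<Rightarrow> complex mat \<Rightarrow> complex mat" where
  "tens d e A B = kmat (pmul d e) (pmul d e) (\<lambda>x y.
     A $$ (encode d (pdiv x e), encode d (pdiv y e)) * B $$ (encode e (pmod x e), encode e (pmod y e)))"

lemma tens_carrier [simp]: "tens d e A B \<in> carrier_mat (prod_list (pmul d e)) (prod_list (pmul d e))"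
  by (simp add: tens_def)

lemma tens_encode [simp]:
  "x \<in> idx (pmul d e) \<Longrightarrow> y \<in> idx (pmul d e) \<Longrightarrow> tens d e A B $$ (encode (pmul d e) x, encode (pmul d e) y)
    = A $$ (encode d (pdiv x e), encode d (pdiv y e)) * B $$ (encode e (pmod x e), encode e (pmod y e))"
  by (simp add: tens_def)

lemma tensor_st_eq: "tensor_st (d, A) (e, B) = (pmul d e, tens d e A B)"
  by (simp add: tensor_st_def tens_def kmat_def Let_def)

section \<open>Idle subsystems: Kraus operators tensored with the identity\<close>

definition ext :: "nat list \<Rightarrow> nat list \<Rightarrow> nat list \<Rightarrow> complex mat \<Rightarrow> complex mat" where
  "ext d' d e K = kmat (pmul d' e) (pmul d e) (\<lambda>x y.
     if pmod x e = pmod y e then K $$ (encode d' (pdiv x e), encode d (pdiv y e)) else 0)"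

lemma ext_mult:
  assumes l: "length d' = length e" "length d = length e" "length d'' = length e"
    and G: "G \<in> carrier_mat (prod_list d'') (prod_list d')" and F: "F \<in> carrier_mat (prod_list d') (prod_list d)"
  shows "ext d'' d e (G * F) = ext d'' d' e G * ext d' d e F"
  unfolding ext_def kmat_mult
proof (rule kmat_cong)
  fix x z assume x: "x \<in> idx (pmul d'' e)" and z: "z \<in> idx (pmul d e)"
  have xm: "pmod x e \<in> idx e" and xd: "pdiv x e \<in> idx d''" and zd: "pdiv z e \<in> idx d"
    using idx_pmod[OF l(3) x] idx_pdiv[OF l(3) x] idx_pdiv[OF l(2) z] .
  let ?g = "\<lambda>u. G $$ (encode d'' (pdiv x e), encode d' u) * F $$ (encode d' u, encode d (pdiv z e))"
  have "(\<Sum>y\<in>idx (pmul d' e). (if pmod x e = pmod y e then G $$ (encode d'' (pdiv x e), encode d' (pdiv y e)) else 0) *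
      (if pmod y e = pmod z e then F $$ (encode d' (pdiv y e), encode d (pdiv z e)) else 0))
    = (\<Sum>u\<in>idx d'. \<Sum>w\<in>idx e. (if pmod x e = w then G $$ (encode d'' (pdiv x e), encode d' u) else 0) *
      (if w = pmod z e then F $$ (encode d' u, encode d (pdiv z e)) else 0))"
    by (rule sum_idx_pmul[OF l(1)])
  also have "\<dots> = (\<Sum>u\<in>idx d'. \<Sum>w\<in>idx e. if w = pmod x e then (if pmod x e = pmod z e then ?g u else 0) else 0)"
    by (intro sum.cong refl) auto
  also have "\<dots> = (\<Sum>u\<in>idx d'. if pmod x e = pmod z e then ?g u else 0)"
    using xm by (intro sum.cong refl) (simp add: sum.delta)
  also have "\<dots> = (if pmod x e = pmod z e then (G * F) $$ (encode d'' (pdiv x e), encode d (pdiv z e)) else 0)"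
    unfolding index_mult_encode[OF G F xd zd] by simp
  finally show "(if pmod x e = pmod z e then (G * F) $$ (encode d'' (pdiv x e), encode d (pdiv z e)) else 0) =
    (\<Sum>y\<in>idx (pmul d' e). (if pmod x e = pmod y e then G $$ (encode d'' (pdiv x e), encode d' (pdiv y e)) else 0) *
      (if pmod y e = pmod z e then F $$ (encode d' (pdiv y e), encode d (pdiv z e)) else 0))" by simp
qed

lemma index_conj_encode:
  assumes "K \<in> carrier_mat (prod_list d') (prod_list d)" "A \<in> carrier_mat (prod_list d) (prod_list d)"
    "x \<in> idx d'" "x' \<in> idx d'"
  shows "(K * A * adj K) $$ (encode d' x, encode d' x') = (\<Sum>y\<in>idx d. \<Sum>y'\<in>idx d.
    K $$ (encode d' x, encode d y) * A $$ (encode d y, encode d y') * cnj (K $$ (encode d' x', encode d y')))"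
  using index_conj[OF assms(1,2) encode_less[OF assms(3)] encode_less[OF assms(4)]]
  unfolding sum_idx .

lemma ext_conj:
  assumes l: "length d' = length e" "length d = length e"
    and K: "K \<in> carrier_mat (prod_list d') (prod_list d)" and A: "A \<in> carrier_mat (prod_list d) (prod_list d)"
  shows "ext d' d e K * tens d e A B * adj (ext d' d e K) = tens d' e (K * A * adj K) B"
  unfolding ext_def tens_def kmat_conj
proof (rule kmat_cong)
  fix x x' assume x: "x \<in> idx (pmul d' e)" and x': "x' \<in> idx (pmul d' e)"
  note m = idx_pmod[OF l(1) x] idx_pmod[OF l(1) x'] and dv = idx_pdiv[OF l(1) x] idx_pdiv[OF l(1) x']
  let ?k = "\<lambda>z u. K $$ (encode d' (pdiv z e), encode d u)"
  let ?a = "\<lambda>u u'. A $$ (encode d u, encode d u')"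
  let ?b = "\<lambda>w w'. B $$ (encode e w, encode e w')"
  have "(\<Sum>y\<in>idx (pmul d e). \<Sum>y'\<in>idx (pmul d e). (if pmod x e = pmod y e then ?k x (pdiv y e) else 0) *
      (?a (pdiv y e) (pdiv y' e) * ?b (pmod y e) (pmod y' e)) * cnj (if pmod x' e = pmod y' e then ?k x' (pdiv y' e) else 0))
    = (\<Sum>y\<in>idx (pmul d e). \<Sum>u'\<in>idx d. \<Sum>w'\<in>idx e. (if pmod x e = pmod y e then ?k x (pdiv y e) else 0) *
      (?a (pdiv y e) u' * ?b (pmod y e) w') * cnj (if pmod x' e = w' then ?k x' u' else 0))"
    by (intro sum.cong refl sum_idx_pmul[OF l(2)])
  also have "\<dots> = (\<Sum>u\<in>idx d. \<Sum>w\<in>idx e. \<Sum>u'\<in>idx d. \<Sum>w'\<in>idx e. (if pmod x e = w then ?k x u else 0) *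
      (?a u u' * ?b w w') * cnj (if pmod x' e = w' then ?k x' u' else 0))"
    by (rule sum_idx_pmul[OF l(2)])
  also have "\<dots> = (\<Sum>u\<in>idx d. \<Sum>w\<in>idx e. if w = pmod x e then (\<Sum>u'\<in>idx d. \<Sum>w'\<in>idx e. if w' = pmod x' e then
      ?k x u * (?a u u' * ?b (pmod x e) (pmod x' e)) * cnj (?k x' u') else 0) else 0)"
  proof (intro sum.cong refl, goal_cases)
    case (1 u w)
    show ?case
    proof (cases "w = pmod x e")
      case True
      show ?thesis by (simp only: True simp_thms if_True) (intro sum.cong refl, auto)
    qed auto
  qed
  also have "\<dots> = (\<Sum>u\<in>idx d. \<Sum>u'\<in>idx d. ?k x u * (?a u u' * ?b (pmod x e) (pmod x' e)) * cnj (?k x' u'))"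
    using m by (simp add: sum.delta)
  also have "\<dots> = (K * A * adj K) $$ (encode d' (pdiv x e), encode d' (pdiv x' e)) * ?b (pmod x e) (pmod x' e)"
    unfolding index_conj_encode[OF K A dv] by (simp add: sum_distrib_left sum_distrib_right ac_simps)
  finally show "(\<Sum>y\<in>idx (pmul d e). \<Sum>y'\<in>idx (pmul d e). (if pmod x e = pmod y e then ?k x (pdiv y e) else 0) *
      (?a (pdiv y e) (pdiv y' e) * ?b (pmod y e) (pmod y' e)) * cnj (if pmod x' e = pmod y' e then ?k x' (pdiv y' e) else 0))
    = (K * A * adj K) $$ (encode d' (pdiv x e), encode d' (pdiv x' e)) * ?b (pmod x e) (pmod x' e)" .
qed

lemma krs_ext:
  assumes l: "length d' = length e" "length d = length e"
    and K: "\<forall>K\<in>set Ks. K \<in> carrier_mat (prod_list d') (prod_list d)" and A: "A \<in> carrier_mat (prod_list d) (prod_list d)"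
  shows "krs (prod_list (pmul d' e)) (map (ext d' d e) Ks) (tens d e A B) = tens d' e (krs (prod_list d') Ks A) B"
proof (rule kmat_eqI)
  fix x y assume x: "x \<in> idx (pmul d' e)" and y: "y \<in> idx (pmul d' e)"
  note dv = encode_less[OF idx_pdiv[OF l(1) x]] encode_less[OF idx_pdiv[OF l(1) y]]
  let ?i = "(encode (pmul d' e) x, encode (pmul d' e) y)"
  have "krs (prod_list (pmul d' e)) (map (ext d' d e) Ks) (tens d e A B) $$ ?i
    = sum_list (map (\<lambda>K. (ext d' d e K * tens d e A B * adj (ext d' d e K)) $$ ?i) Ks)"
    unfolding krs_def by (subst index_mat) (use x y in \<open>simp_all only: encode_less prod.case map_map comp_def\<close>)
  also have "\<dots> = sum_list (map (\<lambda>K. (K * A * adj K) $$ (encode d' (pdiv x e), encode d' (pdiv y e)) * B $$ (encode e (pmod x e), encode e (pmod y e))) Ks)"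
    using x y K
    by (intro arg_cong[where f = sum_list] map_cong refl) (simp add: ext_conj[OF l _ A] del: index_mult_mat(1))
  also have "\<dots> = tens d' e (krs (prod_list d') Ks A) B $$ ?i"
    unfolding sum_list_mult_right tens_encode[OF x y] krs_def using dv by (simp del: index_mult_mat(1))
  finally show "krs (prod_list (pmul d' e)) (map (ext d' d e) Ks) (tens d e A B) $$ ?i = tens d' e (krs (prod_list d') Ks A) B $$ ?i" .
qed simp_all

text \<open>\<open>L\<close> tensored with the identity of dimension \<open>m\<close>, in the
  encoding \<open>a * m + b\<close> that \<open>tensor_st\<close> uses for the index of one
  party.\<close>

definition ext1 :: "nat \<Rightarrow> complex mat \<Rightarrow> complex mat" where
  "ext1 m L = mat (dim_row L * m) (dim_col L * m) (\<lambda>(a, b). if a mod m = b mod m then L $$ (a div m, b div m) else 0)"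

text \<open>The reason why LOCC tolerates idle subsystems: agreement of all digits away from
  \<open>j\<close> together with agreement of all idle parts is the same as agreement of the
  combined indices away from \<open>j\<close> and of the idle part at \<open>j\<close>.\<close>

lemma ext_lift_local:
  assumes j: "j < length d" and l: "length d' = length d" "length e = length d"
    and L: "L \<in> carrier_mat (d' ! j) (d ! j)"
  shows "ext d' d e (lift_local d d' j L) = lift_local (pmul d e) (pmul d' e) j (ext1 (e ! j) L)"
  unfolding ext_def lift_local_kmat[of "pmul d e"]
proof (rule kmat_cong)
  fix x y assume x: "x \<in> idx (pmul d' e)" and y: "y \<in> idx (pmul d e)"
  have l': "length d' = length e" "length d = length e" using l by simp_all
  have lx: "length x = length d" "length y = length d" using x y l by (simp_all add: idx_iff)
  have xy: "x ! j < d' ! j * e ! j" "y ! j < d ! j * e ! j" using x y j l by (simp_all add: idx_pmul_iff)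
  let ?P = "\<forall>t<length d. t \<noteq> j \<longrightarrow> x ! t = y ! t"
  let ?Q = "\<forall>t<length d. t \<noteq> j \<longrightarrow> x ! t div e ! t = y ! t div e ! t"
  have eq: "x ! t = y ! t \<longleftrightarrow> x ! t div e ! t = y ! t div e ! t \<and> x ! t mod e ! t = y ! t mod e ! t" for t
    by (metis div_mult_mod_eq)
  have m: "pmod x e = pmod y e \<longleftrightarrow> (\<forall>t<length d. x ! t mod e ! t = y ! t mod e ! t)"
    using lx l by (simp add: list_eq_iff_nth_eq)
  have k: "lift_local d d' j L $$ (encode d' (pdiv x e), encode d (pdiv y e))
    = (if ?Q then L $$ (x ! j div e ! j, y ! j div e ! j) else 0)"
    unfolding lift_local_kmat kmat_encode[OF idx_pdiv[OF l'(1) x] idx_pdiv[OF l'(2) y]]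
    by (intro if_cong) (use lx l j in auto)
  have "pmod x e = pmod y e \<and> ?Q \<longleftrightarrow> ?P \<and> x ! j mod e ! j = y ! j mod e ! j"
    unfolding m using eq j by blast
  thus "(if pmod x e = pmod y e then lift_local d d' j L $$ (encode d' (pdiv x e), encode d (pdiv y e)) else 0) =
    (if \<forall>t<length (pmul d e). t \<noteq> j \<longrightarrow> x ! t = y ! t then ext1 (e ! j) L $$ (x ! j, y ! j) else 0)"
    unfolding k using xy L l by (auto simp: ext1_def)
qed

lemma ext1_gram:
  assumes L: "L \<in> carrier_mat D' D" and ab: "a < D * m" "b < D * m"
  shows "(adj (ext1 m L) * ext1 m L) $$ (a, b) = (if a mod m = b mod m then (adj L * L) $$ (a div m, b div m) else 0)"
proof -
  have m: "m > 0" using ab by (cases m) auto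
  have dv: "a div m < D" "b div m < D" using ab by (simp_all add: less_mult_imp_div_less)
  have bij: "bij_betw (\<lambda>c. (c div m, c mod m)) {..<D' * m} ({..<D'} \<times> {..<m})"
    by (rule bij_betw_byWitness[where f' = "\<lambda>(u, w). u * m + w"])
      (use m in \<open>auto simp: less_mult_imp_div_less mixed_less mixed_div_mod\<close>)
  let ?f = "\<lambda>u w. cnj (if w = a mod m then L $$ (u, a div m) else 0) * (if w = b mod m then L $$ (u, b div m) else 0)"
  have "(adj (ext1 m L) * ext1 m L) $$ (a, b) = (\<Sum>c<D' * m. ?f (c div m) (c mod m))"
    using L ab by (simp add: index_mult_sum ext1_def del: index_mult_mat(1))
  also have "\<dots> = (\<Sum>u<D'. \<Sum>w<m. ?f u w)"
    using sum.reindex_bij_betw[OF bij, of "\<lambda>(u, w). ?f u w"] by (simp add: sum.cartesian_product)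
  also have "\<dots> = (\<Sum>u<D'. \<Sum>w<m. if w = a mod m then (if a mod m = b mod m then cnj (L $$ (u, a div m)) * L $$ (u, b div m) else 0) else 0)"
    by (intro sum.cong refl) auto
  also have "\<dots> = (if a mod m = b mod m then (adj L * L) $$ (a div m, b div m) else 0)"
    using m L dv by (simp add: index_mult_sum del: index_mult_mat(1))
  finally show ?thesis .
qed

lemma kraus_pos:
  assumes "kraus N M Ks" "N > 0"
  shows "Ks \<noteq> []" "M > 0"
proof -
  have s: "sum_list (map (\<lambda>K. (adj K * K) $$ (0, 0)) Ks) = 1" using assms by (simp add: kraus_def del: index_mult_mat(1))
  thus "Ks \<noteq> []" by auto
  show "M > 0"
  proof (rule ccontr)
    assume "\<not> M > 0"
    hence "(adj K * K) $$ (0, 0) = 0" if "K \<in> set Ks" for K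
      using assms that by (auto simp: kraus_def index_mult_sum simp del: index_mult_mat(1))
    hence "sum_list (map (\<lambda>K. (adj K * K) $$ (0, 0)) Ks) = sum_list (map (\<lambda>K. 0) Ks)"
      by (intro arg_cong[where f = sum_list] map_cong refl)
    thus False using s by simp
  qed
qed

text \<open>Without \<open>prod_list d > 0\<close> an instrument may have no outcomes, and \<open>d'\<close> is then arbitrary.\<close>

lemma locc_length: "locc_instr d d' Ks \<Longrightarrow> prod_list d > 0 \<Longrightarrow> length d' = length d"
proof (induction rule: locc_instr.induct)
  case (compose d d' Fs Gss d'')
  note k = kraus_pos[OF locc_kraus[OF compose.hyps(1)] compose.prems]
  have "length Fs > 0" using k(1) by auto
  thus ?case using compose k(2) by auto
qed simp

lemma map_locc_comp:
  assumes "length Gss = length Fs"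
    and "\<And>i F G. i < length Fs \<Longrightarrow> F \<in> set (Fs ! i) \<Longrightarrow> G \<in> set (concat (Gss ! i)) \<Longrightarrow> h (G * F) = g G * f F"
  shows "map (map h) (locc_comp Fs Gss) = locc_comp (map (map f) Fs) (map (map (map g)) Gss)"
  using assms(1)[symmetric] assms(2)
proof (induction Fs Gss rule: list_induct2)
  case (Cons Fb Fs Gs Gss)
  have "map (map h) (locc_comp Fs Gss) = locc_comp (map (map f) Fs) (map (map (map g)) Gss)"
    using Cons.prems[of "Suc _"] by (intro Cons.IH) auto
  moreover have "map (map h) (map (\<lambda>Gb. [G * F. F \<leftarrow> Fb, G \<leftarrow> Gb]) Gs)
    = map (\<lambda>Gb. [G * F. F \<leftarrow> map f Fb, G \<leftarrow> Gb]) (map (map g) Gs)"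
    using Cons.prems[of 0] by (auto simp: map_concat comp_def intro!: arg_cong[where f = concat]) blast
  ultimately show ?case by simp
qed simp

text \<open>Induction over the protocol: local steps are extended by \<open>ext1\<close>, and since
  \<open>ext\<close> is multiplicative it passes through adaptive composition branch by
  branch.\<close>

lemma locc_ext:
  "locc_instr d d' Ks \<Longrightarrow> prod_list d > 0 \<Longrightarrow> length e = length d \<Longrightarrow>
    locc_instr (pmul d e) (pmul d' e) (map (map (ext d' d e)) Ks)"
proof (induction rule: locc_instr.induct)
  case (local j d d' Lss)
  have "map (map (ext d' d e)) (map (map (lift_local d d' j)) Lss)
    = map (map (lift_local (pmul d e) (pmul d' e) j)) (map (map (ext1 (e ! j))) Lss)"
    using local by (auto simp: ext_lift_local)
  moreover have "locc_instr (pmul d e) (pmul d' e) (map (map (lift_local (pmul d e) (pmul d' e) j)) (map (map (ext1 (e ! j))) Lss))"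
  proof (rule locc_instr.local, goal_cases)
    case 4
    have "dim_row L = d' ! j \<and> dim_col L = d ! j" if "Ls \<in> set Lss" "L \<in> set Ls" for Ls L
      using local that by (meson carrier_matD)
    thus ?case using local by (auto simp: ext1_def intro!: carrier_matI)
  next
    case 5
    show ?case
    proof (intro allI impI)
      fix a b assume "a < pmul d e ! j" "b < pmul d e ! j"
      hence ab: "a < d ! j * e ! j" "b < d ! j * e ! j" using local by simp_all
      have dv: "a div e ! j < d ! j" "b div e ! j < d ! j" using ab by (simp_all add: less_mult_imp_div_less)
      have "concat (map (map (ext1 (e ! j))) Lss) = map (ext1 (e ! j)) (concat Lss)" by (simp add: map_concat)
      hence "sum_list (map (\<lambda>L. (adj L * L) $$ (a, b)) (concat (map (map (ext1 (e ! j))) Lss)))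
        = sum_list (map (\<lambda>L. (adj (ext1 (e ! j) L) * ext1 (e ! j) L) $$ (a, b)) (concat Lss))"
        by (simp only: map_map comp_def)
      also have "\<dots> = sum_list (map (\<lambda>L. if a mod e ! j = b mod e ! j then (adj L * L) $$ (a div e ! j, b div e ! j) else 0) (concat Lss))"
        by (intro arg_cong[where f = sum_list] map_cong refl ext1_gram[where D = "d ! j" and D' = "d' ! j"]) (use local ab in auto)
      also have "\<dots> = (if a mod e ! j = b mod e ! j then (if a div e ! j = b div e ! j then 1 else 0) else 0)"
        unfolding sum_list_if using local dv by (simp del: index_mult_mat(1))
      also have "\<dots> = (if a = b then 1 else 0)" by (auto) (metis div_mult_mod_eq)
      finally show "sum_list (map (\<lambda>L. (adj L * L) $$ (a, b)) (concat (map (map (ext1 (e ! j))) Lss))) = (if a = b then 1 else 0)" .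
    qed
  qed (use local in auto)
  ultimately show ?case by (simp only:)
next
  case (compose d d' Fs Gss d'')
  note k = kraus_pos[OF locc_kraus[OF compose.hyps(1)] compose.prems(1)]
  have len: "length d' = length d" using locc_length[OF compose.hyps(1) compose.prems(1)] .
  have "length Fs > 0" using k(1) by auto
  hence len': "length d'' = length d" using compose locc_length[of d' d''] k(2) len by metis
  have "map (map (ext d'' d e)) (locc_comp Fs Gss)
    = locc_comp (map (map (ext d' d e)) Fs) (map (map (map (ext d'' d' e))) Gss)"
  proof (rule map_locc_comp)
    show "length Gss = length Fs" using compose by simp
    fix i F G assume i: "i < length Fs" and F: "F \<in> set (Fs ! i)" and G: "G \<in> set (concat (Gss ! i))"
    have "F \<in> carrier_mat (prod_list d') (prod_list d)"
      using locc_kraus[OF compose.hyps(1)] i F by (force simp: kraus_def)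
    moreover have "G \<in> carrier_mat (prod_list d'') (prod_list d')"
      using locc_kraus[of d' d'' "Gss ! i"] compose.IH(2) i G unfolding kraus_def by blast
    ultimately show "ext d'' d e (G * F) = ext d'' d' e G * ext d' d e F"
      by (intro ext_mult) (use len len' compose.prems in auto)
  qed
  moreover have "locc_instr (pmul d e) (pmul d'' e) (locc_comp (map (map (ext d' d e)) Fs) (map (map (map (ext d'' d' e))) Gss))"
    by (rule locc_instr.compose[of _ "pmul d' e"]) (use compose k(2) len in auto)
  ultimately show ?case by simp
qed

lemma locc_tensor:
  assumes K: "locc_instr d d' Ks" and p: "prod_list d > 0" and l: "length e = length d"
  shows "\<exists>Ms. locc_instr (pmul d e) (pmul d' e) Ms \<and> (\<forall>A\<in>carrier_mat (prod_list d) (prod_list d). \<forall>B.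
    apply_instr (pmul d' e) Ms (tens d e A B) = tens d' e (apply_instr d' Ks A) B)"
proof (intro exI conjI ballI allI)
  show "locc_instr (pmul d e) (pmul d' e) (map (map (ext d' d e)) Ks)" by (rule locc_ext[OF K p l])
  fix A B :: "complex mat" assume A: "A \<in> carrier_mat (prod_list d) (prod_list d)"
  show "apply_instr (pmul d' e) (map (map (ext d' d e)) Ks) (tens d e A B) = tens d' e (apply_instr d' Ks A) B"
    unfolding apply_instr_krs map_concat[symmetric]
    by (rule krs_ext[OF _ _ _ A]) (use locc_length[OF K p] l locc_kraus[OF K] in \<open>auto simp: kraus_def\<close>)
qed

text \<open>Adjoining an ancilla \<open>\<tau> = S S\<^sup>*\<close> is a Kraus map, with one operator per column of \<open>S\<close>.\<close>

lemma ancilla_kraus: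
  assumes l: "length d = length e" and \<tau>: "psd (prod_list e) \<tau>" "mtrace \<tau> = 1"
  obtains Ts where "kraus (prod_list d) (prod_list (pmul d e)) Ts"
    "\<And>A. A \<in> carrier_mat (prod_list d) (prod_list d) \<Longrightarrow> krs (prod_list (pmul d e)) Ts A = tens d e A \<tau>"
proof -
  obtain S where S: "psd (prod_list e) S" "S * S = \<tau>" using psd_sqrt_exists[OF \<tau>(1)] .
  have Sc: "S \<in> carrier_mat (prod_list e) (prod_list e)" using S(1) by (rule psd_carrier)
  have Sh: "adj S = S" using S(1) by (rule psd_hermitian)
  define T where "T = (\<lambda>l. kmat (pmul d e) d (\<lambda>x y. if pdiv x e = y then S $$ (encode e (pmod x e), l) else 0))"
  define Ts where "Ts = map T [0..<prod_list e]"
  have sl: "sum_list (map f Ts) = (\<Sum>l<prod_list e. f (T l) :: complex)" for f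
    unfolding Ts_def map_map by (simp add: interv_sum_list_conv_sum_set_nat atLeast0LessThan)
  have "kraus (prod_list d) (prod_list (pmul d e)) Ts"
    unfolding kraus_def
  proof (intro conjI allI impI)
    show "\<forall>K\<in>set Ts. K \<in> carrier_mat (prod_list (pmul d e)) (prod_list d)" by (auto simp: Ts_def T_def)
    fix a b assume ab: "a < prod_list d" "b < prod_list d"
    define y z where "y = decode d a" and "z = decode d b"
    have y: "y \<in> idx d" "encode d y = a" and z: "z \<in> idx d" "encode d z = b"
      using ab by (auto simp: y_def z_def decode_idx encode_decode)
    have "(adj (T l) * T l) $$ (a, b) = (if y = z then (\<Sum>w<prod_list e. cnj (S $$ (w, l)) * S $$ (w, l)) else 0)" for l
    proof -
      have "(adj (T l) * T l) $$ (a, b) = (\<Sum>x\<in>idx (pmul d e). cnj (if pdiv x e = y then S $$ (encode e (pmod x e), l) else 0)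
          * (if pdiv x e = z then S $$ (encode e (pmod x e), l) else 0))"
        unfolding T_def adj_kmat kmat_mult using y z by (metis (no_types, lifting) kmat_encode)
      also have "\<dots> = (\<Sum>u\<in>idx d. \<Sum>w\<in>idx e. cnj (if u = y then S $$ (encode e w, l) else 0) * (if u = z then S $$ (encode e w, l) else 0))"
        by (rule sum_idx_pmul[OF l])
      also have "\<dots> = (\<Sum>u\<in>idx d. if u = y then (if y = z then (\<Sum>w\<in>idx e. cnj (S $$ (encode e w, l)) * S $$ (encode e w, l)) else 0) else 0)"
        by (intro sum.cong refl) auto
      also have "\<dots> = (if y = z then (\<Sum>w<prod_list e. cnj (S $$ (w, l)) * S $$ (w, l)) else 0)"
        using y(1) unfolding sum_idx by (simp add: sum.delta)
      finally show ?thesis .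
    qed
    hence "sum_list (map (\<lambda>K. (adj K * K) $$ (a, b)) Ts) = (if y = z then (\<Sum>l<prod_list e. \<Sum>w<prod_list e. cnj (S $$ (w, l)) * S $$ (w, l)) else 0)"
      unfolding sl by simp
    also have "(\<Sum>l<prod_list e. \<Sum>w<prod_list e. cnj (S $$ (w, l)) * S $$ (w, l)) = mtrace (adj S * S)"
      using Sc by (simp add: mtrace_def index_mult_sum del: index_mult_mat(1))
    also have "\<dots> = 1" using \<tau>(2) S(2) Sh by simp
    also have "y = z \<longleftrightarrow> a = b" using y z by (metis decode_encode)
    finally show "sum_list (map (\<lambda>K. (adj K * K) $$ (a, b)) Ts) = (if a = b then 1 else 0)" .
  qed
  moreover have "krs (prod_list (pmul d e)) Ts A = tens d e A \<tau>" if A: "A \<in> carrier_mat (prod_list d) (prod_list d)" for A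
  proof (rule kmat_eqI)
    fix x x' assume x: "x \<in> idx (pmul d e)" and x': "x' \<in> idx (pmul d e)"
    let ?i = "(encode (pmul d e) x, encode (pmul d e) x')"
    define \<alpha> where "\<alpha> = (\<lambda>y y'. A $$ (encode d y, encode d y'))"
    have A\<alpha>: "A = kmat d d \<alpha>" unfolding \<alpha>_def using kmat_ker[OF A] by simp
    note dv = idx_pdiv[OF l x] idx_pdiv[OF l x'] and md = encode_less[OF idx_pmod[OF l x]] encode_less[OF idx_pmod[OF l x']]
    let ?s = "\<lambda>l. S $$ (encode e (pmod x e), l)" and ?s' = "\<lambda>l. S $$ (encode e (pmod x' e), l)"
    have T1: "(T l * A * adj (T l)) $$ ?i = \<alpha> (pdiv x e) (pdiv x' e) * (?s l * cnj (?s' l))" for l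
    proof -
      have "(T l * A * adj (T l)) $$ ?i = (\<Sum>y\<in>idx d. \<Sum>y'\<in>idx d. (if pdiv x e = y then ?s l else 0) * \<alpha> y y' * cnj (if pdiv x' e = y' then ?s' l else 0))"
        unfolding T_def A\<alpha> kmat_conj kmat_encode[OF x x'] ..
      also have "\<dots> = (\<Sum>y\<in>idx d. \<Sum>y'\<in>idx d. if y' = pdiv x' e then (if y = pdiv x e then ?s l * \<alpha> y y' * cnj (?s' l) else 0) else 0)"
        by (intro sum.cong refl) auto
      also have "\<dots> = \<alpha> (pdiv x e) (pdiv x' e) * (?s l * cnj (?s' l))"
        using dv by (simp add: sum.delta)
      finally show ?thesis .
    qed
    have "krs (prod_list (pmul d e)) Ts A $$ ?i = (\<Sum>l<prod_list e. (T l * A * adj (T l)) $$ ?i)"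
      unfolding krs_def by (subst index_mat) (use x x' in \<open>simp_all only: encode_less prod.case sl\<close>)
    also have "\<dots> = \<alpha> (pdiv x e) (pdiv x' e) * (\<Sum>l<prod_list e. ?s l * cnj (?s' l))"
      unfolding T1 sum_distrib_left ..
    also have "(\<Sum>l<prod_list e. ?s l * cnj (?s' l)) = (S * adj S) $$ (encode e (pmod x e), encode e (pmod x' e))"
      using Sc md by (simp add: index_mult_sum del: index_mult_mat(1))
    also have "S * adj S = \<tau>" by (simp add: Sh S(2))
    finally show "krs (prod_list (pmul d e)) Ts A $$ ?i = tens d e A \<tau> $$ ?i" using x x' by (simp add: \<alpha>_def)
  qed simp_all
  ultimately show ?thesis using that by blast
qed

subsection \<open>The monoid of states\<close>

lemma kstateD:
  assumes "kstate k \<rho>"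
  shows "length (fst \<rho>) = k" "psd (prod_list (fst \<rho>)) (snd \<rho>)" "mtrace (snd \<rho>) = 1"
    "snd \<rho> \<in> carrier_mat (prod_list (fst \<rho>)) (prod_list (fst \<rho>))" "prod_list (fst \<rho>) > 0"
proof -
  show 1: "length (fst \<rho>) = k" "psd (prod_list (fst \<rho>)) (snd \<rho>)" "mtrace (snd \<rho>) = 1"
    using assms by (simp_all add: kstate_def is_density_def)
  show 2: "snd \<rho> \<in> carrier_mat (prod_list (fst \<rho>)) (prod_list (fst \<rho>))" using 1(2) by (rule psd_carrier)
  show "prod_list (fst \<rho>) > 0"
  proof (rule ccontr)
    assume "\<not> prod_list (fst \<rho>) > 0"
    hence "prod_list (fst \<rho>) = 0" by linarith
    hence "dim_row (snd \<rho>) = 0" using carrier_matD(1)[OF 2] by (simp only:)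
    hence "mtrace (snd \<rho>) = 0" by (simp add: mtrace_def)
    thus False using 1 by simp
  qed
qed

lemma fst_tensor [simp]: "fst (tensor_st \<rho> \<sigma>) = pmul (fst \<rho>) (fst \<sigma>)"
  by (simp add: tensor_st_def Let_def)

lemma snd_tensor: "snd (tensor_st \<rho> \<sigma>) = tens (fst \<rho>) (fst \<sigma>) (snd \<rho>) (snd \<sigma>)"
  using tensor_st_eq[of "fst \<rho>" "snd \<rho>" "fst \<sigma>" "snd \<sigma>"] by (metis prod.collapse snd_conv)

text \<open>Positivity and trace come for free once the product is seen as the image of
  \<open>\<rho>\<close> under the Kraus map that adjoins \<open>\<sigma>\<close>.\<close>

lemma kstate_tensor:
  assumes \<rho>: "kstate k \<rho>" and \<sigma>: "kstate k \<sigma>"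
  shows "kstate k (tensor_st \<rho> \<sigma>)"
proof -
  have l: "length (fst \<rho>) = length (fst \<sigma>)" using kstateD(1) \<rho> \<sigma> by metis
  obtain Ts where Ts: "kraus (prod_list (fst \<rho>)) (prod_list (pmul (fst \<rho>) (fst \<sigma>))) Ts"
    "krs (prod_list (pmul (fst \<rho>) (fst \<sigma>))) Ts (snd \<rho>) = snd (tensor_st \<rho> \<sigma>)"
    using ancilla_kraus[OF l kstateD(2,3)[OF \<sigma>]] kstateD(4)[OF \<rho>] snd_tensor by metis
  have "psd (prod_list (pmul (fst \<rho>) (fst \<sigma>))) (snd (tensor_st \<rho> \<sigma>))"
    unfolding Ts(2)[symmetric] by (rule krs_psd) (use Ts(1) kstateD(2)[OF \<rho>] in \<open>auto simp: kraus_def\<close>)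
  moreover have "mtrace (snd (tensor_st \<rho> \<sigma>)) = 1"
    unfolding Ts(2)[symmetric] using krs_trace[OF Ts(1) kstateD(4)[OF \<rho>]] kstateD(3)[OF \<rho>] by simp
  ultimately show ?thesis using l kstateD(1)[OF \<rho>] by (simp add: kstate_def is_density_def)
qed

lemma psd_unit: "psd 1 (1\<^sub>m 1)"
  using psd_gram[of "1\<^sub>m 1 :: complex mat" 1] by simp

lemma kstate_unit: "kstate k (unit_st k)"
  using psd_unit by (simp add: kstate_def unit_st_def is_density_def mtrace_def)

lemma kstate_tpow: "kstate k \<rho> \<Longrightarrow> kstate k (tpow \<rho> n)"
  by (induction n) (auto simp: kstate_tensor kstate_unit kstateD(1))

text \<open>An equality and not just a conversion, because the mixed-radix encoding is associative:
  quotients and remainders by a product are iterated ones. Commutativity, in contrast, holds only up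
  to a local permutation.\<close>

lemma tensor_assoc:
  assumes "length (fst \<rho>) = k" "length (fst \<sigma>) = k" "length (fst \<tau>) = k"
  shows "tensor_st (tensor_st \<rho> \<sigma>) \<tau> = tensor_st \<rho> (tensor_st \<sigma> \<tau>)"
proof (rule prod_eqI)
  let ?d = "fst \<rho>" and ?e = "fst \<sigma>" and ?f = "fst \<tau>"
  show fst: "fst (tensor_st (tensor_st \<rho> \<sigma>) \<tau>) = fst (tensor_st \<rho> (tensor_st \<sigma> \<tau>))"
    using assms by (auto intro!: nth_equalityI simp: mult.assoc)
  show "snd (tensor_st (tensor_st \<rho> \<sigma>) \<tau>) = snd (tensor_st \<rho> (tensor_st \<sigma> \<tau>))"
    unfolding snd_tensor[of "tensor_st \<rho> \<sigma>"] snd_tensor[of \<rho> "tensor_st \<sigma> \<tau>"]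
  proof (rule kmat_eqI)
    show "tens (fst (tensor_st \<rho> \<sigma>)) ?f (snd (tensor_st \<rho> \<sigma>)) (snd \<tau>) \<in> carrier_mat (prod_list (pmul (pmul ?d ?e) ?f)) (prod_list (pmul (pmul ?d ?e) ?f))"
      by simp
    show "tens ?d (fst (tensor_st \<sigma> \<tau>)) (snd \<rho>) (snd (tensor_st \<sigma> \<tau>)) \<in> carrier_mat (prod_list (pmul (pmul ?d ?e) ?f)) (prod_list (pmul (pmul ?d ?e) ?f))"
      using fst by simp
    fix x y assume "x \<in> idx (pmul (pmul ?d ?e) ?f)" "y \<in> idx (pmul (pmul ?d ?e) ?f)"
    note xy = this
    have p: "pmul (pmul ?d ?e) ?f = pmul ?d (pmul ?e ?f)" using fst by simp
    note xy' = xy[unfolded p]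
    have l1: "length (pmul ?d ?e) = length ?f" "length ?d = length (pmul ?e ?f)" "length ?d = length ?e" "length ?e = length ?f"
      using assms by simp_all
    have ids: "pdiv (pdiv z ?f) ?e = pdiv z (pmul ?e ?f)" "pmod (pdiv z ?f) ?e = pdiv (pmod z (pmul ?e ?f)) ?f"
      "pmod (pmod z (pmul ?e ?f)) ?f = pmod z ?f" if z: "z \<in> idx (pmul (pmul ?d ?e) ?f)" for z
    proof -
      have lz: "length z = k" using z assms by (simp add: idx_iff)
      have f0: "?f ! t > 0" if "t < k" for t
      proof -
        have "z ! t < (?d ! t * ?e ! t) * ?f ! t" using z that assms by (simp add: idx_iff)
        thus ?thesis by (cases "?f ! t") auto
      qed
      show "pdiv (pdiv z ?f) ?e = pdiv z (pmul ?e ?f)"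
        using assms lz by (auto intro!: nth_equalityI simp: div_mult2_eq mult.commute[of "?e ! _"])
      show "pmod (pdiv z ?f) ?e = pdiv (pmod z (pmul ?e ?f)) ?f"
        using assms lz f0 by (auto intro!: nth_equalityI simp: mod_mult2_eq mult.commute[of "?e ! _"])
      show "pmod (pmod z (pmul ?e ?f)) ?f = pmod z ?f"
        using assms lz by (auto intro!: nth_equalityI simp: mod_mod_cancel)
    qed
    have "tens (fst (tensor_st \<rho> \<sigma>)) ?f (snd (tensor_st \<rho> \<sigma>)) (snd \<tau>) $$ (encode (pmul (pmul ?d ?e) ?f) x, encode (pmul (pmul ?d ?e) ?f) y)
      = snd \<rho> $$ (encode ?d (pdiv (pdiv x ?f) ?e), encode ?d (pdiv (pdiv y ?f) ?e)) *
        snd \<sigma> $$ (encode ?e (pmod (pdiv x ?f) ?e), encode ?e (pmod (pdiv y ?f) ?e)) *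
        snd \<tau> $$ (encode ?f (pmod x ?f), encode ?f (pmod y ?f))"
      using xy idx_pdiv[OF l1(1) xy(1)] idx_pdiv[OF l1(1) xy(2)] by (simp add: snd_tensor)
    also have "\<dots> = tens ?d (fst (tensor_st \<sigma> \<tau>)) (snd \<rho>) (snd (tensor_st \<sigma> \<tau>)) $$ (encode (pmul ?d (pmul ?e ?f)) x, encode (pmul ?d (pmul ?e ?f)) y)"
      using xy' idx_pmod[OF l1(2) xy'(1)] idx_pmod[OF l1(2) xy'(2)] by (simp add: snd_tensor ids[OF xy(1)] ids[OF xy(2)])
    finally show "tens (fst (tensor_st \<rho> \<sigma>)) ?f (snd (tensor_st \<rho> \<sigma>)) (snd \<tau>) $$ (encode (pmul (pmul ?d ?e) ?f) x, encode (pmul (pmul ?d ?e) ?f) y)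
      = tens ?d (fst (tensor_st \<sigma> \<tau>)) (snd \<rho>) (snd (tensor_st \<sigma> \<tau>)) $$ (encode (pmul (pmul ?d ?e) ?f) x, encode (pmul (pmul ?d ?e) ?f) y)"
      unfolding p .
  qed
qed

lemma prod_list_ones [simp]: "prod_list (replicate k (1 :: nat)) = 1"
  by (induction k) auto

lemma tensor_unit_right:
  assumes "kstate k \<rho>"
  shows "tensor_st \<rho> (unit_st k) = \<rho>"
proof (rule prod_eqI)
  note \<rho> = kstateD[OF assms]
  show d: "fst (tensor_st \<rho> (unit_st k)) = fst \<rho>" using \<rho>(1) by (auto simp: unit_st_def intro!: nth_equalityI)
  hence d': "pmul (fst \<rho>) (replicate k 1) = fst \<rho>" by (simp add: unit_st_def)
  show "snd (tensor_st \<rho> (unit_st k)) = snd \<rho>"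
  proof (rule kmat_eqI)
    show "snd (tensor_st \<rho> (unit_st k)) \<in> carrier_mat (prod_list (fst \<rho>)) (prod_list (fst \<rho>))"
      using d by (metis fst_tensor snd_tensor tens_carrier)
    show "snd \<rho> \<in> carrier_mat (prod_list (fst \<rho>)) (prod_list (fst \<rho>))" by (rule \<rho>(4))
    fix x y assume xy: "x \<in> idx (fst \<rho>)" "y \<in> idx (fst \<rho>)"
    have xy': "x \<in> idx (pmul (fst \<rho>) (replicate k 1))" "y \<in> idx (pmul (fst \<rho>) (replicate k 1))"
      using xy by (simp_all only: d')
    have l: "length (fst \<rho>) = length (replicate k (1::nat))" using \<rho>(1) by simp
    have "encode (replicate k 1) (pmod z (replicate k 1)) = 0" if "z \<in> idx (pmul (fst \<rho>) (replicate k 1))" for z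
      using encode_less[OF idx_pmod[OF l that]] by simp
    moreover have "pdiv z (replicate k 1) = z" if "z \<in> idx (fst \<rho>)" for z
      using that \<rho>(1) by (auto simp: idx_iff intro!: nth_equalityI)
    ultimately show "snd (tensor_st \<rho> (unit_st k)) $$ (encode (fst \<rho>) x, encode (fst \<rho>) y) = snd \<rho> $$ (encode (fst \<rho>) x, encode (fst \<rho>) y)"
      using tens_encode[OF xy', of "snd \<rho>" "1\<^sub>m 1"] xy xy' d' by (simp add: snd_tensor unit_st_def)
  qed
qed

lemma tensor_unit_left:
  assumes "kstate k \<rho>"
  shows "tensor_st (unit_st k) \<rho> = \<rho>"
proof (rule prod_eqI)
  note \<rho> = kstateD[OF assms]
  show d: "fst (tensor_st (unit_st k) \<rho>) = fst \<rho>" using \<rho>(1) by (auto simp: unit_st_def intro!: nth_equalityI)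
  hence d': "pmul (replicate k 1) (fst \<rho>) = fst \<rho>" by (simp add: unit_st_def)
  show "snd (tensor_st (unit_st k) \<rho>) = snd \<rho>"
  proof (rule kmat_eqI)
    show "snd (tensor_st (unit_st k) \<rho>) \<in> carrier_mat (prod_list (fst \<rho>)) (prod_list (fst \<rho>))"
      using d by (metis fst_tensor snd_tensor tens_carrier)
    show "snd \<rho> \<in> carrier_mat (prod_list (fst \<rho>)) (prod_list (fst \<rho>))" by (rule \<rho>(4))
    fix x y assume xy: "x \<in> idx (fst \<rho>)" "y \<in> idx (fst \<rho>)"
    have xy': "x \<in> idx (pmul (replicate k 1) (fst \<rho>))" "y \<in> idx (pmul (replicate k 1) (fst \<rho>))"
      using xy by (simp_all only: d')
    have l: "length (replicate k (1::nat)) = length (fst \<rho>)" using \<rho>(1) by simp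
    have "encode (replicate k 1) (pdiv z (fst \<rho>)) = 0" if "z \<in> idx (pmul (replicate k 1) (fst \<rho>))" for z
      using encode_less[OF idx_pdiv[OF l that]] by simp
    moreover have "pmod z (fst \<rho>) = z" if "z \<in> idx (fst \<rho>)" for z
      using that \<rho>(1) by (auto simp: idx_iff intro!: nth_equalityI)
    ultimately show "snd (tensor_st (unit_st k) \<rho>) $$ (encode (fst \<rho>) x, encode (fst \<rho>) y) = snd \<rho> $$ (encode (fst \<rho>) x, encode (fst \<rho>) y)"
      using tens_encode[OF xy', of "1\<^sub>m 1" "snd \<rho>"] xy xy' d' by (simp add: snd_tensor unit_st_def)
  qed
qed

section \<open>Exact conversions: commuting, tensoring and discarding\<close>

definition ex_conv :: "kstate \<Rightarrow> kstate \<Rightarrow> bool" where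
  "ex_conv \<rho> \<sigma> \<longleftrightarrow> exact (fst \<rho>) (snd \<rho>) (fst \<sigma>) (snd \<sigma>)"

lemma ex_conv_refl: "1 \<le> k \<Longrightarrow> kstate k \<rho> \<Longrightarrow> ex_conv \<rho> \<rho>"
  unfolding ex_conv_def by (rule exact_refl) (auto dest: kstateD)

lemma ex_conv_trans: "kstate k \<rho> \<Longrightarrow> ex_conv \<rho> \<sigma> \<Longrightarrow> ex_conv \<sigma> \<tau> \<Longrightarrow> ex_conv \<rho> \<tau>"
  unfolding ex_conv_def using exact_trans kstateD(4) by blast

text \<open>Exchanges the two mixed-radix digits inside the index of one party, that is, swaps its
  two subsystems.\<close>

lemma swap_bij:
  assumes "d > 0" "e > 0"
  shows "bij_betw (\<lambda>c. (c mod d) * e + c div d) {..<d * e} {..<(d :: nat) * e}"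
proof (rule bij_betw_byWitness[where f' = "\<lambda>c. (c mod e) * d + c div e"])
  have dv: "c div d < e" "c div e < d" if "c < d * e" for c
    using that by (simp_all add: less_mult_imp_div_less mult.commute)
  show "\<forall>a\<in>{..<d * e}. ((a mod d * e + a div d) mod e) * d + (a mod d * e + a div d) div e = a"
    using dv by (auto simp: mixed_div_mod div_mult_mod_eq)
  show "\<forall>a\<in>{..<d * e}. ((a mod e * d + a div e) mod d) * e + (a mod e * d + a div e) div d = a"
    using dv by (auto simp: mixed_div_mod div_mult_mod_eq)
  show "(\<lambda>c. c mod d * e + c div d) ` {..<d * e} \<subseteq> {..<d * e}"
    using dv assms by (auto intro!: mixed_less)
  show "(\<lambda>c. c mod e * d + c div e) ` {..<d * e} \<subseteq> {..<d * e}"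
    using dv assms mixed_less[of _ e _ d] by (auto simp: mult.commute[of d e])
qed

lemma ex_conv_commute:
  assumes k: "1 \<le> k" and \<rho>: "kstate k \<rho>" and \<sigma>: "kstate k \<sigma>"
  shows "ex_conv (tensor_st \<rho> \<sigma>) (tensor_st \<sigma> \<rho>)"
proof -
  let ?d = "fst \<rho>" and ?e = "fst \<sigma>"
  let ?de = "pmul ?d ?e"
  have len: "length ?d = k" "length ?e = k" using kstateD(1) \<rho> \<sigma> by auto
  have pos: "?d ! t > 0" "?e ! t > 0" if "t < k" for t
    using kstateD(5)[OF \<rho>] kstateD(5)[OF \<sigma>] len that by (metis neq0_conv nth_mem prod_list_zero_iff)+
  have ed: "pmul ?e ?d = ?de" using len by (auto intro!: nth_equalityI simp: mult.commute)
  define \<tau> where "\<tau> = (\<lambda>t c. (c mod ?d ! t) * ?e ! t + c div ?d ! t)"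
  define T where "T = (\<lambda>x. map (\<lambda>t. \<tau> t (x ! t)) [0..<length ?de])"
  define \<kappa> where "\<kappa> = (\<lambda>x y. snd \<rho> $$ (encode ?d (pdiv x ?e), encode ?d (pdiv y ?e)) * snd \<sigma> $$ (encode ?e (pmod x ?e), encode ?e (pmod y ?e)))"
  have "exact ?de (kmat ?de ?de \<kappa>) ?de (kmat ?de ?de (\<lambda>x y. (\<Prod>t<length ?de. 1) * cnj (\<Prod>t<length ?de. 1) * \<kappa> (T x) (T y)))"
    unfolding T_def
  proof (rule exact_monomial[where c = "\<lambda>_ _. 1"])
    show "?de \<noteq> []" using len k by auto
    fix t assume "t < length ?de"
    thus "bij_betw (\<tau> t) {..<?de ! t} {..<?de ! t}"
      unfolding \<tau>_def using swap_bij[OF pos(1) pos(2), of t t] len by simp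
  qed simp
  moreover have "kmat ?de ?de \<kappa> = snd (tensor_st \<rho> \<sigma>)" by (simp add: snd_tensor tens_def \<kappa>_def)
  moreover have "kmat ?de ?de (\<lambda>x y. (\<Prod>t<length ?de. 1) * cnj (\<Prod>t<length ?de. 1) * \<kappa> (T x) (T y)) = snd (tensor_st \<sigma> \<rho>)"
    unfolding snd_tensor tens_def ed
  proof (rule kmat_cong)
    fix x y assume xy: "x \<in> idx ?de" "y \<in> idx ?de"
    have "pdiv (T z) ?e = pmod z ?d" "pmod (T z) ?e = pdiv z ?d" if z: "z \<in> idx ?de" for z
    proof -
      have lz: "length z = k" using z len by (simp add: idx_iff)
      have lt: "z ! t div ?d ! t < ?e ! t" if "t < k" for t
        using z that len by (simp add: idx_iff less_mult_imp_div_less mult.commute)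
      show "pdiv (T z) ?e = pmod z ?d" "pmod (T z) ?e = pdiv z ?d"
        using lz len lt by (auto simp: T_def \<tau>_def mixed_div_mod intro!: nth_equalityI)
    qed
    thus "(\<Prod>t<length ?de. 1) * cnj (\<Prod>t<length ?de. 1) * \<kappa> (T x) (T y) =
      snd \<sigma> $$ (encode ?e (pdiv x ?d), encode ?e (pdiv y ?d)) * snd \<rho> $$ (encode ?d (pmod x ?d), encode ?d (pmod y ?d))"
      using xy by (simp add: \<kappa>_def)
  qed
  ultimately show ?thesis unfolding ex_conv_def by (simp add: ed)
qed

lemma ex_conv_tensor_right:
  assumes \<rho>: "kstate k \<rho>" and \<tau>: "kstate k \<tau>" and "ex_conv \<rho> \<sigma>"
  shows "ex_conv (tensor_st \<rho> \<tau>) (tensor_st \<sigma> \<tau>)"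
proof -
  obtain Ks where Ks: "locc_instr (fst \<rho>) (fst \<sigma>) Ks" "apply_instr (fst \<sigma>) Ks (snd \<rho>) = snd \<sigma>"
    using assms(3) by (auto simp: ex_conv_def exact_def)
  have l: "length (fst \<tau>) = length (fst \<rho>)" using kstateD(1) \<rho> \<tau> by metis
  show ?thesis
    using locc_tensor[OF Ks(1) kstateD(5)[OF \<rho>] l] kstateD(4)[OF \<rho>] Ks(2)
    unfolding ex_conv_def exact_def snd_tensor fst_tensor by metis
qed

lemma locc_discard:
  assumes d: "d \<noteq> []" and m: "m \<le> length d"
  shows "\<exists>Ks. locc_instr d (replicate m 1 @ drop m d) Ks"
  using m
proof (induction m)
  case 0
  have "0\<^sub>m (prod_list d) (prod_list d) \<in> carrier_mat (prod_list d) (prod_list d)" by simp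
  from exact_refl[OF d this] show ?case by (auto simp: exact_def)
next
  case (Suc m)
  let ?d = "replicate m 1 @ drop m d" and ?d' = "replicate (Suc m) 1 @ drop (Suc m) d"
  have m: "m < length d" using Suc.prems by simp
  obtain Ks where Ks: "locc_instr d ?d Ks" using Suc by auto
  have nm: "?d ! m = d ! m" "?d' ! m = 1" using m by (simp_all add: nth_append del: replicate_Suc)
  \<comment> \<open>Partial trace over party \<open>m\<close>, with one Kraus operator (a basis bra)
    per basis vector.\<close>
  define Ls :: "complex mat list" where "Ls = map (\<lambda>a. mat 1 (d ! m) (\<lambda>(i, b). if b = a then 1 else 0)) [0..<d ! m]"
  have "locc_instr ?d ?d' (map (map (lift_local ?d ?d' m)) [Ls])"
  proof (rule locc_instr.local)
    show "\<forall>t<length ?d. t \<noteq> m \<longrightarrow> ?d' ! t = ?d ! t" using m by (auto simp: nth_append simp del: replicate_Suc)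
    show "\<forall>Ls\<in>set [Ls]. \<forall>L\<in>set Ls. L \<in> carrier_mat (?d' ! m) (?d ! m)" unfolding nm by (auto simp: Ls_def)
    show "\<forall>a<?d ! m. \<forall>b<?d ! m. sum_list (map (\<lambda>L. (adj L * L) $$ (a, b)) (concat [Ls])) = (if a = b then 1 else 0)"
      unfolding nm
    proof (intro allI impI)
      fix a b assume ab: "a < d ! m" "b < d ! m"
      have "sum_list (map (\<lambda>L. (adj L * L) $$ (a, b)) (concat [Ls])) = (\<Sum>c<d ! m. cnj (if a = c then 1 else 0) * (if b = c then 1 else 0))"
        unfolding Ls_def using ab
        by (simp add: comp_def interv_sum_list_conv_sum_set_nat atLeast0LessThan index_mult_sum del: index_mult_mat(1))
      also have "\<dots> = (\<Sum>c<d ! m. if c = a then (if a = b then 1 else 0) else 0)" by (rule sum.cong) auto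
      also have "\<dots> = (if a = b then 1 else 0)" using ab by simp
      finally show "sum_list (map (\<lambda>L. (adj L * L) $$ (a, b)) (concat [Ls])) = (if a = b then 1 else 0)" .
    qed
  qed (use m in auto)
  thus ?case using locc_compose[OF Ks] by blast
qed

text \<open>Once all parties have discarded, the output is a 1 by 1 matrix, and trace preservation
  makes its entry 1.\<close>

lemma ex_conv_unit:
  assumes k: "1 \<le> k" and \<rho>: "kstate k \<rho>"
  shows "ex_conv \<rho> (unit_st k)"
proof -
  have len: "length (fst \<rho>) = k" using \<rho> by (rule kstateD)
  obtain Ks where Ks: "locc_instr (fst \<rho>) (replicate k 1) Ks"
    using locc_discard[of "fst \<rho>" k] len k by fastforce
  let ?B = "apply_instr (replicate k 1) Ks (snd \<rho>)"
  have c: "?B \<in> carrier_mat 1 1" using apply_instr_carrier[of "replicate k 1" Ks "snd \<rho>"] by simp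
  have "mtrace ?B = 1"
    unfolding apply_instr_krs using krs_trace[OF locc_kraus[OF Ks] kstateD(4)[OF \<rho>]] kstateD(3)[OF \<rho>] by simp
  hence "?B $$ (0, 0) = 1" using c by (simp add: mtrace_def)
  hence "?B = 1\<^sub>m 1" using c by (intro eq_matI) auto
  thus ?thesis using Ks unfolding ex_conv_def exact_def unit_st_def by auto
qed

subsection \<open>Preparing arbitrary states from GHZ states\<close>

definition const_list :: "nat list \<Rightarrow> bool" where
  "const_list x \<longleftrightarrow> (\<exists>a. x = replicate (length x) a)"

lemma const_list_replicate [simp]: "const_list (replicate k a)"
  by (auto simp: const_list_def)

lemma const_list_eq: "const_list x \<Longrightarrow> length x = k \<Longrightarrow> 1 \<le> k \<Longrightarrow> x = replicate k (x ! 0)"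
  unfolding const_list_def by (metis One_nat_def Suc_le_lessD nth_replicate)

lemma const_listI:
  assumes "length x = k" "\<And>t. t < k \<Longrightarrow> x ! t = x ! 0"
  shows "const_list x"
proof -
  have "x = replicate k (x ! 0)"
  proof (rule nth_equalityI)
    fix t assume "t < length x"
    hence "t < k" using assms(1) by simp
    thus "x ! t = replicate k (x ! 0) ! t" using assms(2)[of t] by (simp only: nth_replicate)
  qed (use assms(1) in simp)
  thus ?thesis by (metis const_list_replicate)
qed

lemma const_listE: "const_list x \<Longrightarrow> length x = k \<Longrightarrow> (\<And>a. x = replicate k a \<Longrightarrow> P) \<Longrightarrow> P"
  by (metis const_list_def)

text \<open>The kernel of the GHZ state with \<open>D\<close> levels, that is, of the projector onto
  the normalized sum of all \<open>|a...a>\<close> with \<open>a < D\<close>.\<close>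

definition ghz_ker :: "nat \<Rightarrow> nat list \<Rightarrow> nat list \<Rightarrow> complex" where
  "ghz_ker D x y = (if const_list x \<and> const_list y then 1 / of_nat D else 0)"

lemma prod_list_replicate: "prod_list (replicate k (n :: nat)) = n ^ k"
  by (induction k) auto

lemma idx_replicate: "x \<in> idx (replicate k D) \<longleftrightarrow> length x = k \<and> (\<forall>t<k. x ! t < D)"
  by (auto simp: idx_iff)

lemma encode_zeros: "encode d (replicate (length d) 0) = 0"
  by (induction d) auto

lemma encode_ones: "encode (replicate k 2) (replicate k 1) = 2 ^ k - 1"
  by (induction k) (auto simp: prod_list_replicate)

lemma encode_inj: "x \<in> idx d \<Longrightarrow> y \<in> idx d \<Longrightarrow> encode d x = encode d y \<longleftrightarrow> x = y"
  by (metis decode_encode)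

lemma const_list_iff_encode:
  assumes k: "1 \<le> k" and x: "x \<in> idx (replicate k 2)"
  shows "encode (replicate k 2) x \<in> {0, 2 ^ k - 1} \<longleftrightarrow> const_list x"
proof -
  have z: "replicate k 0 \<in> idx (replicate k 2)" "replicate k 1 \<in> idx (replicate k 2)" by (auto simp: idx_replicate)
  have "encode (replicate k 2) x \<in> {0, 2 ^ k - 1} \<longleftrightarrow> x = replicate k 0 \<or> x = replicate k 1"
    using encode_inj[OF x z(1)] encode_inj[OF x z(2)] encode_zeros[of "replicate k 2"] encode_ones[of k] by auto
  also have "\<dots> \<longleftrightarrow> const_list x"
  proof
    assume c: "const_list x"
    have l: "length x = k" and lt: "x ! 0 < 2" using x k by (auto simp: idx_replicate)
    have "x = replicate k (x ! 0)" using const_list_eq[OF c l k] .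
    moreover have "x ! 0 = 0 \<or> x ! 0 = 1" using lt by linarith
    ultimately show "x = replicate k 0 \<or> x = replicate k 1" by metis
  qed auto
  finally show ?thesis .
qed

lemma GHZ_kmat:
  assumes k: "1 \<le> k"
  shows "GHZ k = (replicate k 2, kmat (replicate k 2) (replicate k 2) (ghz_ker 2))"
proof -
  have "mat (2 ^ k) (2 ^ k) (\<lambda>(i, j). if i \<in> {0, 2 ^ k - 1} \<and> j \<in> {0, 2 ^ k - 1} then 1 / 2 else 0)
    = kmat (replicate k 2) (replicate k 2) (ghz_ker 2)" (is "?A = ?B")
  proof (rule kmat_eqI)
    show "?A \<in> carrier_mat (prod_list (replicate k 2)) (prod_list (replicate k 2))" by (simp add: prod_list_replicate)
    fix x y assume xy: "x \<in> idx (replicate k 2)" "y \<in> idx (replicate k 2)"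
    have "encode (replicate k 2) x < 2 ^ k" "encode (replicate k 2) y < 2 ^ k"
      using encode_less[OF xy(1)] encode_less[OF xy(2)] by (simp_all add: prod_list_replicate)
    thus "?A $$ (encode (replicate k 2) x, encode (replicate k 2) y) = ?B $$ (encode (replicate k 2) x, encode (replicate k 2) y)"
      using xy const_list_iff_encode[OF k xy(1)] const_list_iff_encode[OF k xy(2)] by (simp add: ghz_ker_def)
  qed (rule kmat_carrier)
  thus ?thesis by (simp add: GHZ_def Let_def)
qed

lemma const_list_div_mod:
  assumes "length x = k" "1 \<le> k"
  shows "const_list (pdiv x (replicate k E)) \<and> const_list (pmod x (replicate k E)) \<longleftrightarrow> const_list x"
proof
  assume a: "const_list (pdiv x (replicate k E)) \<and> const_list (pmod x (replicate k E))"
  have l: "length (pdiv x (replicate k E)) = k" "length (pmod x (replicate k E)) = k" using assms by auto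
  note c = const_list_eq[OF conjunct1[OF a] l(1) assms(2)] const_list_eq[OF conjunct2[OF a] l(2) assms(2)]
  have "x ! t = x ! 0" if "t < k" for t
  proof -
    have "x ! t div E = x ! 0 div E" "x ! t mod E = x ! 0 mod E"
      using arg_cong[OF c(1), of "\<lambda>l. l ! t"] arg_cong[OF c(2), of "\<lambda>l. l ! t"] that assms by simp_all
    thus ?thesis by (metis div_mult_mod_eq)
  qed
  thus "const_list x" by (rule const_listI[OF assms(1)])
next
  assume "const_list x"
  then obtain a where x: "x = replicate k a" using assms(1) by (rule const_listE)
  show "const_list (pdiv x (replicate k E)) \<and> const_list (pmod x (replicate k E))"
    unfolding x by (simp add: map2_map_map zip_replicate)
qed

text \<open>Copies of GHZ merge into one GHZ state with \<open>2 ^ n\<close> levels: an index list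
  is constant exactly if its lists of quotients and of remainders are.\<close>

lemma GHZ_tpow:
  assumes k: "1 \<le> k"
  shows "tpow (GHZ k) n = (replicate k (2 ^ n), kmat (replicate k (2 ^ n)) (replicate k (2 ^ n)) (ghz_ker (2 ^ n)))"
proof (induction n)
  case 0
  have "kmat (replicate k 1) (replicate k 1) (ghz_ker 1) = 1\<^sub>m 1"
  proof (rule eq_matI)
    fix i j assume "i < dim_row (1\<^sub>m 1 :: complex mat)" "j < dim_col (1\<^sub>m 1 :: complex mat)"
    hence ij: "i = 0" "j = 0" by auto
    have z: "replicate k 0 \<in> idx (replicate k 1)" by (auto simp: idx_replicate)
    have "kmat (replicate k 1) (replicate k 1) (ghz_ker 1) $$ (encode (replicate k 1) (replicate k 0), encode (replicate k 1) (replicate k 0)) = 1"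
      unfolding kmat_encode[OF z z] by (simp add: ghz_ker_def)
    thus "kmat (replicate k 1) (replicate k 1) (ghz_ker 1) $$ (i, j) = 1\<^sub>m 1 $$ (i, j)"
      using encode_zeros[of "replicate k 1"] ij by simp
  qed simp_all
  moreover have "length (fst (GHZ k)) = k" by (simp add: GHZ_def Let_def)
  ultimately show ?case by (simp add: unit_st_def)
next
  case (Suc n)
  let ?e = "replicate k (2 ^ n) :: nat list" and ?r = "replicate k 2 :: nat list"
  have d: "pmul ?r ?e = replicate k (2 ^ Suc n)" by (intro nth_equalityI) auto
  have l: "length ?r = length ?e" by simp
  have "tpow (GHZ k) (Suc n) = (pmul ?r ?e, tens ?r ?e (kmat ?r ?r (ghz_ker 2)) (kmat ?e ?e (ghz_ker (2 ^ n))))"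
    unfolding tpow.simps Suc unfolding GHZ_kmat[OF k] tensor_st_eq ..
  also have "tens ?r ?e (kmat ?r ?r (ghz_ker 2)) (kmat ?e ?e (ghz_ker (2 ^ n))) = kmat (pmul ?r ?e) (pmul ?r ?e) (ghz_ker (2 ^ Suc n))"
    unfolding tens_def
  proof (rule kmat_cong)
    fix x y assume xy: "x \<in> idx (pmul ?r ?e)" "y \<in> idx (pmul ?r ?e)"
    have lx: "length x = k" "length y = k" using xy by (simp_all add: idx_iff)
    show "kmat ?r ?r (ghz_ker 2) $$ (encode ?r (pdiv x ?e), encode ?r (pdiv y ?e)) *
        kmat ?e ?e (ghz_ker (2 ^ n)) $$ (encode ?e (pmod x ?e), encode ?e (pmod y ?e)) = ghz_ker (2 ^ Suc n) x y"
      unfolding kmat_encode[OF idx_pdiv[OF l xy(1)] idx_pdiv[OF l xy(2)]] kmat_encode[OF idx_pmod[OF l xy(1)] idx_pmod[OF l xy(2)]]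
      using const_list_div_mod[OF lx(1) k, of "2 ^ n"] const_list_div_mod[OF lx(2) k, of "2 ^ n"]
      by (auto simp: ghz_ker_def)
  qed
  finally show ?case unfolding d .
qed

lemma kstate_GHZ:
  assumes k: "1 \<le> k"
  shows "kstate k (GHZ k)"
proof -
  let ?N = "2 ^ k :: nat"
  define G where "G = mat 1 ?N (\<lambda>(i, j). if j \<in> {0, ?N - 1} then 1 / of_real (sqrt 2) else (0 :: complex))"
  have s: "complex_of_real (sqrt 2) * of_real (sqrt 2) = 2" by (simp flip: of_real_mult)
  have "adj G * G = snd (GHZ k)"
    by (rule eq_matI) (auto simp: G_def GHZ_def Let_def index_mult_sum s simp del: index_mult_mat(1))
  hence psd: "psd ?N (snd (GHZ k))" using psd_gram[of G ?N] by (simp add: G_def)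
  have N: "2 \<le> ?N" using k by (metis one_le_numeral power_increasing power_one_right)
  have "mtrace (snd (GHZ k)) = (\<Sum>i<?N. if i \<in> {0, ?N - 1} then 1 / 2 else 0)"
    by (simp add: mtrace_def GHZ_def Let_def)
  also have "\<dots> = (\<Sum>i\<in>{0, ?N - 1}. 1 / 2)"
    by (rule sum.mono_neutral_cong_right) (use N in auto)
  also have "\<dots> = 1" using N by simp
  finally have "mtrace (snd (GHZ k)) = 1" .
  thus ?thesis using psd by (simp add: kstate_def is_density_def GHZ_def Let_def prod_list_replicate)
qed

section \<open>Roots of unity and cyclic shifts\<close>

definition om :: "nat \<Rightarrow> nat \<Rightarrow> complex" where
  "om D m = cis (2 * pi * real m / real D)"

lemma om_add: "om D (m + n) = om D m * om D n"
  by (simp add: om_def cis_mult add_divide_distrib distrib_left)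

lemma om_power: "om D (f * a) = om D a ^ f"
  by (simp add: om_def DeMoivre mult.commute[of _ "real f"]) (simp add: ac_simps)

lemma norm_om [simp]: "cmod (om D m) = 1"
  by (simp add: om_def)

lemma om_cnj_self: "om D m * cnj (om D m) = 1"
  by (simp add: complex_norm_square[symmetric])

text \<open>For \<open>a \<noteq> b\<close> this is a full geometric sum of a \<open>D\<close>-th
  root of unity \<open>z\<close>, and \<open>z \<noteq> 1\<close> because \<open>b - a\<close> is
  nonzero and smaller than \<open>D\<close> in absolute value.\<close>

lemma om_orthogonal:
  assumes ab: "a < D" "b < D"
  shows "(\<Sum>f<D. cnj (om D (f * a)) * om D (f * b)) = (if a = b then of_nat D else 0)"
proof (cases "a = b")
  case True
  thus ?thesis by (simp add: mult.commute[of "cnj _"] om_cnj_self)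
next
  case False
  define z where "z = cnj (om D a) * om D b"
  have D: "real D > 0" using ab by simp
  have zc: "z = cis (2 * pi * (real b - real a) / real D)"
    by (simp add: z_def om_def cis_cnj cis_mult diff_divide_distrib right_diff_distrib)
  have "z \<noteq> 1"
  proof
    assume "z = 1"
    hence "cos (2 * pi * (real b - real a) / real D) = 1" unfolding zc by (simp add: complex_eq_iff)
    then obtain n :: int where "2 * pi * (real b - real a) / real D = of_int n * 2 * pi" using cos_one_2pi_int by blast
    hence "(2 * pi) * (real b - real a) = (2 * pi) * (of_int n * real D)" using D by (simp add: field_simps)
    hence "real b - real a = of_int n * real D" by (subst (asm) mult_left_cancel) simp_all
    hence "of_int (int b - int a) = (of_int (n * int D) :: real)" by simp
    hence e: "int b - int a = n * int D" by (simp only: of_int_eq_iff)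
    have "\<bar>int b - int a\<bar> < int D" using ab by auto
    hence "\<bar>n\<bar> * int D < 1 * int D" unfolding e by (simp add: abs_mult)
    hence "\<bar>n\<bar> < 1" by (rule mult_right_less_imp_less) simp
    hence "n = 0" by simp
    thus False using e False by simp
  qed
  moreover have "z ^ D = 1"
  proof -
    have "om D a ^ D = 1" "om D b ^ D = 1" using D by (simp_all add: om_def DeMoivre cis_multiple_2pi)
    thus ?thesis by (simp add: z_def power_mult_distrib flip: complex_cnj_power)
  qed
  moreover have "(\<Sum>f<D. cnj (om D (f * a)) * om D (f * b)) = (\<Sum>f<D. z ^ f)"
    by (simp add: om_power z_def power_mult_distrib)
  ultimately show ?thesis using False by (simp add: geometric_sum)
qed

lemma shift_bij: "D > 0 \<Longrightarrow> bij_betw (\<lambda>a. (a + s) mod D) {..<D} {..<(D :: nat)}"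
proof -
  assume D: "D > 0"
  have *: "a \<ge> b" if "a < D" "b < D" "(a + s) mod D = (b + s) mod D" for a b
  proof (rule ccontr)
    assume ab: "\<not> b \<le> a"
    hence "D dvd (b + s) - (a + s)" using mod_eq_dvd_iff_nat[of "a + s" "b + s" D] that(3) by simp
    hence "D dvd b - a" by simp
    thus False using ab that by (auto dest: dvd_imp_le)
  qed
  have "inj_on (\<lambda>a. (a + s) mod D) {..<D}" by (rule inj_onI) (metis * lessThan_iff antisym)
  moreover have "(\<lambda>a. (a + s) mod D) ` {..<D} \<subseteq> {..<D}" using D by auto
  ultimately show ?thesis by (simp add: bij_betw_def endo_inj_surj)
qed


lemma const_list_shift:
  assumes "D > 0" "\<forall>t<length x. x ! t < D" "1 \<le> length x"
  shows "const_list (map (\<lambda>a. (a + s) mod D) x) \<longleftrightarrow> const_list x"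
proof
  assume "const_list (map (\<lambda>a. (a + s) mod D) x)"
  hence c: "map (\<lambda>a. (a + s) mod D) x = replicate (length x) (map (\<lambda>a. (a + s) mod D) x ! 0)"
    by (rule const_list_eq) (use assms in auto)
  have "x ! t = x ! 0" if t: "t < length x" for t
  proof -
    have z: "0 < length x" using t by linarith
    have e: "(x ! t + s) mod D = (x ! 0 + s) mod D"
      using arg_cong[OF c, of "\<lambda>l. l ! t"] t by (simp add: nth_map[OF z])
    have "x ! t \<in> {..<D}" "x ! 0 \<in> {..<D}" using assms(2) t z by blast+
    thus ?thesis by (rule inj_onD[OF bij_betw_imp_inj_on[OF shift_bij[OF assms(1), of s]] e])
  qed
  thus "const_list x" by (rule const_listI[OF refl])
next
  assume "const_list x"
  then obtain a where x: "x = replicate (length x) a" by (rule const_listE) (rule refl)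
  show "const_list (map (\<lambda>a. (a + s) mod D) x)" by (subst x) simp
qed

text \<open>Measure, then correct. Every outcome must lead, after its own correction, to the same
  kernel divided by the number \<open>D\<close> of outcomes; the branches then add up to that
  kernel.\<close>

lemma exact_measure:
  assumes j: "j < length d" and l: "length d' = length d" and dd: "\<forall>t<length d. t \<noteq> j \<longrightarrow> d' ! t = d ! t"
    and L: "\<And>s L. s < D \<Longrightarrow> L \<in> set (Lf s) \<Longrightarrow> L \<in> carrier_mat (d' ! j) (d ! j)"
    and c: "\<And>a b. a < d ! j \<Longrightarrow> b < d ! j \<Longrightarrow> (\<Sum>s<D. sum_list (map (\<lambda>L. (adj L * L) $$ (a, b)) (Lf s))) = (if a = b then 1 else 0)"
    and D: "D > (0 :: nat)"
    and br: "\<And>s. s < D \<Longrightarrow> exact d' (kmat d' d' (\<lambda>x x'. sum_list (map (\<lambda>L. \<Sum>a<d ! j. \<Sum>a'<d ! j.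
        L $$ (x ! j, a) * \<kappa> (x[j := a]) (x'[j := a']) * cnj (L $$ (x' ! j, a'))) (Lf s))))
        d'' (kmat d'' d'' (\<lambda>x y. \<kappa>' x y / of_nat D))"
  shows "exact d (kmat d d \<kappa>) d'' (kmat d'' d'' \<kappa>')"
proof -
  let ?Lss = "map Lf [0..<D]"
  let ?F = "map (map (lift_local d d' j)) ?Lss"
  have F: "locc_instr d d' ?F"
  proof (rule locc_instr.local[OF j l dd])
    show "\<forall>Ls\<in>set ?Lss. \<forall>L\<in>set Ls. L \<in> carrier_mat (d' ! j) (d ! j)" using L by auto
    show "\<forall>a<d ! j. \<forall>b<d ! j. sum_list (map (\<lambda>L. (adj L * L) $$ (a, b)) (concat ?Lss)) = (if a = b then 1 else 0)"
      using c by (simp add: sum_list_map_concat comp_def interv_sum_list_conv_sum_set_nat atLeast0LessThan del: index_mult_mat(1))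
  qed
  have "exact d (kmat d d \<kappa>) d'' (mat (prod_list d'') (prod_list d'') (\<lambda>(a, b). \<Sum>i<length ?F. kmat d'' d'' (\<lambda>x y. \<kappa>' x y / of_nat D) $$ (a, b)))"
  proof (rule exact_branch[OF F kmat_carrier])
    fix i assume i: "i < length ?F"
    have "?F ! i = map (lift_local d d' j) (Lf i)" using i by simp
    thus "exact d' (krs (prod_list d') (?F ! i) (kmat d d \<kappa>)) d'' (kmat d'' d'' (\<lambda>x y. \<kappa>' x y / of_nat D))"
      using br[of i] i krs_lift_local[OF j l dd, of "Lf i" \<kappa>] by simp
  qed
  moreover have "mat (prod_list d'') (prod_list d'') (\<lambda>(a, b). \<Sum>i<length ?F. kmat d'' d'' (\<lambda>x y. \<kappa>' x y / of_nat D) $$ (a, b)) = kmat d'' d'' \<kappa>'"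
    using D by (intro eq_matI) (simp_all add: kmat_def)
  ultimately show ?thesis by simp
qed

lemma sum_delta2:
  assumes "p < n" "p' < (n :: nat)"
  shows "(\<Sum>a<n. \<Sum>a'<n. (if a = p then v else 0) * g a a' * cnj (if a' = p' then v' else 0)) = v * g p p' * cnj v'"
proof -
  have "(\<Sum>a<n. \<Sum>a'<n. (if a = p then v else 0) * g a a' * cnj (if a' = p' then v' else 0))
    = (\<Sum>a<n. \<Sum>a'<n. if a' = p' then (if a = p then v * g a a' * cnj v' else 0) else 0)"
    by (intro sum.cong refl) auto
  thus ?thesis using assms by simp
qed

text \<open>On outcome \<open>s\<close>, party 0 maps \<open>|a + s>\<close> to
  \<open>v l a |a>\<close>, where \<open>v l\<close> is column \<open>l\<close> of the root of
  \<open>\<rho>\<close>; the sum over \<open>l\<close> within one outcome produces mixed states. The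
  other parties then undo the shift. The result carries \<open>\<rho>\<close>, read on its flat
  index, on the span of the vectors \<open>|a...a>\<close>.\<close>

lemma ghz_amplitude:
  assumes k: "1 \<le> k" and \<rho>: "psd N \<rho>" "mtrace \<rho> = 1" and D: "D > 0" "N \<le> D"
  defines "r \<equiv> replicate k D"
  shows "exact r (kmat r r (ghz_ker D)) r (kmat r r (\<lambda>x y. if const_list x \<and> const_list y \<and> x ! 0 < N \<and> y ! 0 < N then \<rho> $$ (x ! 0, y ! 0) else 0))"
proof -
  obtain S where S: "psd N S" "S * S = \<rho>" using psd_sqrt_exists[OF \<rho>(1)] .
  have Sc: "S \<in> carrier_mat N N" and Sh: "adj S = S" using S(1) psd_carrier psd_hermitian by auto
  define v where "v = (\<lambda>l a. if a < N then S $$ (a, l) else 0)"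
  define R where "R = (\<lambda>a b. if a < N \<and> b < N then \<rho> $$ (a, b) else 0)"
  define L where "L = (\<lambda>s l. mat D D (\<lambda>(a, b). if b = (a + s) mod D then v l a else 0))"
  define Lf where "Lf = (\<lambda>s. map (L s) [0..<N])"
  have sl: "sum_list (map f (Lf s)) = (\<Sum>l<N. f (L s l) :: complex)" for f s
    unfolding Lf_def map_map by (simp add: interv_sum_list_conv_sum_set_nat atLeast0LessThan)
  have r0: "r ! 0 = D" "0 < length r" using k by (simp_all add: r_def)
  have vv: "(\<Sum>l<N. v l a * cnj (v l b)) = R a b" for a b
  proof (cases "a < N \<and> b < N")
    case True
    have "(\<Sum>l<N. v l a * cnj (v l b)) = (S * adj S) $$ (a, b)"
      using True Sc by (simp add: v_def index_mult_sum del: index_mult_mat(1))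
    thus ?thesis using True by (simp add: R_def Sh S(2))
  qed (auto simp: v_def R_def)
  show ?thesis
  proof (rule exact_measure[where j = 0 and Lf = Lf and D = D and d' = r])
    show "L' \<in> carrier_mat (r ! 0) (r ! 0)" if "L' \<in> set (Lf s)" for s L'
      using that r0 by (auto simp: Lf_def L_def)
    fix b c assume "b < r ! 0" "c < r ! 0"
    hence bc: "b < D" "c < D" using r0 by auto
    \<comment> \<open>For fixed \<open>a\<close> exactly one shift leads to \<open>b\<close>, so
      summing over all outcomes weights each \<open>b\<close> with the full trace of
      \<open>\<rho>\<close>, which is 1.\<close>
    have one: "(\<Sum>s<D. if (a + s) mod D = b then w else 0) = (w :: complex)" for a w
      using sum.reindex_bij_betw[OF shift_bij[OF D(1), of a], of "\<lambda>t. if t = b then w else 0"] bc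
      by (simp add: add.commute)
    have "(\<Sum>s<D. sum_list (map (\<lambda>L. (adj L * L) $$ (b, c)) (Lf s))) = (\<Sum>s<D. \<Sum>l<N. \<Sum>a<D.
        if (a + s) mod D = b then (if b = c then v l a * cnj (v l a) else 0) else 0)"
      unfolding sl
    proof (intro sum.cong refl)
      fix s l
      have "(adj (L s l) * L s l) $$ (b, c) = (\<Sum>a<D. cnj (if b = (a + s) mod D then v l a else 0) * (if c = (a + s) mod D then v l a else 0))"
        using bc by (simp add: L_def index_mult_sum del: index_mult_mat(1))
      also have "\<dots> = (\<Sum>a<D. if (a + s) mod D = b then (if b = c then v l a * cnj (v l a) else 0) else 0)"
        by (rule sum.cong) auto
      finally show "(adj (L s l) * L s l) $$ (b, c) = \<dots>" .
    qed
    also have "\<dots> = (\<Sum>l<N. \<Sum>s<D. \<Sum>a<D.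
        if (a + s) mod D = b then (if b = c then v l a * cnj (v l a) else 0) else 0)"
      by (rule sum.swap)
    also have "\<dots> = (\<Sum>l<N. \<Sum>a<D. \<Sum>s<D.
        if (a + s) mod D = b then (if b = c then v l a * cnj (v l a) else 0) else 0)"
      by (intro sum.cong refl sum.swap)
    also have "\<dots> = (\<Sum>l<N. \<Sum>a<D. if b = c then v l a * cnj (v l a) else 0)"
      unfolding one ..
    also have "\<dots> = (\<Sum>a<D. \<Sum>l<N. if b = c then v l a * cnj (v l a) else 0)"
      by (rule sum.swap)
    also have "\<dots> = (\<Sum>a<D. if b = c then R a a else 0)"
      by (intro sum.cong refl) (simp add: vv)
    also have "\<dots> = (if b = c then (\<Sum>a<D. R a a) else 0)" by simp
    also have "(\<Sum>a<D. R a a) = (\<Sum>a<N. \<rho> $$ (a, a))"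
      by (rule sum.mono_neutral_cong_right) (use D in \<open>auto simp: R_def\<close>)
    also have "\<dots> = 1" using \<rho>(2) psd_carrier[OF \<rho>(1)] by (simp add: mtrace_def)
    finally show "(\<Sum>s<D. sum_list (map (\<lambda>L. (adj L * L) $$ (b, c)) (Lf s))) = (if b = c then 1 else 0)" .
  next
    fix s assume s: "s < D"
    let ?sh = "\<lambda>a. (a + s) mod D"
    define \<kappa>s where "\<kappa>s = (\<lambda>x x'. R (x ! 0) (x' ! 0) * ghz_ker D (x[0 := ?sh (x ! 0)]) (x'[0 := ?sh (x' ! 0)]))"
    have e1: "kmat r r (\<lambda>x x'. sum_list (map (\<lambda>L. \<Sum>a<r ! 0. \<Sum>a'<r ! 0.
        L $$ (x ! 0, a) * ghz_ker D (x[0 := a]) (x'[0 := a']) * cnj (L $$ (x' ! 0, a'))) (Lf s))) = kmat r r \<kappa>s"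
    proof (rule kmat_cong)
      fix x x' assume "x \<in> idx r" "x' \<in> idx r"
      hence xx: "x ! 0 < D" "x' ! 0 < D" using k by (auto simp: r_def idx_replicate)
      have "sum_list (map (\<lambda>L. \<Sum>a<r ! 0. \<Sum>a'<r ! 0. L $$ (x ! 0, a) * ghz_ker D (x[0 := a]) (x'[0 := a']) * cnj (L $$ (x' ! 0, a'))) (Lf s))
        = (\<Sum>l<N. \<Sum>a<D. \<Sum>a'<D. (if a = ?sh (x ! 0) then v l (x ! 0) else 0) * ghz_ker D (x[0 := a]) (x'[0 := a'])
            * cnj (if a' = ?sh (x' ! 0) then v l (x' ! 0) else 0))"
        unfolding sl r0 using xx by (intro sum.cong refl) (simp add: L_def)
      also have "\<dots> = (\<Sum>l<N. v l (x ! 0) * ghz_ker D (x[0 := ?sh (x ! 0)]) (x'[0 := ?sh (x' ! 0)]) * cnj (v l (x' ! 0)))"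
        using D by (intro sum.cong refl sum_delta2) auto
      also have "\<dots> = (\<Sum>l<N. v l (x ! 0) * cnj (v l (x' ! 0))) * ghz_ker D (x[0 := ?sh (x ! 0)]) (x'[0 := ?sh (x' ! 0)])"
        unfolding sum_distrib_right by (intro sum.cong refl) (simp add: ac_simps)
      finally show "sum_list (map (\<lambda>L. \<Sum>a<r ! 0. \<Sum>a'<r ! 0. L $$ (x ! 0, a) * ghz_ker D (x[0 := a]) (x'[0 := a']) * cnj (L $$ (x' ! 0, a'))) (Lf s)) = \<kappa>s x x'"
        unfolding vv \<kappa>s_def .
    qed
    define \<tau> where "\<tau> = (\<lambda>(t :: nat) a. if t = 0 then a else ?sh a)"
    define T where "T = (\<lambda>x. map (\<lambda>t. \<tau> t (x ! t)) [0..<length r])"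
    have "exact r (kmat r r \<kappa>s) r (kmat r r (\<lambda>x y. (\<Prod>t<length r. 1) * cnj (\<Prod>t<length r. 1) * \<kappa>s (T x) (T y)))"
      unfolding T_def
    proof (rule exact_monomial[where c = "\<lambda>_ _. 1"])
      show "r \<noteq> []" using k by (auto simp: r_def)
      fix t assume "t < length r"
      hence "r ! t = D" by (simp add: r_def)
      thus "bij_betw (\<tau> t) {..<r ! t} {..<r ! t}"
        using shift_bij[OF D(1), of s] bij_betw_id[of "{..<D}"] by (cases "t = 0") (simp_all add: \<tau>_def id_def)
    qed simp
    moreover have "kmat r r (\<lambda>x y. (\<Prod>t<length r. 1) * cnj (\<Prod>t<length r. 1) * \<kappa>s (T x) (T y))
      = kmat r r (\<lambda>x y. (if const_list x \<and> const_list y \<and> x ! 0 < N \<and> y ! 0 < N then \<rho> $$ (x ! 0, y ! 0) else 0) / of_nat D)"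
    proof (rule kmat_cong)
      fix x y assume xy: "x \<in> idx r" "y \<in> idx r"
      have T: "T z ! 0 = z ! 0" "const_list ((T z)[0 := ?sh (T z ! 0)]) \<longleftrightarrow> const_list z" if z: "z \<in> idx r" for z
      proof -
        have lz: "length z = k" "\<forall>t<k. z ! t < D" using z by (auto simp: r_def idx_replicate)
        show t0: "T z ! 0 = z ! 0" using k by (simp add: T_def \<tau>_def r_def)
        have "(T z)[0 := ?sh (T z ! 0)] = map ?sh z"
          unfolding t0 using lz k by (intro nth_equalityI) (auto simp: T_def \<tau>_def r_def nth_list_update)
        thus "const_list ((T z)[0 := ?sh (T z ! 0)]) \<longleftrightarrow> const_list z"
          using const_list_shift[OF D(1), of z s] lz k by simp
      qed
      show "(\<Prod>t<length r. 1) * cnj (\<Prod>t<length r. 1) * \<kappa>s (T x) (T y)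
        = (if const_list x \<and> const_list y \<and> x ! 0 < N \<and> y ! 0 < N then \<rho> $$ (x ! 0, y ! 0) else 0) / of_nat D"
        unfolding \<kappa>s_def ghz_ker_def using T[OF xy(1)] T[OF xy(2)] by (simp add: R_def)
    qed
    ultimately show "exact r (kmat r r (\<lambda>x x'. sum_list (map (\<lambda>L. \<Sum>a<r ! 0. \<Sum>a'<r ! 0.
        L $$ (x ! 0, a) * ghz_ker D (x[0 := a]) (x'[0 := a']) * cnj (L $$ (x' ! 0, a'))) (Lf s))))
        r (kmat r r (\<lambda>x y. (if const_list x \<and> const_list y \<and> x ! 0 < N \<and> y ! 0 < N then \<rho> $$ (x ! 0, y ! 0) else 0) / of_nat D))"
      unfolding e1 by simp
  qed (use r0 D in auto)
qed

section \<open>Erasing surplus digits by Fourier measurements\<close>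

lemma encode_eq_sum:
  "length x = length d \<Longrightarrow> encode d x = (\<Sum>t<length d. x ! t * prod_list (drop (Suc t) d))"
proof (induction d arbitrary: x)
  case (Cons a d)
  then obtain y ys where x: "x = y # ys" "length ys = length d" by (cases x) auto
  show ?case using Cons.IH[OF x(2)] by (simp add: x sum.lessThan_Suc_shift del: sum.lessThan_Suc)
qed simp

text \<open>Together with the place-value expansion of \<open>encode\<close>, this splits the phase
  of an index into phases of its digits.\<close>

lemma om_sum: "finite S \<Longrightarrow> om D (\<Sum>t\<in>S. h t) = (\<Prod>t\<in>S. om D (h t))"
proof (induction rule: finite_induct)
  case empty
  show ?case by (simp add: om_def)
next
  case (insert t S)
  thus ?case by (simp add: om_add)
qed

lemma sum_bilinear_swap:
  "(\<Sum>u<n. \<Sum>u'<n. p u * (\<Sum>a<N. \<Sum>b<N. r a b * i u a * i' u' b) * q u')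
    = (\<Sum>a<N. \<Sum>b<N. r a b * (\<Sum>u<n. p u * i u a) * (\<Sum>u'<n. q u' * i' u' b :: complex))"
  for n N :: nat
proof -
  let ?t = "\<lambda>u u' a b. p u * (r a b * i u a * i' u' b) * q u'"
  have "(\<Sum>u<n. \<Sum>u'<n. p u * (\<Sum>a<N. \<Sum>b<N. r a b * i u a * i' u' b) * q u') = (\<Sum>u<n. \<Sum>u'<n. \<Sum>a<N. \<Sum>b<N. ?t u u' a b)"
    by (simp add: sum_distrib_left sum_distrib_right)
  also have "\<dots> = (\<Sum>u<n. \<Sum>a<N. \<Sum>u'<n. \<Sum>b<N. ?t u u' a b)"
    by (intro sum.cong refl sum.swap)
  also have "\<dots> = (\<Sum>a<N. \<Sum>u<n. \<Sum>b<N. \<Sum>u'<n. ?t u u' a b)"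
    by (subst sum.swap) (intro sum.cong refl sum.swap)
  also have "\<dots> = (\<Sum>a<N. \<Sum>b<N. \<Sum>u<n. \<Sum>u'<n. ?t u u' a b)"
    by (intro sum.cong refl sum.swap)
  also have "\<dots> = (\<Sum>a<N. \<Sum>b<N. r a b * (\<Sum>u<n. p u * i u a) * (\<Sum>u'<n. q u' * i' u' b))"
    by (intro sum.cong refl) (simp add: sum_distrib_left sum_distrib_right ac_simps)
  finally show ?thesis .
qed

text \<open>In the following locale the parties \<open>t < j\<close> already hold only their own digit of the shared
  basis index \<open>a\<close>, while the others still hold all of \<open>a\<close>. Party \<open>j\<close> measures its index in the
  Fourier basis, which keeps its own digit; since \<open>a\<close> is a weighted sum of digits, the resulting
  phase \<open>\<omega>\<^sup>f\<^sup>a\<close> is a product of phases, each of which one party can undo locally.\<close>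

locale erasure =
  fixes k D :: nat and d :: "nat list" and \<rho> :: "complex mat"
  assumes k: "1 \<le> k" and len: "length d = k" and N0: "0 < prod_list d" and ND: "prod_list d \<le> D"
begin

definition dims :: "nat \<Rightarrow> nat list" where
  "dims j = map (\<lambda>t. if t < j then d ! t else D) [0..<k]"

definition held :: "nat \<Rightarrow> nat \<Rightarrow> nat list" where
  "held j a = map (\<lambda>t. if t < j then decode d a ! t else a) [0..<k]"

text \<open>The matrix \<open>\<rho>\<close> written in the basis of the vectors labelled by
  \<open>held j a\<close>. At \<open>j = 0\<close> it is the output of \<open>ghz_amplitude\<close>,
  at \<open>j = k\<close> it is \<open>\<rho>\<close> itself.\<close>

definition glued :: "nat \<Rightarrow> nat list \<Rightarrow> nat list \<Rightarrow> complex" where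
  "glued j x y = (\<Sum>a<prod_list d. \<Sum>b<prod_list d. \<rho> $$ (a, b) * (if x = held j a then 1 else 0) * (if y = held j b then 1 else 0))"

lemma digit_less: "a < prod_list d \<Longrightarrow> t < k \<Longrightarrow> decode d a ! t < d ! t"
  using decode_idx[of a d] len by (auto simp: idx_iff)

lemma dim_pos: "t < k \<Longrightarrow> 0 < d ! t"
  using digit_less[of 0 t] N0 by linarith

lemma erase_step:
  assumes j: "j < k"
  shows "exact (dims j) (kmat (dims j) (dims j) (glued j)) (dims (Suc j)) (kmat (dims (Suc j)) (dims (Suc j)) (glued (Suc j)))"
proof -
  let ?N = "prod_list d"
  have D0: "D > 0" using N0 ND by simp
  \<comment> \<open>Indices from \<open>?N\<close> on carry no amplitude; the digit 0 assigned to
    them only serves completeness of the measurement on all \<open>D\<close> levels.\<close>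
  define h where "h = (\<lambda>a. if a < ?N then decode d a ! j else 0)"
  have h: "h a < d ! j" for a using digit_less[OF _ j] dim_pos[OF j] by (simp add: h_def)
  define sD where "sD = complex_of_real (sqrt (real D))"
  have sD: "sD * sD = of_nat D" "cnj sD = sD" "sD \<noteq> 0" using D0 by (simp_all add: sD_def flip: of_real_mult)
  \<comment> \<open>Outcome \<open>f\<close> imprints the Fourier phase of \<open>a\<close> and
    keeps the own digit coherently. The factor \<open>1 / sD\<close> makes the \<open>D\<close>
    outcomes complete.\<close>
  define L where "L = (\<lambda>f. mat (d ! j) D (\<lambda>(c, a). if c = h a then om D (f * a) / sD else 0))"
  have dj: "dims j ! j = D" "dims (Suc j) ! j = d ! j" and ld: "length (dims i) = k" for i
    using j by (simp_all add: dims_def)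
  show ?thesis
  proof (rule exact_measure[where j = j and Lf = "\<lambda>f. [L f]" and D = D and d' = "dims (Suc j)"])
    show "j < length (dims j)" "length (dims (Suc j)) = length (dims j)" using j by (simp_all add: ld)
    show "\<forall>t<length (dims j). t \<noteq> j \<longrightarrow> dims (Suc j) ! t = dims j ! t"
      by (auto simp: dims_def)
    show "L' \<in> carrier_mat (dims (Suc j) ! j) (dims j ! j)" if "L' \<in> set [L f]" for f L'
      using that by (auto simp: L_def dj)
    show "D > 0" by (rule D0)
    fix a b assume "a < dims j ! j" "b < dims j ! j"
    hence ab: "a < D" "b < D" by (simp_all add: dj)
    have 1: "(adj (L f) * L f) $$ (a, b) = (if h a = h b then cnj (om D (f * a)) * om D (f * b) / of_nat D else 0)" for f
    proof -
      have "(adj (L f) * L f) $$ (a, b) = (\<Sum>c<d ! j. cnj (if c = h a then om D (f * a) / sD else 0) * (if c = h b then om D (f * b) / sD else 0))"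
        using ab by (simp add: L_def index_mult_sum del: index_mult_mat(1))
      also have "\<dots> = (\<Sum>c<d ! j. if c = h a then (if h a = h b then cnj (om D (f * a)) * om D (f * b) / of_nat D else 0) else 0)"
        using sD by (intro sum.cong refl) auto
      finally show ?thesis using h[of a] by simp
    qed
    have "(\<Sum>f<D. sum_list (map (\<lambda>L. (adj L * L) $$ (a, b)) [L f])) = (\<Sum>f<D. if h a = h b then cnj (om D (f * a)) * om D (f * b) / of_nat D else 0)"
      by (simp add: 1 del: index_mult_mat(1))
    also have "\<dots> = (if h a = h b then (\<Sum>f<D. cnj (om D (f * a)) * om D (f * b)) / of_nat D else 0)"
      by (simp add: sum_divide_distrib)
    also have "\<dots> = (if a = b then 1 else 0)"
      unfolding om_orthogonal[OF ab] using D0 by auto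
    finally show "(\<Sum>f<D. sum_list (map (\<lambda>L. (adj L * L) $$ (a, b)) [L f])) = (if a = b then 1 else 0)" .
  next
    fix f assume "f < D"
    let ?d = "dims (Suc j)"
    define ph where "ph = (\<lambda>a x. om D (f * a) / sD * (if x = held (Suc j) a then 1 else 0))"
    define \<kappa>f where "\<kappa>f = (\<lambda>x y. \<Sum>a<?N. \<Sum>b<?N. \<rho> $$ (a, b) * ph a x * cnj (ph b y))"
    have single: "(\<Sum>u<D. L f $$ (x ! j, u) * (if x[j := u] = held j a then 1 else 0)) = ph a x"
      if x: "x \<in> idx ?d" and a: "a < ?N" for x a
    proof -
      have lx: "length x = k" "x ! j < d ! j" using x j dj by (auto simp: idx_iff ld)
      have "(\<Sum>u<D. L f $$ (x ! j, u) * (if x[j := u] = held j a then 1 else 0))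
        = (\<Sum>u<D. if u = a then L f $$ (x ! j, a) * (if x[j := a] = held j a then 1 else 0) else 0)"
      proof (rule sum.cong)
        fix u
        have "u = a" if "x[j := u] = held j a"
          using arg_cong[OF that, of "\<lambda>l. l ! j"] lx j by (simp add: held_def)
        thus "L f $$ (x ! j, u) * (if x[j := u] = held j a then 1 else 0)
          = (if u = a then L f $$ (x ! j, a) * (if x[j := a] = held j a then 1 else 0) else 0)" by auto
      qed simp
      also have "\<dots> = L f $$ (x ! j, a) * (if x[j := a] = held j a then 1 else 0)" using a ND by simp
      also have "\<dots> = (if x ! j = h a \<and> x[j := a] = held j a then om D (f * a) / sD else 0)"
        using lx a ND by (simp add: L_def)
      also have "x ! j = h a \<and> x[j := a] = held j a \<longleftrightarrow> x = held (Suc j) a"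
      proof
        assume e: "x ! j = h a \<and> x[j := a] = held j a"
        show "x = held (Suc j) a"
        proof (rule nth_equalityI)
          fix t assume t: "t < length x"
          show "x ! t = held (Suc j) a ! t"
          proof (cases "t = j")
            case True
            thus ?thesis using e a j by (simp add: held_def h_def)
          next
            case False
            have "x ! t = x[j := a] ! t" using False by simp
            also have "\<dots> = held j a ! t" using e by simp
            finally show ?thesis using t lx False by (simp add: held_def)
          qed
        qed (simp add: lx held_def)
      next
        assume e: "x = held (Suc j) a"
        show "x ! j = h a \<and> x[j := a] = held j a"
          using a j unfolding e by (auto simp: held_def h_def nth_list_update intro!: nth_equalityI)
      qed
      finally show ?thesis by (simp add: ph_def)
    qed
    have e1: "kmat ?d ?d (\<lambda>x x'. sum_list (map (\<lambda>L. \<Sum>a<dims j ! j. \<Sum>a'<dims j ! j.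
        L $$ (x ! j, a) * glued j (x[j := a]) (x'[j := a']) * cnj (L $$ (x' ! j, a'))) [L f])) = kmat ?d ?d \<kappa>f"
    proof (rule kmat_cong)
      fix x x' assume x: "x \<in> idx ?d" and x': "x' \<in> idx ?d"
      have c: "(\<Sum>u<D. cnj (L f $$ (x' ! j, u)) * (if x'[j := u] = held j b then 1 else 0)) = cnj (ph b x')" if "b < ?N" for b
        unfolding single[OF x' that, symmetric] cnj_sum by (intro sum.cong refl) simp
      have "sum_list (map (\<lambda>L. \<Sum>a<dims j ! j. \<Sum>a'<dims j ! j.
          L $$ (x ! j, a) * glued j (x[j := a]) (x'[j := a']) * cnj (L $$ (x' ! j, a'))) [L f])
        = (\<Sum>u<D. \<Sum>u'<D. L f $$ (x ! j, u) * glued j (x[j := u]) (x'[j := u']) * cnj (L f $$ (x' ! j, u')))"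
        by (simp add: dj)
      also have "\<dots> = \<kappa>f x x'"
        unfolding glued_def sum_bilinear_swap \<kappa>f_def using single[OF x] c by (intro sum.cong refl) auto
      finally show "sum_list (map (\<lambda>L. \<Sum>a<dims j ! j. \<Sum>a'<dims j ! j.
          L $$ (x ! j, a) * glued j (x[j := a]) (x'[j := a']) * cnj (L $$ (x' ! j, a'))) [L f]) = \<kappa>f x x'" .
    qed
    define w where "w = (\<lambda>t. prod_list (drop (Suc t) d))"
    \<comment> \<open>Each party cancels the share of the phase that belongs to its own place value.
      Parties up to \<open>j\<close> hold just their digit; later parties still hold the whole index
      and read digit \<open>t\<close> off it.\<close>
    define c where "c = (\<lambda>t u. cnj (om D (f * (if t < Suc j then u * w t else decode d u ! t * w t))))"
    define C where "C = (\<lambda>x. \<Prod>t<length ?d. c t (x ! t))"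
    define T where "T = (\<lambda>x. map (\<lambda>t. id (x ! t :: nat)) [0..<length ?d])"
    have "exact ?d (kmat ?d ?d \<kappa>f) ?d (kmat ?d ?d (\<lambda>x y. C x * cnj (C y) * \<kappa>f (T x) (T y)))"
      unfolding C_def T_def
    proof (rule exact_monomial[where \<tau> = "\<lambda>_. id"])
      show "?d \<noteq> []" using k ld[of "Suc j"] by auto
      show "cmod (c t a) = 1" for t a by (simp add: c_def)
    qed simp
    moreover have "kmat ?d ?d (\<lambda>x y. C x * cnj (C y) * \<kappa>f (T x) (T y)) = kmat ?d ?d (\<lambda>x y. glued (Suc j) x y / of_nat D)"
    proof (rule kmat_cong)
      fix x y assume x: "x \<in> idx ?d" and y: "y \<in> idx ?d"
      have T: "T z = z" if "z \<in> idx ?d" for z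
        unfolding T_def id_apply idx_length[OF that, symmetric] by (rule map_nth)
      have Ch: "C (held (Suc j) a) = cnj (om D (f * a))" if a: "a < ?N" for a
      proof -
        have "C (held (Suc j) a) = (\<Prod>t<k. cnj (om D (f * (decode d a ! t * w t))))"
          unfolding C_def ld c_def by (intro prod.cong refl) (auto simp: held_def)
        also have "\<dots> = cnj (om D (\<Sum>t<k. f * (decode d a ! t * w t)))"
          by (simp add: om_sum)
        also have "(\<Sum>t<k. f * (decode d a ! t * w t)) = f * encode d (decode d a)"
          using encode_eq_sum[of "decode d a" d] idx_length[OF decode_idx[OF a]] len by (simp add: w_def sum_distrib_left)
        finally show ?thesis using a by (simp add: encode_decode)
      qed
      have Cp: "C z * ph a z = (if z = held (Suc j) a then 1 else 0) / sD" if "a < ?N" for a z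
        using Ch[OF that] om_cnj_self[of D "f * a"] by (auto simp: ph_def mult.commute)
      have "C x * cnj (C y) * \<kappa>f (T x) (T y) = (\<Sum>a<?N. \<Sum>b<?N. \<rho> $$ (a, b) * (C x * ph a x) * cnj (C y * ph b y))"
        unfolding T[OF x] T[OF y] \<kappa>f_def sum_distrib_left by (intro sum.cong refl) (simp add: ac_simps)
      also have "\<dots> = (\<Sum>a<?N. \<Sum>b<?N. \<rho> $$ (a, b) * (if x = held (Suc j) a then 1 else 0) * (if y = held (Suc j) b then 1 else 0) / of_nat D)"
        by (intro sum.cong refl) (auto simp: Cp sD)
      also have "\<dots> = glued (Suc j) x y / of_nat D"
        by (simp add: glued_def sum_divide_distrib)
      finally show "C x * cnj (C y) * \<kappa>f (T x) (T y) = glued (Suc j) x y / of_nat D" .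
    qed
    ultimately show "exact ?d (kmat ?d ?d (\<lambda>x x'. sum_list (map (\<lambda>L. \<Sum>a<dims j ! j. \<Sum>a'<dims j ! j.
        L $$ (x ! j, a) * glued j (x[j := a]) (x'[j := a']) * cnj (L $$ (x' ! j, a'))) [L f])))
        ?d (kmat ?d ?d (\<lambda>x y. glued (Suc j) x y / of_nat D))"
      unfolding e1 by simp
  qed
qed

lemma erase_all: "j \<le> k \<Longrightarrow> exact (dims 0) (kmat (dims 0) (dims 0) (glued 0)) (dims j) (kmat (dims j) (dims j) (glued j))"
proof (induction j)
  case 0
  have "dims 0 \<noteq> []" using k by (simp add: dims_def)
  thus ?case using exact_refl kmat_carrier by blast
next
  case (Suc j)
  thus ?case using exact_trans[OF _ erase_step kmat_carrier] by simp
qed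

lemma glued_final:
  assumes "\<rho> \<in> carrier_mat (prod_list d) (prod_list d)"
  shows "dims k = d" "kmat d d (glued k) = \<rho>"
proof -
  show "dims k = d" unfolding dims_def using len by (intro nth_equalityI) auto
  have held: "held k a = decode d a" if "a < prod_list d" for a
    unfolding held_def using idx_length[OF decode_idx[OF that]] len by (intro nth_equalityI) auto
  have "kmat d d (glued k) = kmat d d (\<lambda>x y. \<rho> $$ (encode d x, encode d y))"
  proof (rule kmat_cong)
    fix x y assume x: "x \<in> idx d" and y: "y \<in> idx d"
    have eq: "z = held k a \<longleftrightarrow> a = encode d z" if "z \<in> idx d" "a < prod_list d" for z a
      using held[OF that(2)] decode_encode[OF that(1)] encode_decode[OF that(2)] by auto
    have "glued k x y = (\<Sum>a<prod_list d. \<Sum>b<prod_list d. if b = encode d y then (if a = encode d x then \<rho> $$ (a, b) else 0) else 0)"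
      unfolding glued_def using eq[OF x] eq[OF y] by (intro sum.cong refl) auto
    thus "glued k x y = \<rho> $$ (encode d x, encode d y)" using encode_less[OF x] encode_less[OF y] by simp
  qed
  thus "kmat d d (glued k) = \<rho>" using kmat_ker[OF assms] by simp
qed

lemma glued_initial:
  "dims 0 = replicate k D"
  "kmat (replicate k D) (replicate k D) (glued 0) = kmat (replicate k D) (replicate k D)
    (\<lambda>x y. if const_list x \<and> const_list y \<and> x ! 0 < prod_list d \<and> y ! 0 < prod_list d then \<rho> $$ (x ! 0, y ! 0) else 0)"
proof -
  show "dims 0 = replicate k D" by (simp add: dims_def map_replicate_trivial)
  show "kmat (replicate k D) (replicate k D) (glued 0) = kmat (replicate k D) (replicate k D)
    (\<lambda>x y. if const_list x \<and> const_list y \<and> x ! 0 < prod_list d \<and> y ! 0 < prod_list d then \<rho> $$ (x ! 0, y ! 0) else 0)"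
  proof (rule kmat_cong)
    fix x y assume x: "x \<in> idx (replicate k D)" and y: "y \<in> idx (replicate k D)"
    have h0: "held 0 a = replicate k a" for a by (simp add: held_def map_replicate_trivial)
    have eq: "z = held 0 a \<longleftrightarrow> const_list z \<and> a = z ! 0" if "z \<in> idx (replicate k D)" for z a
    proof -
      have lz: "length z = k" using that by (simp add: idx_replicate)
      show ?thesis unfolding h0
      proof
        assume e: "z = replicate k a"
        show "const_list z \<and> a = z ! 0" unfolding e using k by simp
      next
        assume "const_list z \<and> a = z ! 0"
        thus "z = replicate k a" using const_list_eq[OF _ lz k] by blast
      qed
    qed
    have "glued 0 x y = (\<Sum>a<prod_list d. \<Sum>b<prod_list d. if b = y ! 0 then (if a = x ! 0 then (if const_list x \<and> const_list y then \<rho> $$ (a, b) else 0) else 0) else 0)"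
      unfolding glued_def using eq[OF x] eq[OF y] by (intro sum.cong refl) auto
    also have "\<dots> = (if const_list x \<and> const_list y \<and> x ! 0 < prod_list d \<and> y ! 0 < prod_list d then \<rho> $$ (x ! 0, y ! 0) else 0)"
      by (cases "y ! 0 < prod_list d") simp_all
    finally show "glued 0 x y = (if const_list x \<and> const_list y \<and> x ! 0 < prod_list d \<and> y ! 0 < prod_list d then \<rho> $$ (x ! 0, y ! 0) else 0)" .
  qed
qed

end

theorem ex_conv_GHZ:
  assumes k: "1 \<le> k" and \<rho>: "kstate k \<rho>"
  shows "\<exists>n. ex_conv (tpow (GHZ k) n) \<rho>"
proof -
  let ?d = "fst \<rho>"
  \<comment> \<open>A generous choice: only \<open>prod_list ?d \<le> 2 ^ n\<close> matters.\<close>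
  define n where "n = prod_list ?d"
  define D where "D = (2 :: nat) ^ n"
  let ?r = "replicate k D"
  have D: "D > 0" "prod_list ?d \<le> D" using less_exp[of n] by (simp_all add: D_def n_def)
  interpret erasure k D ?d "snd \<rho>" by unfold_locales (use k kstateD[OF \<rho>] D in auto)
  have "exact ?r (kmat ?r ?r (ghz_ker D)) ?r (kmat ?r ?r (glued 0))"
    unfolding glued_initial(2) by (rule ghz_amplitude[OF k kstateD(2,3)[OF \<rho>] D])
  moreover have "exact ?r (kmat ?r ?r (glued 0)) ?d (snd \<rho>)"
    using erase_all[of k] glued_final[OF kstateD(4)[OF \<rho>]] glued_initial(1) by simp
  ultimately have "exact ?r (kmat ?r ?r (ghz_ker D)) ?d (snd \<rho>)"
    using exact_trans kmat_carrier by blast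
  thus ?thesis unfolding ex_conv_def using GHZ_tpow[OF k, of n] by (intro exI[of _ n]) (simp add: D_def)
qed

subsection \<open>Asymptotic conversion of sequences of states\<close>

definition conv :: "kstate \<Rightarrow> kstate \<Rightarrow> real \<Rightarrow> bool" where
  "conv \<rho> \<sigma> c \<longleftrightarrow> (\<exists>Ks. locc_instr (fst \<rho>) (fst \<sigma>) Ks \<and>
     fid_ge (prod_list (fst \<sigma>)) (apply_instr (fst \<sigma>) Ks (snd \<rho>)) (snd \<sigma>) c)"

lemma conv_if_ex_conv:
  assumes \<sigma>: "kstate k \<sigma>" and "ex_conv \<rho> \<sigma>" "c \<le> 1"
  shows "conv \<rho> \<sigma> c"
proof -
  obtain Ks where Ks: "locc_instr (fst \<rho>) (fst \<sigma>) Ks" "apply_instr (fst \<sigma>) Ks (snd \<rho>) = snd \<sigma>"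
    using assms(2) by (auto simp: ex_conv_def exact_def)
  show ?thesis unfolding conv_def
    by (rule exI[of _ Ks]) (use Ks fid_ge_mono[OF fid_ge_refl[OF kstateD(2,3)[OF \<sigma>]] assms(3)] in simp)
qed

text \<open>The second protocol runs on the imperfect output of the first. Kraus maps keep the first
  fidelity bound, and \<open>fid_ge_triangle\<close> joins it to the second. A first loss of
  \<open>\<eta>\<^sup>2 / 2\<close> ends up as \<open>\<eta>\<close>, which is harmless in a
  limit.\<close>

lemma conv_trans:
  assumes \<rho>: "kstate k \<rho>" and \<sigma>: "kstate k \<sigma>" and \<tau>: "kstate k \<tau>"
    and 1: "conv \<rho> \<sigma> (1 - \<eta>\<^sup>2 / 2)" and 2: "conv \<sigma> \<tau> (1 - \<zeta>)" and \<eta>: "\<eta> > 0"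
  shows "conv \<rho> \<tau> (1 - \<zeta> - \<eta>)"
proof -
  obtain Ks where Ks: "locc_instr (fst \<rho>) (fst \<sigma>) Ks"
    "fid_ge (prod_list (fst \<sigma>)) (apply_instr (fst \<sigma>) Ks (snd \<rho>)) (snd \<sigma>) (1 - \<eta>\<^sup>2 / 2)"
    using 1 by (auto simp: conv_def)
  obtain Ls where Ls: "locc_instr (fst \<sigma>) (fst \<tau>) Ls"
    "fid_ge (prod_list (fst \<tau>)) (apply_instr (fst \<tau>) Ls (snd \<sigma>)) (snd \<tau>) (1 - \<zeta>)"
    using 2 by (auto simp: conv_def)
  let ?A = "apply_instr (fst \<sigma>) Ks (snd \<rho>)"
  obtain Ms where Ms: "locc_instr (fst \<rho>) (fst \<tau>) Ms" "apply_instr (fst \<tau>) Ms (snd \<rho>) = apply_instr (fst \<tau>) Ls ?A"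
    using locc_compose[OF Ks(1) Ls(1)] kstateD(4)[OF \<rho>] by blast
  note kL = locc_kraus[OF Ls(1)] and kK = locc_kraus[OF Ks(1)]
  have trA: "mtrace ?A = 1"
    using krs_trace[OF kK kstateD(4)[OF \<rho>]] kstateD(3)[OF \<rho>] by (simp add: apply_instr_krs)
  have "fid_ge (prod_list (fst \<tau>)) (apply_instr (fst \<tau>) Ls ?A) (apply_instr (fst \<tau>) Ls (snd \<sigma>)) (1 - \<eta>\<^sup>2 / 2)"
    using krs_fid_ge[OF kL Ks(2)] by (simp add: apply_instr_krs)
  moreover have "mtrace (apply_instr (fst \<tau>) Ls ?A) = 1"
    using krs_trace[OF kL apply_instr_carrier, of Ks "snd \<rho>"] trA by (simp add: apply_instr_krs)
  moreover have "mtrace (apply_instr (fst \<tau>) Ls (snd \<sigma>)) = 1"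
    using krs_trace[OF kL kstateD(4)[OF \<sigma>]] kstateD(3)[OF \<sigma>] by (simp add: apply_instr_krs)
  ultimately have "fid_ge (prod_list (fst \<tau>)) (apply_instr (fst \<tau>) Ls ?A) (snd \<tau>) (1 - \<zeta> - \<eta>)"
    using fid_ge_triangle[OF _ Ls(2) \<eta>] kstateD(3)[OF \<tau>] by blast
  thus ?thesis unfolding conv_def using Ms by metis
qed

text \<open>The protocol acts beside an idle \<open>\<tau>\<close>, and adjoining
  \<open>\<tau>\<close> is itself a Kraus map, so the fidelity bound is kept without loss.\<close>

lemma conv_tensor_right:
  assumes \<rho>: "kstate k \<rho>" and \<sigma>: "kstate k \<sigma>" and \<tau>: "kstate k \<tau>" and c: "conv \<rho> \<sigma> c"
  shows "conv (tensor_st \<rho> \<tau>) (tensor_st \<sigma> \<tau>) c"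
proof -
  let ?d = "fst \<rho>" and ?d' = "fst \<sigma>" and ?e = "fst \<tau>"
  obtain Ks where Ks: "locc_instr ?d ?d' Ks" "fid_ge (prod_list ?d') (apply_instr ?d' Ks (snd \<rho>)) (snd \<sigma>) c"
    using c by (auto simp: conv_def)
  have l: "length ?e = length ?d" "length ?d' = length ?e" using kstateD(1) \<rho> \<sigma> \<tau> by metis+
  obtain Ms where Ms: "locc_instr (pmul ?d ?e) (pmul ?d' ?e) Ms"
    "apply_instr (pmul ?d' ?e) Ms (tens ?d ?e (snd \<rho>) (snd \<tau>)) = tens ?d' ?e (apply_instr ?d' Ks (snd \<rho>)) (snd \<tau>)"
    using locc_tensor[OF Ks(1) kstateD(5)[OF \<rho>] l(1)] kstateD(4)[OF \<rho>] by blast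
  obtain Ts where Ts: "kraus (prod_list ?d') (prod_list (pmul ?d' ?e)) Ts"
    "\<And>A. A \<in> carrier_mat (prod_list ?d') (prod_list ?d') \<Longrightarrow> krs (prod_list (pmul ?d' ?e)) Ts A = tens ?d' ?e A (snd \<tau>)"
    using ancilla_kraus[OF l(2) kstateD(2,3)[OF \<tau>]] by blast
  have "fid_ge (prod_list (pmul ?d' ?e)) (tens ?d' ?e (apply_instr ?d' Ks (snd \<rho>)) (snd \<tau>)) (tens ?d' ?e (snd \<sigma>) (snd \<tau>)) c"
    using krs_fid_ge[OF Ts(1) Ks(2)] Ts(2)[OF apply_instr_carrier] Ts(2)[OF kstateD(4)[OF \<sigma>]] by simp
  thus ?thesis unfolding conv_def snd_tensor fst_tensor using Ms by metis
qed

text \<open>Arbitrary sequences instead of powers, because rates involve lengths such as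
  \<open>nat \<lceil>r * real n\<rceil>\<close> and subsequences of them.\<close>

definition aconv :: "(nat \<Rightarrow> kstate) \<Rightarrow> (nat \<Rightarrow> kstate) \<Rightarrow> bool" where
  "aconv f g \<longleftrightarrow> (\<forall>c<1. \<forall>\<^sub>F n in sequentially. conv (f n) (g n) c)"

lemma aconv_if_ex_conv:
  assumes "\<And>n. kstate k (g n)" "\<forall>\<^sub>F n in sequentially. ex_conv (f n) (g n)"
  shows "aconv f g"
  unfolding aconv_def using assms(2) by (auto elim!: eventually_mono intro!: conv_if_ex_conv[OF assms(1)])

lemma aconv_trans:
  assumes k: "\<And>n. kstate k (f n)" "\<And>n. kstate k (g n)" "\<And>n. kstate k (h n)" and fg: "aconv f g" and gh: "aconv g h"
  shows "aconv f h"
  unfolding aconv_def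
proof (intro allI impI)
  fix c :: real assume c: "c < 1"
  define \<eta> where "\<eta> = (1 - c) / 2"
  have \<eta>: "\<eta> > 0" using c by (simp add: \<eta>_def)
  have "\<forall>\<^sub>F n in sequentially. conv (f n) (g n) (1 - \<eta>\<^sup>2 / 2)" "\<forall>\<^sub>F n in sequentially. conv (g n) (h n) (1 - \<eta>)"
    using fg gh \<eta> unfolding aconv_def by auto
  thus "\<forall>\<^sub>F n in sequentially. conv (f n) (h n) c"
  proof eventually_elim
    case (elim n)
    have "conv (f n) (h n) (1 - \<eta> - \<eta>)" by (rule conv_trans[OF k elim \<eta>])
    thus ?case by (simp add: \<eta>_def field_simps)
  qed
qed

lemma aconv_tensor_right:
  assumes "\<And>n. kstate k (f n)" "\<And>n. kstate k (g n)" "\<And>n. kstate k (h n)" "aconv f g"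
  shows "aconv (\<lambda>n. tensor_st (f n) (h n)) (\<lambda>n. tensor_st (g n) (h n))"
  unfolding aconv_def
proof (intro allI impI)
  fix c :: real assume "c < 1"
  hence "\<forall>\<^sub>F n in sequentially. conv (f n) (g n) c" using assms(4) by (simp add: aconv_def)
  thus "\<forall>\<^sub>F n in sequentially. conv (tensor_st (f n) (h n)) (tensor_st (g n) (h n)) c"
    by (rule eventually_mono) (rule conv_tensor_right[OF assms(1-3)])
qed

lemma aconv_reindex:
  assumes "aconv f g" "filterlim \<phi> at_top at_top"
  shows "aconv (\<lambda>n. f (\<phi> n)) (\<lambda>n. g (\<phi> n))"
  unfolding aconv_def
proof (intro allI impI)
  fix c :: real assume "c < 1"
  hence "\<forall>\<^sub>F n in sequentially. conv (f n) (g n) c" using assms(1) by (simp add: aconv_def)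
  thus "\<forall>\<^sub>F n in sequentially. conv (f (\<phi> n)) (g (\<phi> n)) c"
    by (rule eventually_compose_filterlim[OF _ assms(2)])
qed

text \<open>Replaces the error criterion by fidelity bounds close to 1; the squares that separate
  the two measures vanish in the limit.\<close>

lemma limsup_opt_err_iff_aconv:
  assumes k: "\<And>n. kstate k (f n)" "\<And>n. kstate k (g n)"
  shows "limsup (\<lambda>n. opt_err (f n) (g n)) = 0 \<longleftrightarrow> aconv f g"
proof
  assume l0: "limsup (\<lambda>n. opt_err (f n) (g n)) = 0"
  show "aconv f g"
    unfolding aconv_def
  proof (intro allI impI)
    fix c :: real assume c: "c < 1"
    \<comment> \<open>An error below 1 satisfies \<open>\<epsilon>\<^sup>2 \<le> \<epsilon>\<close>,
      hence the cap at 1; the resulting fidelity is then at least \<open>c\<close>.\<close>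
    define e where "e = min 1 (1 - c)"
    have e: "0 < e" "e \<le> 1" "e \<le> 1 - c" using c by (auto simp: e_def)
    have "limsup (\<lambda>n. opt_err (f n) (g n)) < ereal e" using l0 e by simp
    hence "\<forall>\<^sub>F n in sequentially. opt_err (f n) (g n) < ereal e" by (rule Limsup_lessD)
    thus "\<forall>\<^sub>F n in sequentially. conv (f n) (g n) c"
    proof eventually_elim
      case (elim n)
      then obtain \<epsilon> where \<epsilon>: "0 \<le> \<epsilon>" "\<epsilon> < e" "converts (f n) (g n) \<epsilon>"
        unfolding opt_err_def Inf_less_iff by auto
      then obtain Ks where Ks: "locc_instr (fst (f n)) (fst (g n)) Ks"
        "pdist (apply_instr (fst (g n)) Ks (snd (f n))) (snd (g n)) \<le> \<epsilon>" by (auto simp: converts_def)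
      have "psd (prod_list (fst (g n))) (apply_instr (fst (g n)) Ks (snd (f n)))"
        unfolding apply_instr_krs by (rule krs_psd) (use locc_kraus[OF Ks(1)] kstateD(2)[OF k(1)] in \<open>auto simp: kraus_def\<close>)
      hence "fid_ge (prod_list (fst (g n))) (apply_instr (fst (g n)) Ks (snd (f n))) (snd (g n)) (1 - \<epsilon>\<^sup>2)"
        by (rule pdist_le_imp_fid_ge[OF _ kstateD(2)[OF k(2)] Ks(2)]) (use \<epsilon> e in auto)
      moreover have "\<epsilon>\<^sup>2 \<le> \<epsilon>" using \<epsilon> e by (simp add: power2_eq_square mult_left_le)
      hence "c \<le> 1 - \<epsilon>\<^sup>2" using \<epsilon> e by linarith
      ultimately show ?case unfolding conv_def using Ks(1) fid_ge_mono by blast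
    qed
  qed
next
  assume a: "aconv f g"
  have nn: "0 \<le> opt_err (f n) (g n)" for n unfolding opt_err_def by (rule Inf_greatest) auto
  have le: "limsup (\<lambda>n. opt_err (f n) (g n)) \<le> ereal e" if e: "e > 0" for e
  proof -
    \<comment> \<open>The square of \<open>1 - e\<^sup>2 / 2\<close> is at least
      \<open>1 - e\<^sup>2\<close>. The maximum with 0 covers large \<open>e\<close>, where the
      bound to be reached is negative.\<close>
    define c where "c = max 0 (1 - e\<^sup>2 / 2)"
    have c: "0 \<le> c" "c < 1" using e by (auto simp: c_def)
    have "1 - e\<^sup>2 \<le> c\<^sup>2"
    proof (cases "1 - e\<^sup>2 / 2 \<ge> 0")
      case True
      have "(1 - e\<^sup>2 / 2)\<^sup>2 = 1 - e\<^sup>2 + (e\<^sup>2 / 2)\<^sup>2" by (simp add: power2_eq_square field_simps)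
      thus ?thesis using True by (simp add: c_def)
    next
      case False
      thus ?thesis using zero_le_power2[of c] by linarith
    qed
    hence c2: "1 - c\<^sup>2 \<le> e\<^sup>2" by simp
    have "\<forall>\<^sub>F n in sequentially. conv (f n) (g n) c" using a c unfolding aconv_def by blast
    hence "\<forall>\<^sub>F n in sequentially. opt_err (f n) (g n) \<le> ereal e"
    proof eventually_elim
      case (elim n)
      then obtain Ks where Ks: "locc_instr (fst (f n)) (fst (g n)) Ks"
        "fid_ge (prod_list (fst (g n))) (apply_instr (fst (g n)) Ks (snd (f n))) (snd (g n)) c" by (auto simp: conv_def)
      have "pdist (apply_instr (fst (g n)) Ks (snd (f n))) (snd (g n)) \<le> e"
        by (rule fid_ge_imp_pdist_le[OF Ks(2) c(1) c2]) (use e in simp)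
      hence "converts (f n) (g n) e" using Ks(1) by (auto simp: converts_def)
      thus ?case unfolding opt_err_def using e by (intro Inf_lower) auto
    qed
    thus ?thesis by (rule Limsup_bounded)
  qed
  have "limsup (\<lambda>n. opt_err (f n) (g n)) \<le> 0"
    by (rule ereal_le_epsilon2) (use le in auto)
  moreover have "0 \<le> limsup (\<lambda>n. opt_err (f n) (g n))"
    by (rule le_Limsup) (auto simp: nn)
  ultimately show "limsup (\<lambda>n. opt_err (f n) (g n)) = 0" by (rule antisym)
qed

lemma asym_ge_iff_aconv: "kstate k \<rho> \<Longrightarrow> kstate k \<sigma> \<Longrightarrow> asym_ge \<rho> \<sigma> \<longleftrightarrow> aconv (tpow \<rho>) (tpow \<sigma>)"
  unfolding asym_ge_def by (rule limsup_opt_err_iff_aconv) (rule kstate_tpow, assumption)+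

subsection \<open>Products of lists of states\<close>

definition lprod :: "nat \<Rightarrow> kstate list \<Rightarrow> kstate" where
  "lprod k xs = foldr tensor_st xs (unit_st k)"

lemma lprod_simps [simp]: "lprod k [] = unit_st k" "lprod k (x # xs) = tensor_st x (lprod k xs)"
  by (simp_all add: lprod_def)

lemma kstate_lprod: "\<forall>x\<in>set xs. kstate k x \<Longrightarrow> kstate k (lprod k xs)"
  by (induction xs) (auto simp: kstate_unit kstate_tensor)

lemma lprod_append:
  "\<forall>x\<in>set xs. kstate k x \<Longrightarrow> \<forall>x\<in>set ys. kstate k x \<Longrightarrow> lprod k (xs @ ys) = tensor_st (lprod k xs) (lprod k ys)"
proof (induction xs)
  case Nil
  thus ?case by (simp add: tensor_unit_left kstate_lprod)
next
  case (Cons x xs)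
  have st: "kstate k x" "kstate k (lprod k xs)" "kstate k (lprod k ys)"
    using Cons.prems by (simp_all add: kstate_lprod)
  have "tensor_st (tensor_st x (lprod k xs)) (lprod k ys) = tensor_st x (tensor_st (lprod k xs) (lprod k ys))"
    by (rule tensor_assoc[OF kstateD(1)[OF st(1)] kstateD(1)[OF st(2)] kstateD(1)[OF st(3)]])
  thus ?case using Cons by simp
qed

lemma lprod_singleton: "kstate k \<rho> \<Longrightarrow> lprod k [\<rho>] = \<rho>"
  by (simp add: tensor_unit_right)

lemma tpow_lprod:
  assumes "\<forall>x\<in>set xs. kstate k x"
  shows "tpow (lprod k xs) n = lprod k (concat (replicate n xs))"
proof (induction n)
  case 0
  thus ?case using kstateD(1)[OF kstate_lprod[OF assms]] by simp
next
  case (Suc n)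
  thus ?case using lprod_append[of xs k "concat (replicate n xs)"] assms by auto
qed

lemma mset_concat_replicate: "mset (concat (replicate n xs)) = repeat_mset n (mset xs)"
  by (induction n) auto

lemma concat_replicate_singleton: "concat (replicate n [x]) = replicate n x"
  by (induction n) auto

lemma tpow_eq_lprod: "kstate k \<rho> \<Longrightarrow> tpow \<rho> n = lprod k (replicate n \<rho>)"
  using tpow_lprod[of "[\<rho>]" k n] lprod_singleton[of k \<rho>] by (simp add: concat_replicate_singleton)

section \<open>Rearranging products; the asymptotic order is compatible with tensoring\<close>

context
  fixes k :: nat
  assumes k1: "1 \<le> k"
begin

lemma ex_conv_tensor_left:
  assumes "kstate k \<rho>" "kstate k \<sigma>" "kstate k \<tau>" "ex_conv \<rho> \<sigma>"
  shows "ex_conv (tensor_st \<tau> \<rho>) (tensor_st \<tau> \<sigma>)"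
proof -
  note t = kstate_tensor[OF assms(3,1)] kstate_tensor[OF assms(1,3)]
  have "ex_conv (tensor_st \<rho> \<tau>) (tensor_st \<tau> \<sigma>)"
    by (rule ex_conv_trans[OF t(2) ex_conv_tensor_right[OF assms(1,3,4)] ex_conv_commute[OF k1 assms(2,3)]])
  thus ?thesis by (rule ex_conv_trans[OF t(1) ex_conv_commute[OF k1 assms(3,1)]])
qed

text \<open>Reordering factors is a local permutation of bases: the head of one list is moved past
  the factors that precede it in the other.\<close>

lemma ex_conv_lprod_perm:
  "\<forall>x\<in>set xs. kstate k x \<Longrightarrow> mset xs = mset ys \<Longrightarrow> ex_conv (lprod k xs) (lprod k ys)"
proof (induction xs arbitrary: ys)
  case Nil
  thus ?case using ex_conv_refl[OF k1 kstate_unit] by simp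
next
  case (Cons x xs)
  have set_eq: "set ys = set (x # xs)" using mset_eq_setD[OF Cons.prems(2)] by simp
  hence "x \<in> set ys" by simp
  then obtain us vs where ys: "ys = us @ x # vs" using split_list by metis
  have sets: "\<forall>z\<in>set ys. kstate k z" using Cons.prems(1) by (simp only: set_eq)
  hence st: "kstate k x" "kstate k (lprod k xs)" "kstate k (lprod k us)" "kstate k (lprod k vs)" "kstate k (lprod k (us @ vs))"
    and su: "\<forall>z\<in>set us. kstate k z" "\<forall>z\<in>set vs. kstate k z" "\<forall>z\<in>set (x # vs). kstate k z"
    using Cons.prems(1) ys by (auto intro!: kstate_lprod)
  have len: "length (fst x) = k" "length (fst (lprod k us)) = k" "length (fst (lprod k vs)) = k"
    using st kstateD(1) by auto
  have "ex_conv (lprod k xs) (lprod k (us @ vs))"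
    using Cons.prems by (intro Cons.IH) (auto simp: ys)
  hence 1: "ex_conv (tensor_st x (lprod k xs)) (tensor_st x (lprod k (us @ vs)))"
    by (rule ex_conv_tensor_left[OF st(2,5,1)])
  have "ex_conv (tensor_st (tensor_st x (lprod k us)) (lprod k vs)) (tensor_st (tensor_st (lprod k us) x) (lprod k vs))"
    by (rule ex_conv_tensor_right[OF kstate_tensor[OF st(1,3)] st(4) ex_conv_commute[OF k1 st(1,3)]])
  moreover have "tensor_st (tensor_st x (lprod k us)) (lprod k vs) = tensor_st x (lprod k (us @ vs))"
    using tensor_assoc[OF len] lprod_append[OF su(1,2)] by simp
  moreover have "tensor_st (tensor_st (lprod k us) x) (lprod k vs) = lprod k ys"
    using tensor_assoc[OF len(2,1,3)] lprod_append[OF su(1,3)] ys by simp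
  ultimately have "ex_conv (tensor_st x (lprod k (us @ vs))) (lprod k ys)" by simp
  thus ?case using ex_conv_trans[OF kstate_tensor[OF st(1,2)] 1] by simp
qed

text \<open>Permute the surplus factors to the end and discard them.\<close>

lemma ex_conv_lprod_sub:
  assumes xs: "\<forall>x\<in>set xs. kstate k x" and sub: "mset ys \<subseteq># mset xs"
  shows "ex_conv (lprod k xs) (lprod k ys)"
proof -
  obtain zs where zs: "mset zs = mset xs - mset ys" using ex_mset by blast
  have m: "mset xs = mset (ys @ zs)" using sub zs by simp
  hence s: "set xs = set (ys @ zs)" by (rule mset_eq_setD)
  have yz: "\<forall>x\<in>set ys. kstate k x" "\<forall>x\<in>set zs. kstate k x" using xs s by auto
  note K = kstate_lprod[OF yz(1)] kstate_lprod[OF yz(2)]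
  have "ex_conv (tensor_st (lprod k ys) (lprod k zs)) (tensor_st (lprod k ys) (unit_st k))"
    by (rule ex_conv_tensor_left[OF K(2) kstate_unit K(1) ex_conv_unit[OF k1 K(2)]])
  hence "ex_conv (lprod k (ys @ zs)) (lprod k ys)"
    using tensor_unit_right[OF K(1)] lprod_append[OF yz] by simp
  thus ?thesis using ex_conv_trans[OF kstate_lprod[OF xs] ex_conv_lprod_perm[OF xs m]] by simp
qed

lemma asym_ge_if_ex_conv:
  assumes "kstate k \<rho>" "kstate k \<sigma>" "ex_conv \<rho> \<sigma>"
  shows "asym_ge \<rho> \<sigma>"
proof -
  have "ex_conv (tpow \<rho> n) (tpow \<sigma> n)" for n
  proof (induction n)
    case 0
    thus ?case using ex_conv_refl[OF k1 kstate_unit] kstateD(1)[OF assms(1)] kstateD(1)[OF assms(2)] by simp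
  next
    case (Suc n)
    have "ex_conv (tensor_st \<rho> (tpow \<rho> n)) (tensor_st \<sigma> (tpow \<rho> n))"
      by (rule ex_conv_tensor_right[OF assms(1) kstate_tpow[OF assms(1)] assms(3)])
    moreover have "ex_conv (tensor_st \<sigma> (tpow \<rho> n)) (tensor_st \<sigma> (tpow \<sigma> n))"
      by (rule ex_conv_tensor_left[OF kstate_tpow[OF assms(1)] kstate_tpow[OF assms(2)] assms(2) Suc])
    ultimately show ?case
      using ex_conv_trans[OF kstate_tensor[OF assms(1) kstate_tpow[OF assms(1)]]] by simp
  qed
  thus ?thesis unfolding asym_ge_iff_aconv[OF assms(1,2)]
    by (intro aconv_if_ex_conv[of k] kstate_tpow assms) simp
qed

lemma asym_ge_trans:
  assumes "kstate k \<rho>" "kstate k \<sigma>" "kstate k \<tau>" "asym_ge \<rho> \<sigma>" "asym_ge \<sigma> \<tau>"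
  shows "asym_ge \<rho> \<tau>"
  using assms(4,5)
  unfolding asym_ge_iff_aconv[OF assms(1,2)] asym_ge_iff_aconv[OF assms(2,3)] asym_ge_iff_aconv[OF assms(1,3)]
  by (rule aconv_trans[OF kstate_tpow[OF assms(1)] kstate_tpow[OF assms(2)] kstate_tpow[OF assms(3)]])

lemma ex_conv_tpow_tensor:
  assumes "kstate k \<rho>" "kstate k \<tau>"
  shows "ex_conv (tpow (tensor_st \<rho> \<tau>) n) (tensor_st (tpow \<rho> n) (tpow \<tau> n))"
    "ex_conv (tensor_st (tpow \<rho> n) (tpow \<tau> n)) (tpow (tensor_st \<rho> \<tau>) n)"
proof -
  have 1: "tpow (tensor_st \<rho> \<tau>) n = lprod k (concat (replicate n [\<rho>, \<tau>]))"
    using tpow_lprod[of "[\<rho>, \<tau>]" k n] assms by (simp add: tensor_unit_right)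
  have 2: "tensor_st (tpow \<rho> n) (tpow \<tau> n) = lprod k (replicate n \<rho> @ replicate n \<tau>)"
    using assms by (subst lprod_append) (auto simp: tpow_eq_lprod)
  have m: "mset (concat (replicate n [\<rho>, \<tau>])) = mset (replicate n \<rho> @ replicate n \<tau>)"
    by (induction n) auto
  show "ex_conv (tpow (tensor_st \<rho> \<tau>) n) (tensor_st (tpow \<rho> n) (tpow \<tau> n))"
    unfolding 1 2 by (rule ex_conv_lprod_perm[OF _ m]) (use assms in auto)
  show "ex_conv (tensor_st (tpow \<rho> n) (tpow \<tau> n)) (tpow (tensor_st \<rho> \<tau>) n)"
    unfolding 1 2 by (rule ex_conv_lprod_perm[OF _ m[symmetric]]) (use assms in auto)
qed

lemma asym_ge_tensor_right:
  assumes "kstate k \<rho>" "kstate k \<sigma>" "kstate k \<tau>" "asym_ge \<rho> \<sigma>"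
  shows "asym_ge (tensor_st \<rho> \<tau>) (tensor_st \<sigma> \<tau>)"
proof -
  note K = kstate_tpow[OF assms(1)] kstate_tpow[OF assms(2)] kstate_tpow[OF assms(3)]
  note T = kstate_tpow[OF kstate_tensor[OF assms(1,3)]] kstate_tpow[OF kstate_tensor[OF assms(2,3)]]
  note S = kstate_tensor[OF K(1) K(3)] kstate_tensor[OF K(2) K(3)]
  have "aconv (tpow \<rho>) (tpow \<sigma>)" using assms(4) asym_ge_iff_aconv[OF assms(1,2)] by simp
  hence 1: "aconv (\<lambda>n. tensor_st (tpow \<rho> n) (tpow \<tau> n)) (\<lambda>n. tensor_st (tpow \<sigma> n) (tpow \<tau> n))"
    by (rule aconv_tensor_right[OF K])
  have 2: "aconv (\<lambda>n. tpow (tensor_st \<rho> \<tau>) n) (\<lambda>n. tensor_st (tpow \<rho> n) (tpow \<tau> n))"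
    by (rule aconv_if_ex_conv[OF S(1)]) (rule always_eventually, rule allI, rule ex_conv_tpow_tensor(1)[OF assms(1,3)])
  have 3: "aconv (\<lambda>n. tensor_st (tpow \<sigma> n) (tpow \<tau> n)) (\<lambda>n. tpow (tensor_st \<sigma> \<tau>) n)"
    by (rule aconv_if_ex_conv[OF T(2)]) (rule always_eventually, rule allI, rule ex_conv_tpow_tensor(2)[OF assms(2,3)])
  have "aconv (\<lambda>n. tpow (tensor_st \<rho> \<tau>) n) (\<lambda>n. tpow (tensor_st \<sigma> \<tau>) n)"
    by (rule aconv_trans[OF T(1) S(1) T(2) 2 aconv_trans[OF S(1) S(2) T(2) 1 3]])
  thus ?thesis using asym_ge_iff_aconv[OF kstate_tensor[OF assms(1,3)] kstate_tensor[OF assms(2,3)]] by simp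
qed


subsection \<open>Upper bound on rates\<close>

lemma asym_ge_unit: "kstate k \<rho> \<Longrightarrow> asym_ge \<rho> (unit_st k)"
  using asym_ge_if_ex_conv[OF _ kstate_unit ex_conv_unit[OF k1]] by blast

lemma monotonesD:
  assumes E: "E \<in> monotones k"
  shows "E (GHZ k) = 1" "kstate k \<rho> \<Longrightarrow> kstate k \<sigma> \<Longrightarrow> E (tensor_st \<rho> \<sigma>) = E \<rho> + E \<sigma>"
    "kstate k \<rho> \<Longrightarrow> kstate k \<sigma> \<Longrightarrow> asym_ge \<rho> \<sigma> \<Longrightarrow> E \<sigma> \<le> E \<rho>"
  using E unfolding monotones_def mem_Collect_eq by blast+

lemma monotones_unit: "E \<in> monotones k \<Longrightarrow> E (unit_st k) = 0"
  using monotonesD(2)[OF _ kstate_unit kstate_unit] tensor_unit_left[OF kstate_unit, of k] by simp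

lemma monotones_nonneg: "E \<in> monotones k \<Longrightarrow> kstate k \<rho> \<Longrightarrow> 0 \<le> E \<rho>"
  using monotonesD(3)[OF _ _ kstate_unit asym_ge_unit] monotones_unit by metis

lemma monotones_tpow: "E \<in> monotones k \<Longrightarrow> kstate k \<rho> \<Longrightarrow> E (tpow \<rho> n) = real n * E \<rho>"
proof (induction n)
  case 0
  thus ?case using monotones_unit kstateD(1) by simp
next
  case (Suc n)
  thus ?case using monotonesD(2)[OF Suc.prems(1,2) kstate_tpow[OF Suc.prems(2)], of n] by (simp add: algebra_simps)
qed

lemma achievable_iff_aconv:
  assumes "kstate k \<rho>" "kstate k \<sigma>"
  shows "achievable k \<rho> \<sigma> r \<longleftrightarrow> 0 \<le> r \<and> (\<forall>\<delta>>0. aconv (\<lambda>n. tensor_st (tpow \<rho> n) (tpow (GHZ k) (nat \<lfloor>\<delta> * real n\<rfloor>)))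
    (\<lambda>n. tpow \<sigma> (nat \<lceil>r * real n\<rceil>)))"
proof -
  have "(limsup (\<lambda>n. opt_err (tensor_st (tpow \<rho> n) (tpow (GHZ k) (nat \<lfloor>\<delta> * real n\<rfloor>))) (tpow \<sigma> (nat \<lceil>r * real n\<rceil>))) = 0)
    = aconv (\<lambda>n. tensor_st (tpow \<rho> n) (tpow (GHZ k) (nat \<lfloor>\<delta> * real n\<rfloor>))) (\<lambda>n. tpow \<sigma> (nat \<lceil>r * real n\<rceil>))" for \<delta>
    by (rule limsup_opt_err_iff_aconv[of k])
      (intro kstate_tensor kstate_tpow assms kstate_GHZ[OF k1] | assumption)+
  thus ?thesis unfolding achievable_def by simp
qed

lemma ex_conv_tpow_le:
  assumes "kstate k \<sigma>" "m \<le> n"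
  shows "ex_conv (tpow \<sigma> n) (tpow \<sigma> m)"
  unfolding tpow_eq_lprod[OF assms(1)]
  by (rule ex_conv_lprod_sub) (use assms in \<open>simp_all add: subseteq_mset_def\<close>)

lemma tpow_tpow: "kstate k \<rho> \<Longrightarrow> tpow (tpow \<rho> n) m = tpow \<rho> (m * n)"
proof -
  assume \<rho>: "kstate k \<rho>"
  have "tpow (tpow \<rho> n) m = lprod k (concat (replicate m (replicate n \<rho>)))"
    unfolding tpow_eq_lprod[OF \<rho>] using tpow_lprod[of "replicate n \<rho>" k m] \<rho> by simp
  also have "concat (replicate m (replicate n \<rho>)) = replicate (m * n) \<rho>"
    by (induction m) (simp_all add: replicate_add)
  finally show ?thesis by (simp add: tpow_eq_lprod[OF \<rho>])
qed

lemma achievable_le_monotone: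
  assumes \<rho>: "kstate k \<rho>" and \<sigma>: "kstate k \<sigma>" and r: "achievable k \<rho> \<sigma> r" and E: "E \<in> monotones k"
  shows "r * E \<sigma> \<le> E \<rho>"
proof -
  note G = kstate_GHZ[OF k1]
  have r0: "0 \<le> r" using r by (simp add: achievable_def)
  have E\<sigma>: "0 \<le> E \<sigma>" by (rule monotones_nonneg[OF E \<sigma>])
  have step: "(r * real N - 1) * E \<sigma> \<le> real N * E \<rho> + 1" if N: "N > 0" for N
  proof -
    \<comment> \<open>Rounding down keeps \<open>m * p\<close> below \<open>r * real (N * m)\<close>
      for every number \<open>m\<close> of blocks at once.\<close>
    define p where "p = nat \<lfloor>r * real N\<rfloor>"
    let ?\<phi> = "\<lambda>m. N * m"
    let ?f = "\<lambda>m. tensor_st (tpow \<rho> (N * m)) (tpow (GHZ k) m)"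
    let ?t = "tensor_st (tpow \<rho> N) (GHZ k)"
    note t = kstate_tensor[OF kstate_tpow[OF \<rho>, of N] G]
    have invN: "0 < 1 / real N" using N by simp
    have fl: "filterlim ?\<phi> at_top at_top"
      using N by (intro filterlim_subseq) (auto simp: strict_mono_def)
    have "aconv (\<lambda>n. tensor_st (tpow \<rho> n) (tpow (GHZ k) (nat \<lfloor>(1 / real N) * real n\<rfloor>))) (\<lambda>n. tpow \<sigma> (nat \<lceil>r * real n\<rceil>))"
      using r invN unfolding achievable_iff_aconv[OF \<rho> \<sigma>] by blast
    from aconv_reindex[OF this fl]
    have 1: "aconv ?f (\<lambda>m. tpow \<sigma> (nat \<lceil>r * real (N * m)\<rceil>))" using N by simp
    have 2: "aconv (\<lambda>m. tpow \<sigma> (nat \<lceil>r * real (N * m)\<rceil>)) (\<lambda>m. tpow (tpow \<sigma> p) m)"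
    proof (rule aconv_if_ex_conv[OF kstate_tpow[OF kstate_tpow[OF \<sigma>]]], rule always_eventually, rule allI)
      fix m
      have "real p \<le> r * real N" using r0 by (simp add: p_def)
      hence "real (m * p) \<le> r * real (N * m)" using mult_right_mono[of "real p" "r * real N" "real m"] by (simp add: ac_simps)
      hence "m * p \<le> nat \<lceil>r * real (N * m)\<rceil>" by linarith
      thus "ex_conv (tpow \<sigma> (nat \<lceil>r * real (N * m)\<rceil>)) (tpow (tpow \<sigma> p) m)"
        unfolding tpow_tpow[OF \<sigma>] by (rule ex_conv_tpow_le[OF \<sigma>])
    qed
    have 3: "aconv (\<lambda>m. tpow ?t m) ?f"
    proof (rule aconv_if_ex_conv[OF kstate_tensor[OF kstate_tpow[OF \<rho>] kstate_tpow[OF G]]], rule always_eventually, rule allI)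
      fix m
      show "ex_conv (tpow ?t m) (?f m)"
        using ex_conv_tpow_tensor(1)[OF kstate_tpow[OF \<rho>, of N] G, of m] by (simp add: tpow_tpow[OF \<rho>] mult.commute)
    qed
    have "aconv ?f (\<lambda>m. tpow (tpow \<sigma> p) m)"
      by (rule aconv_trans[OF kstate_tensor[OF kstate_tpow[OF \<rho>] kstate_tpow[OF G]] kstate_tpow[OF \<sigma>] kstate_tpow[OF kstate_tpow[OF \<sigma>]] 1 2])
    hence "aconv (\<lambda>m. tpow ?t m) (\<lambda>m. tpow (tpow \<sigma> p) m)"
      by (rule aconv_trans[OF kstate_tpow[OF t] kstate_tensor[OF kstate_tpow[OF \<rho>] kstate_tpow[OF G]] kstate_tpow[OF kstate_tpow[OF \<sigma>]] 3])
    hence "asym_ge ?t (tpow \<sigma> p)" using asym_ge_iff_aconv[OF t kstate_tpow[OF \<sigma>]] by simp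
    hence "E (tpow \<sigma> p) \<le> E ?t" by (rule monotonesD(3)[OF E t kstate_tpow[OF \<sigma>]])
    hence "real p * E \<sigma> \<le> real N * E \<rho> + 1"
      using monotones_tpow[OF E] monotonesD(1)[OF E] monotonesD(2)[OF E kstate_tpow[OF \<rho>] G] \<rho> \<sigma> by simp
    moreover have "r * real N - 1 \<le> real p" unfolding p_def by linarith
    hence "(r * real N - 1) * E \<sigma> \<le> real p * E \<sigma>" using E\<sigma> by (rule mult_right_mono)
    ultimately show ?thesis by linarith
  qed
  show ?thesis
  proof (rule ccontr)
    assume "\<not> r * E \<sigma> \<le> E \<rho>"
    hence gap: "r * E \<sigma> - E \<rho> > 0" by simp
    \<comment> \<open>Per \<open>N\<close> copies, rounding costs at most \<open>E \<sigma>\<close>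
      and the GHZ state costs 1; \<open>N\<close> times the gap has to exceed their sum.\<close>
    obtain N :: nat where N: "(1 + E \<sigma>) / (r * E \<sigma> - E \<rho>) < real N" using reals_Archimedean2 by blast
    have "N > 0" using N gap E\<sigma> by (metis add_nonneg_nonneg divide_nonneg_pos gr0I less_le_not_le of_nat_0 zero_le_one)
    moreover have "1 + E \<sigma> < real N * (r * E \<sigma> - E \<rho>)" using N gap by (simp add: pos_divide_less_eq)
    ultimately show False using step[of N] by (simp add: algebra_simps)
  qed
qed

subsection \<open>Achievability\<close>

text \<open>Asymptotic order on multisets of states; elements that are not \<open>k\<close>-partite states are ignored, so
  that no carrier is needed.\<close>

definition mlist :: "kstate multiset \<Rightarrow> kstate list" where
  "mlist A = (SOME xs. mset xs = filter_mset (kstate k) A)"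

definition mprod :: "kstate multiset \<Rightarrow> kstate" where
  "mprod A = lprod k (mlist A)"

lemma mset_mlist: "mset (mlist A) = filter_mset (kstate k) A"
  unfolding mlist_def by (rule someI_ex) (rule ex_mset)

lemma mlist_kstate: "\<forall>x\<in>set (mlist A). kstate k x"
  unfolding set_mset_mset[symmetric] mset_mlist by simp

lemma kstate_mprod: "kstate k (mprod A)"
  unfolding mprod_def by (rule kstate_lprod[OF mlist_kstate])

lemma asym_ge_lprod_perm:
  assumes "\<forall>x\<in>set xs. kstate k x" "mset xs = mset ys"
  shows "asym_ge (lprod k xs) (lprod k ys)"
proof -
  have "\<forall>x\<in>set ys. kstate k x" using assms(1) mset_eq_setD[OF assms(2)] by simp
  thus ?thesis using asym_ge_if_ex_conv[OF kstate_lprod kstate_lprod ex_conv_lprod_perm[OF assms]] assms(1) by blast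
qed

lemma mprod_equiv:
  assumes xs: "\<forall>x\<in>set xs. kstate k x" and "filter_mset (kstate k) A = mset xs"
  shows "asym_ge (mprod A) (lprod k xs)" "asym_ge (lprod k xs) (mprod A)"
  unfolding mprod_def
  by (rule asym_ge_lprod_perm, use assms mlist_kstate mset_mlist in simp_all)+

text \<open>The order of factors chosen by \<open>SOME\<close> is immaterial up to
  \<open>asym_ge\<close>, so a convenient listing may replace it.\<close>

lemma mprod_equivI:
  assumes A: "filter_mset (kstate k) A = mset xs" "\<forall>x\<in>set xs. kstate k x"
    and B: "filter_mset (kstate k) B = mset ys" "\<forall>x\<in>set ys. kstate k x"
  shows "asym_ge (mprod A) (mprod B) \<longleftrightarrow> asym_ge (lprod k xs) (lprod k ys)"
  using mprod_equiv[OF A(2,1)] mprod_equiv[OF B(2,1)] asym_ge_trans kstate_mprod kstate_lprod[OF A(2)] kstate_lprod[OF B(2)]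
  by meson

lemma ordered_states: "ordered_multisets (\<lambda>A B. asym_ge (mprod A) (mprod B)) {#GHZ k#}"
proof
  show "asym_ge (mprod A) (mprod A)" for A
    by (rule asym_ge_if_ex_conv[OF kstate_mprod kstate_mprod ex_conv_refl[OF k1 kstate_mprod]])
  show "asym_ge (mprod A) (mprod C)" if "asym_ge (mprod A) (mprod B)" "asym_ge (mprod B) (mprod C)" for A B C
    by (rule asym_ge_trans[OF kstate_mprod kstate_mprod kstate_mprod that])
  show "asym_ge (mprod (A + C)) (mprod (B + C))" if "asym_ge (mprod A) (mprod B)" for A B C
  proof -
    have m: "filter_mset (kstate k) (D + C) = mset (mlist D @ mlist C)" "\<forall>x\<in>set (mlist D @ mlist C). kstate k x" for D
      using mlist_kstate by (auto simp: mset_mlist)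
    show ?thesis unfolding mprod_equivI[OF m m] lprod_append[OF mlist_kstate mlist_kstate] mprod_def[symmetric]
      by (rule asym_ge_tensor_right[OF kstate_mprod kstate_mprod kstate_mprod that])
  qed
  show "asym_ge (mprod A) (mprod {#})" for A
  proof -
    have "mlist {#} = []" using mset_mlist[of "{#}"] by simp
    hence "mprod {#} = unit_st k" by (simp add: mprod_def)
    thus ?thesis using asym_ge_unit[OF kstate_mprod] by simp
  qed
  show "\<exists>n. asym_ge (mprod (repeat_mset n {#GHZ k#})) (mprod A)" for A
  proof -
    obtain n where n: "ex_conv (tpow (GHZ k) n) (mprod A)" using ex_conv_GHZ[OF k1 kstate_mprod] by blast
    note G = kstate_GHZ[OF k1]
    have "asym_ge (tpow (GHZ k) n) (mprod A)" by (rule asym_ge_if_ex_conv[OF kstate_tpow[OF G] kstate_mprod n])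
    moreover have "asym_ge (mprod (repeat_mset n {#GHZ k#})) (tpow (GHZ k) n)"
      unfolding tpow_eq_lprod[OF G]
    proof (rule mprod_equiv(1))
      show "filter_mset (kstate k) (repeat_mset n {#GHZ k#}) = mset (replicate n (GHZ k))"
        using G by (induction n) auto
    qed (use G in simp)
    ultimately show ?thesis
      using asym_ge_trans[OF kstate_mprod kstate_tpow[OF G] kstate_mprod] by blast
  qed
qed

text \<open>The multisets \<open>{#tensor_st \<rho> \<sigma>#}\<close> and
  \<open>{#\<rho>, \<sigma>#}\<close> have products convertible both ways, so \<open>E\<close>
  agrees on them; additivity over multiset sums thereby becomes additivity over tensor
  products.\<close>

lemma monotone_of_additive:
  assumes add: "\<forall>A B. E (A + B) = E A + (E B :: real)" and mono: "\<forall>A B. asym_ge (mprod A) (mprod B) \<longrightarrow> E B \<le> E A"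
    and unit: "E {#GHZ k#} = 1"
  shows "(\<lambda>\<rho>. E {#\<rho>#}) \<in> monotones k"
proof -
  have "E {#tensor_st \<rho> \<sigma>#} = E {#\<rho>#} + E {#\<sigma>#}" if s: "kstate k \<rho>" "kstate k \<sigma>" for \<rho> \<sigma>
  proof -
    note t = kstate_tensor[OF s]
    have e: "lprod k [tensor_st \<rho> \<sigma>] = lprod k [\<rho>, \<sigma>]" using lprod_singleton[OF t] lprod_singleton[OF s(2)] by simp
    have "asym_ge (mprod {#tensor_st \<rho> \<sigma>#}) (mprod {#\<rho>, \<sigma>#})" "asym_ge (mprod {#\<rho>, \<sigma>#}) (mprod {#tensor_st \<rho> \<sigma>#})"
    proof -
      show "asym_ge (mprod {#tensor_st \<rho> \<sigma>#}) (mprod {#\<rho>, \<sigma>#})"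
        by (subst mprod_equivI[where xs = "[tensor_st \<rho> \<sigma>]" and ys = "[\<rho>, \<sigma>]"])
          (use s t in \<open>simp_all only: e[symmetric] list.set ball_simps, simp_all add: asym_ge_lprod_perm del: lprod_simps\<close>)
      show "asym_ge (mprod {#\<rho>, \<sigma>#}) (mprod {#tensor_st \<rho> \<sigma>#})"
        by (subst mprod_equivI[where ys = "[tensor_st \<rho> \<sigma>]" and xs = "[\<rho>, \<sigma>]"])
          (use s t in \<open>simp_all only: e[symmetric] list.set ball_simps, simp_all add: asym_ge_lprod_perm del: lprod_simps\<close>)
    qed
    hence "E {#tensor_st \<rho> \<sigma>#} = E {#\<rho>, \<sigma>#}" using mono by (meson order_antisym)
    also have "{#\<rho>, \<sigma>#} = {#\<rho>#} + {#\<sigma>#}" by simp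
    finally show ?thesis unfolding add[rule_format] .
  qed
  moreover have "E {#\<sigma>#} \<le> E {#\<rho>#}" if s: "kstate k \<rho>" "kstate k \<sigma>" "asym_ge \<rho> \<sigma>" for \<rho> \<sigma>
  proof -
    have "asym_ge (mprod {#\<rho>#}) (mprod {#\<sigma>#})"
      by (subst mprod_equivI[where xs = "[\<rho>]" and ys = "[\<sigma>]"])
        (use s lprod_singleton[OF s(1)] lprod_singleton[OF s(2)] in simp_all)
    thus ?thesis using mono by blast
  qed
  ultimately show ?thesis using unit unfolding monotones_def by blast
qed


section \<open>From a conversion of blocks to conversions of every length\<close>

lemma ex_conv_split_copies:
  assumes \<rho>: "kstate k \<rho>" and le: "m * Q \<le> n" "m * W + C \<le> M"
  shows "ex_conv (tensor_st (tpow \<rho> n) (tpow (GHZ k) M))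
    (tensor_st (tpow (tensor_st (tpow \<rho> Q) (tpow (GHZ k) W)) m) (tpow (GHZ k) C))"
proof -
  note G = kstate_GHZ[OF k1]
  let ?b = "replicate Q \<rho> @ replicate W (GHZ k)"
  have b: "\<forall>x\<in>set ?b. kstate k x" using \<rho> G by auto
  have sets: "\<forall>x\<in>set (replicate n \<rho>). kstate k x" "\<forall>x\<in>set (replicate M (GHZ k)). kstate k x"
    "\<forall>x\<in>set (replicate Q \<rho>). kstate k x" "\<forall>x\<in>set (replicate W (GHZ k)). kstate k x"
    "\<forall>x\<in>set (replicate C (GHZ k)). kstate k x" "\<forall>x\<in>set (concat (replicate m ?b)). kstate k x"
    using \<rho> G b by auto
  have 1: "tensor_st (tpow \<rho> n) (tpow (GHZ k) M) = lprod k (replicate n \<rho> @ replicate M (GHZ k))"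
    unfolding lprod_append[OF sets(1,2)] tpow_eq_lprod[OF \<rho>] tpow_eq_lprod[OF G] ..
  have 2: "tensor_st (tpow (tensor_st (tpow \<rho> Q) (tpow (GHZ k) W)) m) (tpow (GHZ k) C)
    = lprod k (concat (replicate m ?b) @ replicate C (GHZ k))"
    unfolding lprod_append[OF sets(6,5)] tpow_lprod[OF b, symmetric] lprod_append[OF sets(3,4)]
      tpow_eq_lprod[OF \<rho>, symmetric] tpow_eq_lprod[OF G, symmetric] ..
  have plus: "replicate_mset (a + b) x = replicate_mset a x + replicate_mset b x" for a b and x :: kstate
    by (rule multiset_eqI) simp
  have rep: "repeat_mset m (replicate_mset a x) = replicate_mset (m * a) x" for a and x :: kstate
    by (induction m) (simp_all add: plus)
  have "mset (concat (replicate m ?b) @ replicate C (GHZ k))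
    = replicate_mset (m * Q) \<rho> + replicate_mset (m * W + C) (GHZ k)"
    by (simp add: mset_concat_replicate repeat_mset_distrib2 rep plus)
  also have "\<dots> \<subseteq># replicate_mset n \<rho> + replicate_mset M (GHZ k)"
    using le by (intro subset_mset.add_mono) (simp_all add: subseteq_mset_def)
  finally have "mset (concat (replicate m ?b) @ replicate C (GHZ k)) \<subseteq># mset (replicate n \<rho> @ replicate M (GHZ k))"
    by simp
  thus ?thesis unfolding 1 2 by (rule ex_conv_lprod_sub[rotated]) (use \<rho> G in auto)
qed

lemma tensor_tpow: "kstate k \<sigma> \<Longrightarrow> tensor_st (tpow \<sigma> a) (tpow \<sigma> b) = tpow \<sigma> (a + b)"
  using lprod_append[of "replicate a \<sigma>" k "replicate b \<sigma>"] by (simp add: tpow_eq_lprod replicate_add)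

text \<open>Cut \<open>n\<close> into blocks of \<open>Q = W * K\<close> copies. Each block uses
  \<open>2 * W\<close> copies of GHZ, a rate of \<open>2 / K < \<delta>\<close>, so the supply
  eventually covers a further constant as well. The leftover \<open>n mod Q\<close> copies of
  \<open>\<rho>\<close> are discarded, and the missing copies of \<open>\<sigma>\<close> are made
  from that constant.\<close>

lemma aconv_of_block_conversion:
  assumes \<rho>: "kstate k \<rho>" and \<sigma>: "kstate k \<sigma>" and r: "0 \<le> r" and W: "W > 0" and K: "K > 0"
    and \<delta>: "2 / real K < \<delta>" and p: "r * real K \<le> real p"
    and block: "asym_ge (tensor_st (tpow \<rho> (W * K)) (tpow (GHZ k) (2 * W))) (tpow \<sigma> (W * p))"
  shows "aconv (\<lambda>n. tensor_st (tpow \<rho> n) (tpow (GHZ k) (nat \<lfloor>\<delta> * real n\<rfloor>))) (\<lambda>n. tpow \<sigma> (nat \<lceil>r * real n\<rceil>))"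
proof -
  note G = kstate_GHZ[OF k1]
  define Q where "Q = W * K"
  have Q: "Q > 0" using W K by (simp add: Q_def)
  \<comment> \<open>Copies of \<open>\<sigma>\<close> owed for an incomplete last block. The bound
    does not depend on \<open>n\<close>, so a fixed number \<open>C\<close> of GHZ copies prepares
    them.\<close>
  define c0 where "c0 = nat \<lceil>r * real Q\<rceil>"
  obtain C where C: "ex_conv (tpow (GHZ k) C) (tpow \<sigma> c0)" using ex_conv_GHZ[OF k1 kstate_tpow[OF \<sigma>]] by blast
  let ?t = "tensor_st (tpow \<rho> Q) (tpow (GHZ k) (2 * W))"
  note t = kstate_tensor[OF kstate_tpow[OF \<rho>, of Q] kstate_tpow[OF G, of "2 * W"]]
  let ?f = "\<lambda>n. tensor_st (tpow \<rho> n) (tpow (GHZ k) (nat \<lfloor>\<delta> * real n\<rfloor>))"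
  let ?g = "\<lambda>n. tensor_st (tpow ?t (n div Q)) (tpow (GHZ k) C)"
  let ?h = "\<lambda>n. tensor_st (tpow ?t (n div Q)) (tpow \<sigma> c0)"
  let ?i = "\<lambda>n. tensor_st (tpow (tpow \<sigma> (W * p)) (n div Q)) (tpow \<sigma> c0)"
  let ?j = "\<lambda>n. tpow \<sigma> (nat \<lceil>r * real n\<rceil>)"
  have kf: "kstate k (?f n)" and kg: "kstate k (?g n)" and kh: "kstate k (?h n)" and ki: "kstate k (?i n)"
    and kj: "kstate k (?j n)" for n
    by (rule kstate_tensor[OF kstate_tpow[OF \<rho>] kstate_tpow[OF G]] kstate_tensor[OF kstate_tpow[OF t] kstate_tpow[OF G]]
        kstate_tensor[OF kstate_tpow[OF t] kstate_tpow[OF \<sigma>]] kstate_tensor[OF kstate_tpow[OF kstate_tpow[OF \<sigma>]] kstate_tpow[OF \<sigma>]]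
        kstate_tpow[OF \<sigma>])+
  have fg: "aconv ?f ?g"
  proof (rule aconv_if_ex_conv[OF kg])
    \<comment> \<open>From here on the surplus of GHZ, at rate \<open>\<delta> - 2 / real K\<close>,
      covers \<open>C\<close>; the extra 1 absorbs the floor.\<close>
    define n0 where "n0 = nat \<lceil>(real C + 1) / (\<delta> - 2 / real K)\<rceil>"
    have "ex_conv (?f n) (?g n)" if n: "n \<ge> n0" for n
    proof (rule ex_conv_split_copies[OF \<rho>])
      show "n div Q * Q \<le> n" by simp
      have "(real C + 1) / (\<delta> - 2 / real K) \<le> real n" using n unfolding n0_def by linarith
      hence a: "real C + 1 \<le> real n * (\<delta> - 2 / real K)" using \<delta> by (simp add: pos_divide_le_eq)
      have "real (n div Q * Q) \<le> real n" by (simp only: of_nat_le_iff) simp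
      hence "real (n div Q) * (real W * real K) \<le> real n" by (simp add: Q_def)
      hence "real (n div Q * (2 * W)) \<le> 2 * real n / real K" using K by (simp add: field_simps)
      hence "real (n div Q * (2 * W) + C) + 1 \<le> \<delta> * real n" using a by (simp add: algebra_simps)
      thus "n div Q * (2 * W) + C \<le> nat \<lfloor>\<delta> * real n\<rfloor>" by linarith
    qed
    thus "\<forall>\<^sub>F n in sequentially. ex_conv (?f n) (?g n)" unfolding eventually_sequentially by blast
  qed
  have gh: "aconv ?g ?h"
  proof (rule aconv_if_ex_conv[OF kh], rule always_eventually, rule allI)
    show "ex_conv (?g n) (?h n)" for n
      by (rule ex_conv_tensor_left[OF kstate_tpow[OF G] kstate_tpow[OF \<sigma>] kstate_tpow[OF t] C])
  qed
  have hi: "aconv ?h ?i"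
  proof (rule aconv_tensor_right[OF kstate_tpow[OF t] kstate_tpow[OF kstate_tpow[OF \<sigma>]] kstate_tpow[OF \<sigma>]])
    have fl: "filterlim (\<lambda>n. n div Q) at_top at_top"
      unfolding filterlim_at_top eventually_sequentially
    proof
      show "\<exists>N. \<forall>n\<ge>N. m \<le> n div Q" for m
        using Q by (intro exI[of _ "m * Q"]) (simp add: less_eq_div_iff_mult_less_eq)
    qed
    have "aconv (tpow ?t) (tpow (tpow \<sigma> (W * p)))"
      using block asym_ge_iff_aconv[OF t kstate_tpow[OF \<sigma>]] by (simp add: Q_def)
    thus "aconv (\<lambda>n. tpow ?t (n div Q)) (\<lambda>n. tpow (tpow \<sigma> (W * p)) (n div Q))"
      using fl by (rule aconv_reindex)
  qed
  have ij: "aconv ?i ?j"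
  proof (rule aconv_if_ex_conv[OF kj], rule always_eventually, rule allI)
    fix n
    have "r * real n = r * real Q * real (n div Q) + r * real (n mod Q)"
    proof -
      have "real n = real Q * real (n div Q) + real (n mod Q)"
        by (metis mult_div_mod_eq of_nat_add of_nat_mult)
      thus ?thesis by (simp add: algebra_simps)
    qed
    also have "\<dots> \<le> real (n div Q * (W * p)) + real c0"
    proof (rule add_mono)
      have "r * real K * (real W * real (n div Q)) \<le> real p * (real W * real (n div Q))"
        using p by (intro mult_right_mono) auto
      thus "r * real Q * real (n div Q) \<le> real (n div Q * (W * p))" by (simp add: Q_def ac_simps)
      have "r * real (n mod Q) \<le> r * real Q" using r Q by (intro mult_left_mono) (auto intro: less_imp_le)
      thus "r * real (n mod Q) \<le> real c0" unfolding c0_def by linarith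
    qed
    finally have "nat \<lceil>r * real n\<rceil> \<le> n div Q * (W * p) + c0" by linarith
    thus "ex_conv (?i n) (?j n)"
      unfolding tpow_tpow[OF \<sigma>] tensor_tpow[OF \<sigma>] by (rule ex_conv_tpow_le[OF \<sigma>])
  qed
  show ?thesis
    by (rule aconv_trans[OF kf kg kj fg aconv_trans[OF kg kh kj gh aconv_trans[OF kh ki kj hi ij]]])
qed

lemma achievable_zero:
  assumes "kstate k \<rho>" "kstate k \<sigma>"
  shows "achievable k \<rho> \<sigma> 0"
  unfolding achievable_iff_aconv[OF assms]
proof (intro conjI allI impI)
  fix \<delta> :: real
  show "aconv (\<lambda>n. tensor_st (tpow \<rho> n) (tpow (GHZ k) (nat \<lfloor>\<delta> * real n\<rfloor>))) (\<lambda>n. tpow \<sigma> (nat \<lceil>0 * real n\<rceil>))"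
  proof (rule aconv_if_ex_conv[OF kstate_tpow[OF assms(2)]], rule always_eventually, rule allI)
    fix n
    have "tpow \<sigma> (nat \<lceil>0 * real n\<rceil>) = unit_st k" using kstateD(1)[OF assms(2)] by simp
    thus "ex_conv (tensor_st (tpow \<rho> n) (tpow (GHZ k) (nat \<lfloor>\<delta> * real n\<rfloor>))) (tpow \<sigma> (nat \<lceil>0 * real n\<rceil>))"
      using ex_conv_unit[OF k1 kstate_tensor[OF kstate_tpow[OF assms(1)] kstate_tpow[OF kstate_GHZ[OF k1]]]] by simp
  qed
qed simp

lemma achievable_if_less_monotones:
  assumes \<rho>: "kstate k \<rho>" and \<sigma>: "kstate k \<sigma>" and r: "0 \<le> r" "r < r'"
    and E: "\<And>E. E \<in> monotones k \<Longrightarrow> E \<sigma> \<noteq> 0 \<Longrightarrow> r' \<le> E \<rho> / E \<sigma>"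
  shows "achievable k \<rho> \<sigma> r"
  unfolding achievable_iff_aconv[OF \<rho> \<sigma>]
proof (intro conjI allI impI r(1))
  fix \<delta> :: real assume \<delta>: "\<delta> > 0"
  note G = kstate_GHZ[OF k1]
  interpret ordered_multisets "\<lambda>A B. asym_ge (mprod A) (mprod B)" "{#GHZ k#}" by (rule ordered_states)
  \<comment> \<open>The first bound brings the GHZ consumption \<open>2 / K\<close> below
    \<open>\<delta>\<close>; the second keeps \<open>p / K\<close>, which is at most
    \<open>r + 1 / K\<close>, below \<open>r'\<close>.\<close>
  obtain K :: nat where K: "max (2 / \<delta>) (1 / (r' - r)) < real K" using reals_Archimedean2 by blast
  have "0 < max (2 / \<delta>) (1 / (r' - r))" using \<delta> by (simp add: less_max_iff_disj)
  hence K0: "K > 0" using K by (metis less_trans of_nat_0_less_iff)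
  have K\<delta>: "2 / real K < \<delta>" and Kr: "1 / real K < r' - r" using K K0 \<delta> r(2) by (auto simp: field_simps)
  define p where "p = nat \<lceil>r * real K\<rceil>"
  have p: "r * real K \<le> real p" "real p \<le> r * real K + 1" using r(1) by (auto simp: p_def)
  have "\<not> (\<exists>F. (\<forall>A B. F (A + B) = F A + (F B :: real)) \<and> (\<forall>A B. asym_ge (mprod A) (mprod B) \<longrightarrow> F B \<le> F A) \<and> F {#GHZ k#} = 1
      \<and> real K * F {#\<rho>#} + 1 \<le> real p * F {#\<sigma>#})"
  proof
    assume "\<exists>F. (\<forall>A B. F (A + B) = F A + (F B :: real)) \<and> (\<forall>A B. asym_ge (mprod A) (mprod B) \<longrightarrow> F B \<le> F A) \<and> F {#GHZ k#} = 1
      \<and> real K * F {#\<rho>#} + 1 \<le> real p * F {#\<sigma>#}"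
    then obtain F where F: "(\<lambda>\<rho>. F {#\<rho>#}) \<in> monotones k" and le: "real K * F {#\<rho>#} + 1 \<le> real p * F {#\<sigma>#}"
      using monotone_of_additive by blast
    have nn: "0 \<le> F {#\<rho>#}" "0 \<le> F {#\<sigma>#}" using monotones_nonneg[OF F \<rho>] monotones_nonneg[OF F \<sigma>] by auto
    have "F {#\<sigma>#} \<noteq> 0"
    proof
      assume "F {#\<sigma>#} = 0"
      hence "real K * F {#\<rho>#} + 1 \<le> 0" using le by simp
      thus False using nn(1) mult_nonneg_nonneg[of "real K" "F {#\<rho>#}"] by linarith
    qed
    hence pos: "0 < F {#\<sigma>#}" using nn by simp
    have "r' * F {#\<sigma>#} \<le> F {#\<rho>#}" using E[OF F] pos by (simp add: pos_le_divide_eq)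
    hence "real K * (r' * F {#\<sigma>#}) \<le> real K * F {#\<rho>#}" by (rule mult_left_mono) simp
    moreover have "real K * F {#\<rho>#} < (r * real K + 1) * F {#\<sigma>#}"
      using le mult_right_mono[OF p(2) less_imp_le[OF pos]] by linarith
    moreover have "(r * real K + 1) * F {#\<sigma>#} \<le> real K * r' * F {#\<sigma>#}"
      using Kr K0 pos by (intro mult_right_mono) (auto simp: field_simps)
    ultimately show False by (simp add: mult.assoc)
  qed
  from additive_separation[OF this]
  obtain W where W: "W > 0" "asym_ge (mprod (repeat_mset (W * K) {#\<rho>#} + repeat_mset (2 * W) {#GHZ k#})) (mprod (repeat_mset (W * p) {#\<sigma>#}))"
    by blast
  have filt: "filter_mset (kstate k) (repeat_mset n {#\<tau>#}) = mset (replicate n \<tau>)" if "kstate k \<tau>" for n \<tau>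
    using that by (induction n) auto
  have sets: "\<forall>x\<in>set (replicate (W * K) \<rho>). kstate k x" "\<forall>x\<in>set (replicate (2 * W) (GHZ k)). kstate k x"
    "\<forall>x\<in>set (replicate (W * K) \<rho> @ replicate (2 * W) (GHZ k)). kstate k x" "\<forall>x\<in>set (replicate (W * p) \<sigma>). kstate k x"
    using \<rho> \<sigma> G by auto
  have "filter_mset (kstate k) (repeat_mset (W * K) {#\<rho>#} + repeat_mset (2 * W) {#GHZ k#}) = mset (replicate (W * K) \<rho> @ replicate (2 * W) (GHZ k))"
    unfolding filter_union_mset filt[OF \<rho>] filt[OF G] by simp
  from W(2)[unfolded mprod_equivI[OF this sets(3) filt[OF \<sigma>] sets(4)]]
  have "asym_ge (tensor_st (tpow \<rho> (W * K)) (tpow (GHZ k) (2 * W))) (tpow \<sigma> (W * p))"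
    unfolding lprod_append[OF sets(1,2)] tpow_eq_lprod[OF \<rho>] tpow_eq_lprod[OF \<sigma>] tpow_eq_lprod[OF G] .
  thus "aconv (\<lambda>n. tensor_st (tpow \<rho> n) (tpow (GHZ k) (nat \<lfloor>\<delta> * real n\<rfloor>))) (\<lambda>n. tpow \<sigma> (nat \<lceil>r * real n\<rceil>))"
    by (rule aconv_of_block_conversion[OF \<rho> \<sigma> r(1) W(1) K0 K\<delta> p(1)])
qed

end

theorem mainTheorem4:
  fixes k :: nat and \<rho> \<sigma> :: kstate
  assumes "1 \<le> k" and "kstate k \<rho>" and "kstate k \<sigma>"
  shows "R_LOCCq k \<rho> \<sigma> = Inf {ereal (E \<rho> / E \<sigma>) | E. E \<in> monotones k \<and> E \<sigma> \<noteq> 0}"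
proof (rule antisym)
  show "R_LOCCq k \<rho> \<sigma> \<le> Inf {ereal (E \<rho> / E \<sigma>) | E. E \<in> monotones k \<and> E \<sigma> \<noteq> 0}"
    unfolding R_LOCCq_def
  proof (intro Sup_least Inf_greatest, safe)
    fix r E assume r: "achievable k \<rho> \<sigma> r" and E: "E \<in> monotones k" "E \<sigma> \<noteq> 0"
    have "0 < E \<sigma>" using monotones_nonneg[OF assms(1) E(1) assms(3)] E(2) by simp
    thus "ereal r \<le> ereal (E \<rho> / E \<sigma>)"
      using achievable_le_monotone[OF assms r E(1)] by (simp add: pos_le_divide_eq)
  qed
  show "Inf {ereal (E \<rho> / E \<sigma>) | E. E \<in> monotones k \<and> E \<sigma> \<noteq> 0} \<le> R_LOCCq k \<rho> \<sigma>" (is "?I \<le> _")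
  proof (rule dense_le)
    fix y assume y: "y < ?I"
    have ach: "ereal r \<le> R_LOCCq k \<rho> \<sigma>" if "achievable k \<rho> \<sigma> r" for r
      unfolding R_LOCCq_def using that by (intro Sup_upper) blast
    show "y \<le> R_LOCCq k \<rho> \<sigma>"
    proof (cases "y \<le> 0")
      case True
      thus ?thesis using ach[OF achievable_zero[OF assms]] by (simp add: zero_ereal_def order_trans)
    next
      case False
      then obtain r where yr: "y = ereal r" "0 \<le> r" using y by (cases y) auto
      \<comment> \<open>A real strictly in between leaves the slack that a finite \<open>K\<close>
        needs, and it exists even when the infimum is \<open>\<infinity>\<close>.\<close>
      obtain r' where r': "y < ereal r'" "ereal r' < ?I" using ereal_dense2[OF y] by blast
      have "r' \<le> E \<rho> / E \<sigma>" if "E \<in> monotones k" "E \<sigma> \<noteq> 0" for E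
      proof -
        have "?I \<le> ereal (E \<rho> / E \<sigma>)" by (rule Inf_lower) (use that in blast)
        with r'(2) have "ereal r' < ereal (E \<rho> / E \<sigma>)" by (rule less_le_trans)
        thus ?thesis by simp
      qed
      hence "achievable k \<rho> \<sigma> r"
        using r'(1) yr by (intro achievable_if_less_monotones[OF assms, of r r']) auto
      thus ?thesis using ach yr by simp
    qed
  qed
qed

end
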